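(* In the setting of the context, there exist large enough $r_{Q,R_D}$, and constants $\zeta_\psi>0$ and $\zeta_{\lambda,\ell}>0$ for $1\le\ell\le D-1$ and $\lambda\in I_\ell$, such that if $$C_F\le\zeta_\psi,\qquad \tilde C_{\lambda,\ell}\le\zeta_{\lambda,\ell}\quad(1\le\ell\le D-1,\ \lambda\in I_\ell),$$ then, for every $0\le p\le\varsigma-1$, one can construct a solution $u^{\mathfrak{d}_p}(t,z,\epsilon)$ of $$Q(\partial_z)\sigma_qu^{\mathfrak{d}_p}(t,z,\epsilon)=(\epsilon t)^{d_D}\sigma_q^{\frac{d_D}{k_2}+1}R_D(\partial_z)u^{\mathfrak{d}_p}(t,z,\epsilon)+\sum_{\ell=1}^{D-1}\Big(\sum_{\lambda\in I_\ell}t^{d_{\lambda,\ell}}\epsilon^{\Delta_{\lambda,\ell}}\sigma_q^{\delta_\ell}c_{\lambda,\ell}(z,\epsilon)R_\ell(\partial_z)u^{\mathfrak{d}_p}(t,z,\epsilon)\Big)+\sigma_qf^{\mathfrak{d}_p}(t,z,\epsilon)$$ which defines a holomorphic function on $\mathcal{T}\times H_{\beta'}\times\mathcal{E}_p$, for every $0<\beta'<\beta$.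
   Context: Notation. $q>1$ is real. For $\gamma\in\mathbb{R}$, $\sigma_q^\gamma g(t)=g(q^\gamma t)$ whenever the right-hand side makes sense (acting on $t$), $\sigma_q=\sigma_q^1$. $D(0,r)$ is the open disc, $\overline D(0,r)$ its closure, $\mathbb{C}^\star=\mathbb{C}\setminus\{0\}$, and $c_k(n):=(q^{1/k})^{n(n-1)/2}$. $E_{(\beta,\mu)}$ is the Banach space of continuous $h:\mathbb{R}\to\mathbb{C}$ with $\|h\|_{(\beta,\mu)}=\sup_m(1+|m|)^\mu e^{\beta|m|}|h(m)|<\infty$. $\mathcal{F}^{-1}(h)(z)=(2\pi)^{-1/2}\int_{-\infty}^\infty h(m)e^{izm}dm$, $H_\beta=\{z\in\mathbb{C}:|\Im z|<\beta\}$. For $k>0$: $\Theta_{q^{1/k}}(x)=\sum_{n\in\mathbb{Z}}q^{-n(n-1)/(2k)}x^n$, $\pi_{q^{1/k}}=\frac{\log q}{k}\prod_{n\ge0}(1-q^{-(n+1)/k})^{-1}$, and $\mathcal{L}^\gamma_{q;1/k}(f)(T)=\frac1{\pi_{q^{1/k}}}\int_{L_\gamma}\frac{f(u)}{\Theta_{q^{1/k}}(u/T)}\frac{du}{u}$ with $L_\gamma=(0,\infty)e^{i\gamma}$; the value does not depend on the choice of $\gamma$ with $e^{i\gamma}$ in the sector where $f$ is defined with suitable growth. Function spaces. For an unbounded sector $U_d$ with vertex $0$ and bisecting direction $d$, $\rho>0$, and $\delta>0$ such that the distance from $U_d\cup D(0,\rho)$ to $-\delta$ is positive, $\mathrm{Exp}^d_{(k,\beta,\mu,\alpha,\rho)}$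 is the Banach space of continuous $h$ on $(U_d\cup\overline D(0,\rho))\times\mathbb{R}$, holomorphic in $\tau\in U_d\cup D(0,\rho)$, with norm $\|h\|_{(k,\beta,\mu,\alpha,\rho)}=\sup(1+|m|)^\mu e^{\beta|m|}\exp(-\frac{k\log^2|\tau+\delta|}{2\log q}-\alpha\log|\tau+\delta|)|h(\tau,m)|<\infty$. For an infinite sector $S_d$ of bisecting direction $d$ and a bounded domain $\mathcal{R}_d^b$, $\mathrm{Exp}^d_{(k,\beta,\mu,\nu)}$ is the Banach space of continuous $h$ on $(S_d\cup\overline{\mathcal{R}_d^b})\times\mathbb{R}$, holomorphic in $\tau\in S_d\cup\mathcal{R}_d^b$, with norm $\|h\|_{(k,\beta,\mu,\nu)}=\sup(1+|m|)^\mu e^{\beta|m|}\exp(-\frac{k\log^2|\tau|}{2\log q}-\nu\log|\tau|)|h(\tau,m)|<\infty$. Data. $1\le k_1<k_2$, $D\ge3$, $d_D\ge1$ are integers, $\frac1\kappa=\frac1{k_1}-\frac1{k_2}$. For $1\le\ell\le D-1$: $I_\ell$ is a finite nonempty set of nonnegative integers, $\delta_\ell\ge1$ is an integer, and for $\lambda\in I_\ell$, $d_{\lambda,\ell}\ge1$, $\Delta_{\lambda,\ell}\ge0$ are integers. Assume $\delta_1=1$, $\delta_\ell<\delta_{\ell+1}$ ($1\le\ell\le D-2$), and for all $1\le\ell\le D-1$, $\lambda\in I_\ell$: $\Delta_{\lambda,\ell}\ge d_{\lambda,\ell}$, $\frac{d_{\lambda,\ell}}{k_2}+1\ge\delta_\ell$,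 $\frac{d_D-1}{k_2}+1\ge\delta_\ell$. $Q,R_1,\dots,R_D\in\mathbb{C}[X]$ with $\deg Q\ge\deg R_D\ge\deg R_\ell$ ($1\le\ell\le D-1$), $Q(im)\ne0$, $R_D(im)\neq0$ for $m\in\mathbb{R}$, and $\frac{Q(im)}{R_D(im)}\in S_{Q,R_D}=\{z\in\mathbb{C}:|z|\ge r_{Q,R_D},|\arg z-d_{Q,R_D}|\le\eta_{Q,R_D}\}$ for all $m\in\mathbb{R}$, for some $r_{Q,R_D},\eta_{Q,R_D}>0$ and $d_{Q,R_D}\in\mathbb{R}$. Let $\beta>0$, $\mu>\deg(R_D)+1$, $\epsilon_0>0$, $\rho>0$. The maps $m\mapsto C_{\lambda,\ell}(m,\epsilon)$, $m\mapsto F_n(m,\epsilon)$ ($n\ge0$) lie in $E_{(\beta,\mu)}$, depend holomorphically on $\epsilon\in D(0,\epsilon_0)$, and there are constants $\tilde C_{\lambda,\ell},C_F>0$ with $\|C_{\lambda,\ell}(\cdot,\epsilon)\|_{(\beta,\mu)}\le\tilde C_{\lambda,\ell}$, $\|F_n(\cdot,\epsilon)\|_{(\beta,\mu)}\le C_F\rho^{-n}q^{n(n-1)/(2k_1)}$ for all $\epsilon\in D(0,\epsilon_0)$. Put $c_{\lambda,\ell}(z,\epsilon)=\mathcal{F}^{-1}(m\mapsto C_{\lambda,\ell}(m,\epsilon))(z)$. Good covering. For an integer $\varsigma\ge2$, $(\mathcal{E}_p)_{0\le p\le\varsigma-1}$ is a good covering in $\mathbb{C}^\star$: each $\mathcal{E}_p$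 is an open sector with vertex $0$ and radius $\epsilon_0$, $\mathcal{E}_j\cap\mathcal{E}_k\ne\emptyset$ if and only if $|j-k|\le1$ (indices cyclic, $\mathcal{E}_\varsigma:=\mathcal{E}_0$), and $\bigcup_p\mathcal{E}_p=\mathcal{U}\setminus\{0\}$ for some neighborhood $\mathcal{U}$ of $0$. Associated family. $\mathcal{T}$ is an open bounded sector with vertex $0$ and radius $r_{\mathcal{T}}>0$, $\tilde\delta>0$. For each $0\le p\le\varsigma-1$, $U_{\mathfrak{d}_p}$ and $S_{\mathfrak{d}_p}$ are unbounded sectors with vertex $0$ and bisecting direction $\mathfrak{d}_p\in\mathbb{R}$; $\delta>0$ is such that $-\delta$ has positive distance to each $U_{\mathfrak{d}_p}\cup D(0,\rho)$; $\mathcal{R}_{\mathfrak{d}_p,\tilde\delta}=\{T\in\mathbb{C}^\star:|1+e^{i\mathfrak{d}_p}r/T|>\tilde\delta\text{ for every }r\ge0\}$ and $\mathcal{R}^b_{\mathfrak{d}_p}=\mathcal{R}_{\mathfrak{d}_p,\tilde\delta}\cap D(0,\epsilon_0r_{\mathcal{T}})$. Assume $0<\epsilon_0,r_{\mathcal{T}}<1$, $\nu+\frac{k_2}{\log q}\log r_{\mathcal{T}}<0$, $\alpha+\frac{\kappa}{\log q}\log(\epsilon_0r_{\mathcal{T}})<0$, $\epsilon_0r_{\mathcal{T}}\le q^{(\frac12-\nu)/k_2}/2$ (with $\alpha,\nu$ introduced below). Let $q_l(m)$, $0\le l\le d_D-1$, be the roots of $P_m(\tau)=\frac{Q(im)}{c_{k_2}(k_2)}-\frac{R_D(im)}{c_{k_2}(d_D+k_2)}\tau^{d_D}$.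 Assume: (1) there is $M_1>0$ with $|\tau-q_l(m)|\ge M_1(1+|\tau|)$ for all $0\le l\le d_D-1$, $m\in\mathbb{R}$, $0\le p\le\varsigma-1$, $\tau\in S_{\mathfrak{d}_p}\cup\overline D(0,\rho)$; (2) there are $M_2>0$ and $l_0\in\{0,\dots,d_D-1\}$ with $|\tau-q_{l_0}(m)|\ge M_2|q_{l_0}(m)|$ for all $m\in\mathbb{R}$, $0\le p\le\varsigma-1$, $\tau\in S_{\mathfrak{d}_p}\cup\overline D(0,\rho)$; (3) for every $0\le p\le\varsigma-1$, $\mathcal{R}^b_{\mathfrak{d}_p}\cap\mathcal{R}^b_{\mathfrak{d}_{p+1}}\ne\emptyset$ (with $\mathcal{R}^b_{\mathfrak{d}_\varsigma}:=\mathcal{R}^b_{\mathfrak{d}_0}$) and $\epsilon t\in\mathcal{R}^b_{\mathfrak{d}_p}$ for all $t\in\mathcal{T}$, $\epsilon\in\mathcal{E}_p$. Forcing term. The series $\psi_{k_1}(\tau,m,\epsilon)=\sum_{n\ge0}F_n(m,\epsilon)\tau^n/c_{k_1}(n)$, convergent on $D(0,\rho)$, is assumed to extend analytically in $\tau$ to $U_{\mathfrak{d}_p}$ as $\psi_{k_1}^{\mathfrak{d}_p}\in\mathrm{Exp}^{\mathfrak{d}_p}_{(k_1,\beta,\mu,\alpha,\rho)}$ for some $\alpha>0$, with $\|\psi_{k_1}^{\mathfrak{d}_p}(\tau,m,\epsilon)\|_{(k_1,\beta,\mu,\alpha,\rho)}\le\zeta_{\psi_{k_1}}$ for some $\zeta_{\psi_{k_1}}>0$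 not depending on $\epsilon\in D(0,\epsilon_0)$. Then (the opening of $S_{\mathfrak{d}_p}$ being reduced if needed, without loss of generality) $\psi_{k_2}^{\mathfrak{d}_p}(\tau,m,\epsilon):=\mathcal{L}^{\mathfrak{d}_p}_{q;1/\kappa}(h\mapsto\psi_{k_1}^{\mathfrak{d}_p}(h,m,\epsilon))(\tau)$ lies in $\mathrm{Exp}^{\mathfrak{d}_p}_{(k_2,\beta,\mu,\nu)}$ for some $\nu\in\mathbb{R}$, with norm bounded uniformly in $\epsilon\in D(0,\epsilon_0)$. Put $F^{\mathfrak{d}_p}(T,m,\epsilon)=\mathcal{L}^{\mathfrak{d}_p}_{q;1/k_2}(\tau\mapsto\psi_{k_2}^{\mathfrak{d}_p}(\tau,m,\epsilon))(T)$, holomorphic in $T\in\mathcal{R}_{\mathfrak{d}_p,\tilde\delta}\cap D(0,r_1)$ for any $0<r_1\le q^{(\frac12-\nu)/k_2}/2$, and $f^{\mathfrak{d}_p}(t,z,\epsilon)=\mathcal{F}^{-1}(m\mapsto F^{\mathfrak{d}_p}(\epsilon t,m,\epsilon))(z)$, which is bounded and holomorphic on $\mathcal{T}\times H_{\beta'}\times\mathcal{E}_p$ for $0<\beta'<\beta$. *)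

theory Defs
  imports "HOL-Analysis.Analysis"
begin

text \<open>Arguments are never taken through a fixed branch: a point lies in a sector when it can be
  written with some argument in the required range.\<close>

definition sector :: "real \<Rightarrow> real \<Rightarrow> complex set" where
  "sector d \<theta> = {of_real r * cis (d + \<phi>) | r \<phi>. 0 < r \<and> \<bar>\<phi>\<bar> < \<theta>}"

definition unbounded_sector :: "real \<Rightarrow> complex set \<Rightarrow> bool" where
  "unbounded_sector d S \<longleftrightarrow> (\<exists>\<theta>. 0 < \<theta> \<and> \<theta> \<le> pi \<and> S = sector d \<theta>)"

definition bounded_sector :: "real \<Rightarrow> complex set \<Rightarrow> bool" where
  "bounded_sector r S \<longleftrightarrow> (\<exists>d \<theta>. 0 < \<theta> \<and> \<theta> \<le> pi \<and> S = sector d \<theta> \<inter> ball 0 r)"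

definition outer_closed_sector :: "real \<Rightarrow> real \<Rightarrow> real \<Rightarrow> complex set" where
  "outer_closed_sector r d \<eta> = {of_real s * cis (d + \<phi>) | s \<phi>. r \<le> s \<and> \<bar>\<phi>\<bar> \<le> \<eta>}"

definition strip :: "real \<Rightarrow> complex set" where
  "strip b = {z. \<bar>Im z\<bar> < b}"

definition R_dom :: "real \<Rightarrow> real \<Rightarrow> complex set" where
  "R_dom d \<delta>t = {T. T \<noteq> 0 \<and> (\<forall>r\<ge>0. cmod (1 + cis d * of_real r / T) > \<delta>t)}"

definition good_covering :: "real \<Rightarrow> nat \<Rightarrow> (nat \<Rightarrow> complex set) \<Rightarrow> bool" where
  "good_covering \<epsilon>0 s E \<longleftrightarrow>
     2 \<le> s \<and> (\<forall>p<s. bounded_sector \<epsilon>0 (E p)) \<and>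
     (\<forall>j<s. \<forall>k<s. E j \<inter> E k \<noteq> {} \<longleftrightarrow> j = k \<or> k = Suc j mod s \<or> j = Suc k mod s) \<and>
     (\<exists>U. 0 \<in> interior U \<and> (\<Union>p<s. E p) = U - {0})"


definition sigma_q :: "real \<Rightarrow> real \<Rightarrow> (complex \<Rightarrow> complex) \<Rightarrow> complex \<Rightarrow> complex" where
  "sigma_q q \<gamma> g t = g (of_real (q powr \<gamma>) * t)"

definition diff_op :: "complex poly \<Rightarrow> (complex \<Rightarrow> complex) \<Rightarrow> complex \<Rightarrow> complex" where
  "diff_op Q g z = (\<Sum>j\<le>degree Q. coeff Q j * (deriv ^^ j) g z)"

definition cq :: "real \<Rightarrow> real \<Rightarrow> nat \<Rightarrow> real" where
  "cq q k n = (q powr (1 / k)) powr (real n * (real n - 1) / 2)"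


definition inv_fourier :: "(real \<Rightarrow> complex) \<Rightarrow> complex \<Rightarrow> complex" where
  "inv_fourier h z = (LINT m|lborel. h m * exp (\<i> * z * of_real m)) / of_real (sqrt (2 * pi))"

definition jacobi_theta :: "real \<Rightarrow> real \<Rightarrow> complex \<Rightarrow> complex" where
  "jacobi_theta q k x =
     (\<Sum>\<^sub>\<infinity>n\<in>(UNIV :: int set). of_real (q powr (- (of_int n * (of_int n - 1)) / (2 * k))) * x powi n)"

definition pi_q :: "real \<Rightarrow> real \<Rightarrow> real" where
  "pi_q q k = ln q / k * (\<Prod>n. inverse (1 - q powr (- (real n + 1) / k)))"

text \<open>The ray \<open>(0,\<infinity>) e\<^sup>i\<^sup>\<gamma>\<close> is parametrized by \<open>u = r e\<^sup>i\<^sup>\<gamma>\<close>, so that \<open>du/u = dr/r\<close>.\<close>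

definition q_laplace :: "real \<Rightarrow> real \<Rightarrow> real \<Rightarrow> (complex \<Rightarrow> complex) \<Rightarrow> complex \<Rightarrow> complex" where
  "q_laplace q k \<gamma> f T =
     (LINT r:{0<..}|lborel.
        f (of_real r * cis \<gamma>) / jacobi_theta q k (of_real r * cis \<gamma> / T) / of_real r)
     / of_real (pi_q q k)"


text \<open>Norms take values in the extended nonnegative reals; membership requires finiteness.\<close>

definition E_norm :: "real \<Rightarrow> real \<Rightarrow> (real \<Rightarrow> complex) \<Rightarrow> ennreal" where
  "E_norm \<beta> \<mu> h = (SUP m. ennreal ((1 + \<bar>m\<bar>) powr \<mu> * exp (\<beta> * \<bar>m\<bar>) * cmod (h m)))"

definition E_space :: "real \<Rightarrow> real \<Rightarrow> (real \<Rightarrow> complex) set" where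
  "E_space \<beta> \<mu> = {h. continuous_on UNIV h \<and> E_norm \<beta> \<mu> h < \<infinity>}"

definition Exp1_norm ::
    "real \<Rightarrow> complex set \<Rightarrow> real \<Rightarrow> real \<Rightarrow> real \<Rightarrow> real \<Rightarrow> real \<Rightarrow> real
      \<Rightarrow> (complex \<Rightarrow> real \<Rightarrow> complex) \<Rightarrow> ennreal" where
  "Exp1_norm q U \<delta> k \<beta> \<mu> \<alpha> \<rho> h =
     (SUP (\<tau>, m) \<in> (U \<union> cball 0 \<rho>) \<times> UNIV.
        ennreal ((1 + \<bar>m\<bar>) powr \<mu> * exp (\<beta> * \<bar>m\<bar>)
          * exp (- k * (ln (cmod (\<tau> + of_real \<delta>)))\<^sup>2 / (2 * ln q)
                 - \<alpha> * ln (cmod (\<tau> + of_real \<delta>)))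
          * cmod (h \<tau> m)))"

definition Exp1_space ::
    "real \<Rightarrow> complex set \<Rightarrow> real \<Rightarrow> real \<Rightarrow> real \<Rightarrow> real \<Rightarrow> real \<Rightarrow> real
      \<Rightarrow> (complex \<Rightarrow> real \<Rightarrow> complex) set" where
  "Exp1_space q U \<delta> k \<beta> \<mu> \<alpha> \<rho> =
     {h. continuous_on ((U \<union> cball 0 \<rho>) \<times> UNIV) (\<lambda>(\<tau>, m). h \<tau> m) \<and>
         (\<forall>m. (\<lambda>\<tau>. h \<tau> m) holomorphic_on (U \<union> ball 0 \<rho>)) \<and>
         Exp1_norm q U \<delta> k \<beta> \<mu> \<alpha> \<rho> h < \<infinity>}"

text \<open>The weight tends to 0 as \<open>\<tau> \<rightarrow> 0\<close>, so \<open>\<tau> = 0\<close>, where \<open>ln 0 = 0\<close> would produce the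
  wrong weight 1, contributes nothing to the supremum and is left out.\<close>

definition Exp2_norm ::
    "real \<Rightarrow> complex set \<Rightarrow> complex set \<Rightarrow> real \<Rightarrow> real \<Rightarrow> real \<Rightarrow> real
      \<Rightarrow> (complex \<Rightarrow> real \<Rightarrow> complex) \<Rightarrow> ennreal" where
  "Exp2_norm q S Rb k \<beta> \<mu> \<nu> h =
     (SUP (\<tau>, m) \<in> (S \<union> closure Rb - {0}) \<times> UNIV.
        ennreal ((1 + \<bar>m\<bar>) powr \<mu> * exp (\<beta> * \<bar>m\<bar>)
          * exp (- k * (ln (cmod \<tau>))\<^sup>2 / (2 * ln q) - \<nu> * ln (cmod \<tau>))
          * cmod (h \<tau> m)))"

definition Exp2_space ::
    "real \<Rightarrow> complex set \<Rightarrow> complex set \<Rightarrow> real \<Rightarrow> real \<Rightarrow> real \<Rightarrow> real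
      \<Rightarrow> (complex \<Rightarrow> real \<Rightarrow> complex) set" where
  "Exp2_space q S Rb k \<beta> \<mu> \<nu> =
     {h. continuous_on ((S \<union> closure Rb) \<times> UNIV) (\<lambda>(\<tau>, m). h \<tau> m) \<and>
         (\<forall>m. (\<lambda>\<tau>. h \<tau> m) holomorphic_on (S \<union> Rb)) \<and>
         Exp2_norm q S Rb k \<beta> \<mu> \<nu> h < \<infinity>}"


definition P_fun ::
    "real \<Rightarrow> nat \<Rightarrow> nat \<Rightarrow> complex poly \<Rightarrow> complex poly \<Rightarrow> real \<Rightarrow> complex \<Rightarrow> complex" where
  "P_fun q k2 dD Q RD m \<tau> =
     poly Q (\<i> * of_real m) / of_real (cq q (real k2) k2)
     - poly RD (\<i> * of_real m) / of_real (cq q (real k2) (dD + k2)) * \<tau> ^ dD"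

definition psi_k2 ::
    "real \<Rightarrow> real \<Rightarrow> real \<Rightarrow> (complex \<Rightarrow> real \<Rightarrow> complex \<Rightarrow> complex)
      \<Rightarrow> complex \<Rightarrow> real \<Rightarrow> complex \<Rightarrow> complex" where
  "psi_k2 q \<kappa> d \<psi> \<tau> m \<epsilon> = q_laplace q \<kappa> d (\<lambda>h. \<psi> h m \<epsilon>) \<tau>"

definition F_forcing ::
    "real \<Rightarrow> real \<Rightarrow> nat \<Rightarrow> real \<Rightarrow> (complex \<Rightarrow> real \<Rightarrow> complex \<Rightarrow> complex)
      \<Rightarrow> complex \<Rightarrow> real \<Rightarrow> complex \<Rightarrow> complex" where
  "F_forcing q \<kappa> k2 d \<psi> T m \<epsilon> = q_laplace q (real k2) d (\<lambda>\<tau>. psi_k2 q \<kappa> d \<psi> \<tau> m \<epsilon>) T"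

definition f_forcing ::
    "real \<Rightarrow> real \<Rightarrow> nat \<Rightarrow> real \<Rightarrow> (complex \<Rightarrow> real \<Rightarrow> complex \<Rightarrow> complex)
      \<Rightarrow> complex \<Rightarrow> complex \<Rightarrow> complex \<Rightarrow> complex" where
  "f_forcing q \<kappa> k2 d \<psi> t z \<epsilon> = inv_fourier (\<lambda>m. F_forcing q \<kappa> k2 d \<psi> (\<epsilon> * t) m \<epsilon>) z"

text \<open>Complex (Frechet) differentiability in three variables at every point; the
  sets of interest are open.\<close>

definition holomorphic3_on ::
    "(complex \<Rightarrow> complex \<Rightarrow> complex \<Rightarrow> complex) \<Rightarrow> (complex \<times> complex \<times> complex) set \<Rightarrow> bool" where
  "holomorphic3_on u A \<longleftrightarrow>
     (\<forall>x\<in>A. \<exists>a b c.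
        ((\<lambda>(t, z, \<epsilon>). u t z \<epsilon>) has_derivative (\<lambda>(v, w, e). a * v + b * w + c * e)) (at x within A))"

text \<open>As \<open>q > 1\<close>, the dilations \<open>t \<mapsto> q\<^sup>\<gamma> t\<close> may lead out of the bounded sector \<open>TT\<close> where
  the unknown lives; the equation is required at every \<open>t\<close> at which all its terms make sense,
  i.e. all the dilated points lie in \<open>TT\<close>.\<close>

definition solves_equation ::
    "real \<Rightarrow> nat \<Rightarrow> nat \<Rightarrow> nat \<Rightarrow> (nat \<Rightarrow> nat) \<Rightarrow> (nat \<Rightarrow> nat set) \<Rightarrow> (nat \<Rightarrow> nat \<Rightarrow> nat)
      \<Rightarrow> (nat \<Rightarrow> nat \<Rightarrow> nat) \<Rightarrow> complex poly \<Rightarrow> (nat \<Rightarrow> complex poly)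
      \<Rightarrow> (nat \<Rightarrow> nat \<Rightarrow> complex \<Rightarrow> complex \<Rightarrow> complex) \<Rightarrow> (complex \<Rightarrow> complex \<Rightarrow> complex \<Rightarrow> complex)
      \<Rightarrow> complex set \<Rightarrow> complex set \<Rightarrow> complex set
      \<Rightarrow> (complex \<Rightarrow> complex \<Rightarrow> complex \<Rightarrow> complex) \<Rightarrow> bool" where
  "solves_equation q k2 D dD \<delta>s I d \<Delta> Q R c f TT H E u \<longleftrightarrow>
     (\<forall>t\<in>TT. \<forall>z\<in>H. \<forall>\<epsilon>\<in>E.
        (\<forall>\<gamma> \<in> {1, real dD / real k2 + 1} \<union> (\<lambda>l. real (\<delta>s l)) ` {1..D-1}.
            of_real (q powr \<gamma>) * t \<in> TT) \<longrightarrow>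
        diff_op Q (\<lambda>z. sigma_q q 1 (\<lambda>t. u t z \<epsilon>) t) z =
          (\<epsilon> * t) ^ dD
            * sigma_q q (real dD / real k2 + 1) (\<lambda>t. diff_op (R D) (\<lambda>z. u t z \<epsilon>) z) t
          + (\<Sum>l=1..D-1. \<Sum>j\<in>I l.
               t ^ d j l * \<epsilon> ^ \<Delta> j l
               * sigma_q q (real (\<delta>s l)) (\<lambda>t. c j l z \<epsilon> * diff_op (R l) (\<lambda>z. u t z \<epsilon>) z) t)
          + sigma_q q 1 (\<lambda>t. f t z \<epsilon>) t)"

end

theory Submission
  imports Defs "HOL-Complex_Analysis.Complex_Analysis"
    "HOL-Computational_Algebra.Fundamental_Theorem_Algebra"
begin

text \<open>The equation is solved on the Borel side, along the single ray \<open>\<tau> = r e\<^sup>i\<^sup>d\<close>, \<open>r > 0\<close>, of each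
  direction. The unknown is sought as \<open>u = F\<^sup>-\<^sup>1 (m \<mapsto> U (\<epsilon> t, m, \<epsilon>))\<close> with \<open>U\<close> the q-Laplace
  transform (with parameter \<open>k = k2\<close>) of a function \<open>w (\<tau>, m, \<epsilon>)\<close>. The theta function in the
  Laplace kernel satisfies a first-order q-difference equation; hence a substitution in the radial
  variable turns \<open>T\<^sup>n\<close> times the dilation by \<open>q\<^sup>a\<close> into multiplication by a constant times
  \<open>\<tau>\<^sup>n\<close> together with the dilation of \<open>w\<close> by \<open>q\<close> to the power \<open>a - 1 - n/k\<close>. The leading terms
  combine to a multiple of \<open>P\<^sub>m (\<tau>)\<close>, multiplication by the coefficients becomes a convolution in
  the Fourier variable \<open>m\<close>, and the assumption \<open>d/k2 + 1 \<ge> \<delta>\<^sub>l\<close> says that \<open>w\<close> is only evaluated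
  at \<open>\<lambda> \<tau>\<close> with \<open>\<lambda> \<le> 1\<close>. Thus, after division by \<open>P\<^sub>m (\<tau>)\<close>, \<open>w\<close> is a fixed point of an affine map.

  This map is a contraction for small coefficients, in the weight \<open>exp (k log\<^sup>2 r / (2 log q) + \<nu> log r)\<close>
  for \<open>r \<ge> 1\<close> and \<open>1\<close> for \<open>r \<le> 1\<close>. Shrinking the argument by \<open>q\<^sup>-\<^sup>x\<close> gains a factor
  \<open>r\<^sup>-\<^sup>k\<^sup>x\<close> in this weight, which reduces \<open>\<tau>\<^sup>d\<close> to the power \<open>k (\<delta>\<^sub>l - 1) < d\<^sub>D\<close>; the
  separation of \<open>\<tau>\<close> from the roots of \<open>P\<^sub>m\<close> bounds \<open>|P\<^sub>m (\<tau>)|\<close> below by a multiple of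
  \<open>|R\<^sub>D (i m)| (1 + |\<tau>|)\<^sup>N\<close> with \<open>N = d\<^sub>D\<close>, which absorbs the rest (\<open>ray_weight_shift\<close>, \<open>P_fun_lower_bound\<close>).
  The factor \<open>R\<^sub>D (i m)\<close> likewise absorbs \<open>R\<^sub>l (i m)\<close> under the convolution, as
  \<open>\<mu> > deg R\<^sub>D + 1\<close> (\<open>fourier_weight_convolution\<close>). The Neumann series is summed pointwise in a class
  of measurable families that are holomorphic in \<open>\<epsilon>\<close> (\<open>weighted_convolution.solution_exists\<close>).

  The forcing term has to be in this class. Its size for \<open>r \<ge> 1\<close> is an assumption; for \<open>r \<le> 1\<close> it is
  bounded directly from the first Laplace integral. Its holomorphy in \<open>\<epsilon>\<close> is clear from the power
  series near \<open>\<tau> = 0\<close> and propagates along the ray (\<open>holomorphic_parameter_propagates\<close>).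

  To transform back, the reciprocal of theta must decay like the reciprocal of the weight on the
  cone where the arguments \<open>\<tau>/T\<close> lie. Jacobi's triple product shows that theta has no zero off the
  negative half-line, and its q-difference equation spreads the bound from a compact annulus to the
  whole cone (\<open>theta_lower_bound\<close>). The bound on \<open>\<epsilon>0 * rT\<close> then makes the Laplace integral converge.
  Fubini's theorem and the product rule for Fourier transforms lead from the equation for \<open>w\<close> to the
  one for \<open>u\<close>. Finally \<open>u\<close> is locally bounded and holomorphic in each of \<open>t\<close>, \<open>z\<close>, \<open>\<epsilon>\<close>
  separately, so it is jointly differentiable by Osgood's lemma.\<close>

section \<open>Holomorphic functions depending on a parameter\<close>

lemma cauchy_bound_deriv:
  assumes "f holomorphic_on ball x r" "r > 0" "\<And>y. y \<in> ball x r \<Longrightarrow> cmod (f y) \<le> M"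
  shows "cmod ((deriv ^^ n) f x) \<le> fact n * M / (r/2)^n"
proof (rule Cauchy_inequality)
  show "f holomorphic_on ball x (r/2)"
    using assms(1) by (rule holomorphic_on_subset) (use assms(2) in auto)
  show "continuous_on (cball x (r/2)) f"
    by (rule holomorphic_on_imp_continuous_on, rule holomorphic_on_subset[OF assms(1)]) (use assms(2) in auto)
  show "cmod (f y) \<le> M" if "cmod (x - y) = r/2" for y
    using that assms(2) by (intro assms(3)) (auto simp: dist_norm)
qed (use assms in auto)

lemma cauchy_lipschitz:
  assumes f: "f holomorphic_on ball x r" and r: "r > 0" and M: "\<And>y. y \<in> ball x r \<Longrightarrow> cmod (f y) \<le> M"
    and y: "y \<in> ball x (r/2)" and z: "z \<in> ball x (r/2)"
  shows "cmod (deriv f y) \<le> 4 * M / r" "cmod (f y - f z) \<le> 4 * M / r * cmod (y - z)"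
proof -
  have sub: "ball w (r/2) \<subseteq> ball x r" if "w \<in> ball x (r/2)" for w
  proof
    fix v assume "v \<in> ball w (r/2)"
    then show "v \<in> ball x r" using that dist_triangle[of x v w] by simp
  qed
  have D: "cmod (deriv f w) \<le> 4 * M / r" if w: "w \<in> ball x (r/2)" for w
  proof -
    have "cmod ((deriv ^^ 1) f w) \<le> fact 1 * M / (r/2/2)^1"
      by (rule cauchy_bound_deriv) (use f M r sub[OF w] in \<open>auto intro: holomorphic_on_subset\<close>)
    then show ?thesis by (simp add: mult.commute)
  qed
  show "cmod (deriv f y) \<le> 4 * M / r" by (rule D[OF y])
  show "cmod (f y - f z) \<le> 4 * M / r * cmod (y - z)"
  proof (rule field_differentiable_bound[of "ball x (r/2)" f "deriv f"])
    fix w assume w: "w \<in> ball x (r/2)"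
    have "w \<in> ball x r" using w r by auto
    then have "f field_differentiable at w"
      using f by (metis at_within_open holomorphic_on_def open_ball)
    then show "(f has_field_derivative deriv f w) (at w within ball x (r/2))"
      using field_differentiable_derivI has_field_derivative_at_within by blast
  qed (use D y z in auto)
qed

text \<open>The constant depends on \<open>f\<close> only through the bound \<open>M\<close>, so for a bounded family of functions
  difference quotients converge uniformly over the family.\<close>

lemma cauchy_taylor1:
  assumes f: "f holomorphic_on ball x r" and r: "r > 0" and M: "\<And>y. y \<in> ball x r \<Longrightarrow> cmod (f y) \<le> M"
    and h: "cmod h < r/4"
  shows "cmod (f (x+h) - f x - deriv f x * h) \<le> 32 * M / r^2 * cmod h ^ 2"
proof -
  have f': "deriv f holomorphic_on ball x (r/2)"
    by (rule holomorphic_deriv[OF holomorphic_on_subset[OF f]]) (use r in auto)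
  have L: "cmod (deriv f y - deriv f x) \<le> 32 * M / r^2 * cmod (y - x)" if "y \<in> ball x (r/4)" for y
    using cauchy_lipschitz(2)[OF f', of "4*M/r" y x] that cauchy_lipschitz(1)[OF f r M, where z=x] r
    by (auto simp: field_simps power2_eq_square)
  have M0: "M \<ge> 0" using M[of x] r norm_ge_zero order_trans centre_in_ball by meson
  have "cmod ((f (x+h) - deriv f x * (x+h)) - (f x - deriv f x * x)) \<le> (32 * M / r^2 * cmod h) * cmod (x + h - x)"
  proof (rule field_differentiable_bound[of "cball x (cmod h)" _ "\<lambda>y. deriv f y - deriv f x"])
    fix y assume y: "y \<in> cball x (cmod h)"
    then have yb: "y \<in> ball x (r/4)" using h by auto
    then have "y \<in> ball x r" using r by auto
    then have "f field_differentiable at y"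
      using f by (metis at_within_open holomorphic_on_def open_ball)
    then have *: "(f has_field_derivative deriv f y) (at y within cball x (cmod h))"
      using field_differentiable_derivI has_field_derivative_at_within by blast
    show "((\<lambda>y. f y - deriv f x * y) has_field_derivative deriv f y - deriv f x) (at y within cball x (cmod h))"
      by (auto intro!: derivative_eq_intros *)
    have "cmod (deriv f y - deriv f x) \<le> 32 * M / r^2 * cmod (y - x)" by (rule L[OF yb])
    also have "\<dots> \<le> 32 * M / r^2 * cmod h"
      using y M0 by (intro mult_left_mono) (auto simp: dist_norm norm_minus_commute)
    finally show "cmod (deriv f y - deriv f x) \<le> 32 * M / r^2 * cmod h" .
  qed (auto simp: dist_norm)
  then show ?thesis by (simp add: power2_eq_square algebra_simps)
qed

text \<open>Differentiation under the integral sign: by Cauchy's estimate the dominating function of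
  \<open>f\<close> also dominates, up to a constant, the difference quotients in \<open>z\<close>.\<close>

lemma
  fixes f :: "complex \<Rightarrow> 'a \<Rightarrow> complex"
  assumes B: "open B"
    and meas: "\<And>z. z \<in> B \<Longrightarrow> f z \<in> borel_measurable M"
    and hol: "\<And>x. (\<lambda>z. f z x) holomorphic_on B"
    and dom: "\<And>z. z \<in> B \<Longrightarrow> \<exists>r g. 0 < r \<and> ball z r \<subseteq> B \<and> integrable M g \<and> (\<forall>w\<in>ball z r. \<forall>x. cmod (f w x) \<le> g x)"
  shows holomorphic_lebesgue_integral: "(\<lambda>z. integral\<^sup>L M (f z)) holomorphic_on B"
    and deriv_lebesgue_integral:
      "z \<in> B \<Longrightarrow> deriv (\<lambda>z. integral\<^sup>L M (f z)) z = (\<integral>x. deriv (\<lambda>z. f z x) z \<partial>M)"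
proof -
  have *: "((\<lambda>z. integral\<^sup>L M (f z)) has_field_derivative (\<integral>x. deriv (\<lambda>z. f z x) z \<partial>M)) (at z)"
    if z: "z \<in> B" for z
  proof -
    obtain r g where rg: "0 < r \<and> ball z r \<subseteq> B \<and> integrable M g \<and> (\<forall>w\<in>ball z r. \<forall>x. cmod (f w x) \<le> g x)"
      using dom[OF z] by (elim exE)
    then have r: "r > 0" "ball z r \<subseteq> B" and g: "integrable M g" by simp_all
    have b: "cmod (f w x) \<le> g x" if "w \<in> ball z r" for w x
      using that rg by simp
    have int: "integrable M (f w)" if "w \<in> ball z r" for w
    proof (rule Bochner_Integration.integrable_bound[OF g])
      show "f w \<in> borel_measurable M" using meas that r by blast
      show "AE x in M. cmod (f w x) \<le> norm (g x)"
        by (intro AE_I2 order_trans[OF b[OF that]]) simp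
    qed
    have holb: "(\<lambda>w. f w x) holomorphic_on ball z r" for x
      using holomorphic_on_subset[OF hol r(2)] .
    have dq: "((\<lambda>h. (f (z+h) x - f z x) / h) \<longlongrightarrow> deriv (\<lambda>w. f w x) z) (at 0)" for x
    proof -
      have "(\<lambda>w. f w x) field_differentiable at z"
        using hol[of x] z B by (metis at_within_open holomorphic_on_def)
      then show ?thesis by (rule DERIV_D[OF iffD2[OF DERIV_deriv_iff_field_differentiable]])
    qed
    have "((\<lambda>h. (integral\<^sup>L M (f (z+h)) - integral\<^sup>L M (f z)) / h) \<longlongrightarrow> (\<integral>x. deriv (\<lambda>z. f z x) z \<partial>M)) (at 0)"
      unfolding tendsto_at_iff_sequentially
    proof (intro allI impI)
      fix X :: "nat \<Rightarrow> complex" assume X0: "\<forall>i. X i \<in> UNIV - {0}" and X: "X \<longlonglongrightarrow> 0"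
      have "\<forall>\<^sub>F n in sequentially. cmod (X n) < r/2"
        using tendstoD[OF X, of "r/2"] r by (simp add: dist_norm)
      then obtain N where N: "\<And>n. n \<ge> N \<Longrightarrow> cmod (X n) < r/2" by (auto simp: eventually_sequentially)
      define Y where "Y n = X (n + N)" for n
      have Y: "Y \<longlonglongrightarrow> 0" "Y n \<noteq> 0" "cmod (Y n) < r/2" for n
        using LIMSEQ_ignore_initial_segment[OF X, of N] X0 N unfolding Y_def by auto
      have Yb: "z + Y n \<in> ball z (r/2)" "z + Y n \<in> ball z r" for n
        using Y(3)[of n] r by (auto simp: dist_norm)
      have F: "(integral\<^sup>L M (f (z+Y n)) - integral\<^sup>L M (f z)) / Y n = (\<integral>x. (f (z+Y n) x - f z x) / Y n \<partial>M)" for n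
        using int[of "z + Y n"] int[of z] Yb r by simp
      have "(\<lambda>n. \<integral>x. (f (z+Y n) x - f z x) / Y n \<partial>M) \<longlonglongrightarrow> (\<integral>x. deriv (\<lambda>z. f z x) z \<partial>M)"
      proof (rule integral_dominated_convergence)
        have m: "(\<lambda>x. (f (z+Y n) x - f z x) / Y n) \<in> borel_measurable M" for n
          using meas[OF subsetD[OF r(2) Yb(2)[of n]]] meas[OF z] by measurable
        have l: "(\<lambda>n. (f (z+Y n) x - f z x) / Y n) \<longlonglongrightarrow> deriv (\<lambda>z. f z x) z" for x
          using dq[of x] Y unfolding tendsto_at_iff_sequentially by (auto simp: o_def)
        show "(\<lambda>x. deriv (\<lambda>z. f z x) z) \<in> borel_measurable M"
          by (rule borel_measurable_LIMSEQ_metric[OF m l])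
        show "(\<lambda>x. (f (z+Y n) x - f z x) / Y n) \<in> borel_measurable M" for n by (rule m)
        show "integrable M (\<lambda>x. 4 / r * g x)" using g by simp
        show "AE x in M. (\<lambda>n. (f (z+Y n) x - f z x) / Y n) \<longlonglongrightarrow> deriv (\<lambda>z. f z x) z" using l by simp
        show "AE x in M. cmod ((f (z+Y n) x - f z x) / Y n) \<le> 4 / r * g x" for n
        proof (rule AE_I2)
          fix x
          have "cmod (f (z + Y n) x - f z x) \<le> 4 * g x / r * cmod (Y n)"
            using cauchy_lipschitz(2)[OF holb r(1) b, of "z+Y n" z x] Yb r by simp
          then show "cmod ((f (z+Y n) x - f z x) / Y n) \<le> 4 / r * g x"
            using Y(2)[of n] by (simp add: norm_divide divide_le_eq)
        qed
      qed
      then have "(\<lambda>n. (integral\<^sup>L M (f (z+Y n)) - integral\<^sup>L M (f z)) / Y n) \<longlonglongrightarrow> (\<integral>x. deriv (\<lambda>z. f z x) z \<partial>M)"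
        by (simp add: F)
      then show "((\<lambda>h. (integral\<^sup>L M (f (z+h)) - integral\<^sup>L M (f z)) / h) \<circ> X) \<longlonglongrightarrow> (\<integral>x. deriv (\<lambda>z. f z x) z \<partial>M)"
        unfolding Y_def o_def by (rule LIMSEQ_offset[where k=N])
    qed
    then show ?thesis by (simp add: DERIV_def)
  qed
  show "(\<lambda>z. integral\<^sup>L M (f z)) holomorphic_on B"
    by (rule holomorphic_onI) (use * field_differentiable_def has_field_derivative_at_within in metis)
  show "deriv (\<lambda>z. integral\<^sup>L M (f z)) z = (\<integral>x. deriv (\<lambda>z. f z x) z \<partial>M)" if "z \<in> B"
    using *[OF that] by (rule DERIV_imp_deriv)
qed

text \<open>Osgood's lemma. The three coordinates are displaced one after the other, with a quadratic Taylor
  remainder each. The derivative with respect to one coordinate is then taken at a point where the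
  later coordinates are already displaced; it differs from the one at the centre by a multiple of the
  displacement \<open>N\<close>, because it is the derivative of a difference of two functions, which is
  \<open>O(N)\<close> on a whole disc by the Lipschitz estimate.\<close>

lemma osgood_has_derivative:
  fixes f :: "complex \<Rightarrow> complex \<Rightarrow> complex \<Rightarrow> complex"
  assumes r: "r > 0"
    and h1: "\<And>y z. y \<in> ball b r \<Longrightarrow> z \<in> ball c r \<Longrightarrow> (\<lambda>x. f x y z) holomorphic_on ball a r"
    and h2: "\<And>x z. x \<in> ball a r \<Longrightarrow> z \<in> ball c r \<Longrightarrow> (\<lambda>y. f x y z) holomorphic_on ball b r"
    and h3: "\<And>x y. x \<in> ball a r \<Longrightarrow> y \<in> ball b r \<Longrightarrow> (\<lambda>z. f x y z) holomorphic_on ball c r"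
    and M: "\<And>x y z. x \<in> ball a r \<Longrightarrow> y \<in> ball b r \<Longrightarrow> z \<in> ball c r \<Longrightarrow> cmod (f x y z) \<le> M"
  shows "\<exists>A B C. ((\<lambda>(x,y,z). f x y z) has_derivative (\<lambda>(v,w,e). A * v + B * w + C * e)) (at (a,b,c))"
proof -
  have M0: "M \<ge> 0" using M[of a b c] r norm_ge_zero order_trans centre_in_ball by meson
  define A where "A = deriv (\<lambda>x. f x b c) a"
  define B where "B = deriv (\<lambda>y. f a y c) b"
  define C where "C = deriv (\<lambda>z. f a b z) c"
  define K where "K = 64 * M / r^2"
  have K0: "K \<ge> 0" using M0 by (simp add: K_def)
  have main: "cmod (f (a+v) (b+w) (c+e) - f a b c - (A * v + B * w + C * e))
      \<le> 12 * K * (norm (v,w,e))^2" if n: "norm (v,w,e) < r/4" for v w e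
  proof -
    define N where "N = norm (v,w,e)"
    have vN: "cmod v \<le> N" "cmod w \<le> N" "cmod e \<le> N" "N \<ge> 0"
      using norm_fst_le[of v "(w,e)"] norm_snd_le[of "(w,e)" v] norm_fst_le[of w e] norm_snd_le[of e w]
      unfolding N_def by (auto intro: order_trans)
    have N4: "N < r/4" using n by (simp add: N_def)
    have inb: "b+w \<in> ball b r" "c+e \<in> ball c r" "a+v \<in> ball a r" "b+w \<in> ball b (r/2)" "c+e \<in> ball c (r/2)"
      "a \<in> ball a r" "b \<in> ball b r" "c \<in> ball c r" "b \<in> ball b (r/2)" "c \<in> ball c (r/2)" "a \<in> ball a (r/2)"
      using vN N4 r by (auto simp: dist_norm)
    have sq: "32 * M / r^2 * cmod x ^ 2 \<le> K * N^2" if "cmod x \<le> N" for x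
      using that M0 unfolding K_def by (intro mult_mono power_mono divide_right_mono) auto
    have t1: "cmod (f (a+v) (b+w) (c+e) - f a (b+w) (c+e) - deriv (\<lambda>x. f x (b+w) (c+e)) a * v) \<le> K * N^2"
      by (rule order_trans[OF cauchy_taylor1[OF h1[OF inb(1,2)] r M[OF _ inb(1,2)]] sq]) (use vN N4 in linarith)+
    have t2: "cmod (f a (b+w) (c+e) - f a b (c+e) - deriv (\<lambda>y. f a y (c+e)) b * w) \<le> K * N^2"
      by (rule order_trans[OF cauchy_taylor1[OF h2[OF inb(6,2)] r M[OF inb(6) _ inb(2)]] sq]) (use vN N4 in linarith)+
    have t3: "cmod (f a b (c+e) - f a b c - deriv (\<lambda>z. f a b z) c * e) \<le> K * N^2"
      by (rule order_trans[OF cauchy_taylor1[OF h3[OF inb(6,7)] r M[OF inb(6,7)]] sq]) (use vN N4 in linarith)+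
    have fd1: "(\<lambda>x. f x y z) field_differentiable at a" if "y \<in> ball b r" "z \<in> ball c r" for y z
      using h1[OF that] inb(6) by (metis at_within_open holomorphic_on_def open_ball)
    have fd2: "(\<lambda>y. f a y z) field_differentiable at b" if "z \<in> ball c r" for z
      using h2[OF inb(6) that] inb(7) by (metis at_within_open holomorphic_on_def open_ball)
    have t4: "cmod (deriv (\<lambda>x. f x (b+w) (c+e)) a - A) \<le> 4 * (2 * K * N)"
    proof -
      have "cmod (f x (b+w) (c+e) - f x b c) \<le> 2 * (4 * M / r * N)" if x: "x \<in> ball a r" for x
      proof -
        have "cmod (f x (b+w) (c+e) - f x b (c+e)) \<le> 4 * M / r * cmod w"
          using cauchy_lipschitz(2)[OF h2[OF x inb(2)] r M[OF x _ inb(2)] inb(4) inb(9)] by simp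
        moreover have "cmod (f x b (c+e) - f x b c) \<le> 4 * M / r * cmod e"
          using cauchy_lipschitz(2)[OF h3[OF x inb(7)] r M[OF x inb(7)] inb(5) inb(10)] by auto
        moreover have "4 * M / r * cmod e \<le> 4 * M / r * N" "4 * M / r * cmod w \<le> 4 * M / r * N"
          using vN M0 r by (auto intro!: mult_left_mono divide_right_mono)
        moreover have "cmod (f x (b+w) (c+e) - f x b c) \<le> cmod (f x (b+w) (c+e) - f x b (c+e)) + cmod (f x b (c+e) - f x b c)"
          using norm_triangle_ineq[of "f x (b+w) (c+e) - f x b (c+e)" "f x b (c+e) - f x b c"] by simp
        ultimately show ?thesis by linarith
      qed
      then have "cmod (deriv (\<lambda>x. f x (b+w) (c+e) - f x b c) a) \<le> 4 * (2 * (4 * M / r * N)) / r"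
        by (intro cauchy_lipschitz(1)[OF _ r _ inb(11) inb(11)] holomorphic_intros h1 inb)
      moreover have "deriv (\<lambda>x. f x (b+w) (c+e) - f x b c) a = deriv (\<lambda>x. f x (b+w) (c+e)) a - A"
        unfolding A_def by (intro deriv_diff fd1 inb)
      moreover have "4 * (2 * (4 * M / r * N)) / r \<le> 4 * (2 * K * N)"
        using M0 r vN unfolding K_def by (simp add: field_simps power2_eq_square)
      ultimately show ?thesis by simp
    qed
    have t5: "cmod (deriv (\<lambda>y. f a y (c+e)) b - B) \<le> K * N"
    proof -
      have "cmod (f a y (c+e) - f a y c) \<le> 4 * M / r * N" if y: "y \<in> ball b r" for y
      proof -
        have "cmod (f a y (c+e) - f a y c) \<le> 4 * M / r * cmod e"
          using cauchy_lipschitz(2)[OF h3[OF inb(6) y] r M[OF inb(6) y] inb(5) inb(10)] by auto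
        moreover have "4 * M / r * cmod e \<le> 4 * M / r * N"
          using vN M0 r by (auto intro!: mult_left_mono divide_right_mono)
        ultimately show ?thesis by linarith
      qed
      then have "cmod (deriv (\<lambda>y. f a y (c+e) - f a y c) b) \<le> 4 * (4 * M / r * N) / r"
        by (intro cauchy_lipschitz(1)[OF _ r _ inb(9) inb(9)] holomorphic_intros h2 inb)
      moreover have "deriv (\<lambda>y. f a y (c+e) - f a y c) b = deriv (\<lambda>y. f a y (c+e)) b - B"
        unfolding B_def by (intro deriv_diff fd2 inb)
      moreover have "4 * (4 * M / r * N) / r \<le> K * N"
        using M0 r vN unfolding K_def by (simp add: field_simps power2_eq_square)
      ultimately show ?thesis by simp
    qed
    have e1: "cmod ((deriv (\<lambda>x. f x (b+w) (c+e)) a - A) * v) \<le> 8 * K * N^2"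
      using mult_mono[OF t4 vN(1)] K0 vN by (simp add: norm_mult power2_eq_square mult_ac)
    have e2: "cmod ((deriv (\<lambda>y. f a y (c+e)) b - B) * w) \<le> K * N^2"
      using mult_mono[OF t5 vN(2)] K0 vN by (simp add: norm_mult power2_eq_square mult_ac)
    have "f (a+v) (b+w) (c+e) - f a b c - (A * v + B * w + C * e) =
       (f (a+v) (b+w) (c+e) - f a (b+w) (c+e) - deriv (\<lambda>x. f x (b+w) (c+e)) a * v)
     + (f a (b+w) (c+e) - f a b (c+e) - deriv (\<lambda>y. f a y (c+e)) b * w)
     + (f a b (c+e) - f a b c - deriv (\<lambda>z. f a b z) c * e)
     + (deriv (\<lambda>x. f x (b+w) (c+e)) a - A) * v + (deriv (\<lambda>y. f a y (c+e)) b - B) * w"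
      by (simp add: C_def algebra_simps)
    then have "cmod (f (a+v) (b+w) (c+e) - f a b c - (A * v + B * w + C * e)) \<le> K*N^2 + K*N^2 + K*N^2 + 8 * K * N^2 + K*N^2"
      by (simp only:) (intro norm_triangle_mono t1 t2 t3 e1 e2)
    also have "\<dots> \<le> 12 * K * N^2" by simp
    finally have *: "cmod (f (a+v) (b+w) (c+e) - f a b c - (A * v + B * w + C * e)) \<le> 12 * K * N^2" .
    then show ?thesis unfolding N_def by simp
  qed
  have "((\<lambda>(x,y,z). f x y z) has_derivative (\<lambda>(v,w,e). A * v + B * w + C * e)) (at (a,b,c))"
    unfolding has_derivative_at_alt
  proof (intro conjI allI impI)
    have "bounded_linear (\<lambda>p. A * fst p + B * fst (snd p) + C * snd (snd p))"
      by (intro bounded_linear_add bounded_linear_const_mult bounded_linear_fst bounded_linear_snd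
          bounded_linear_compose[OF bounded_linear_fst bounded_linear_snd]
          bounded_linear_compose[OF bounded_linear_snd bounded_linear_snd])
    then show "bounded_linear (\<lambda>(v,w,e). A * v + B * w + C * e)"
      by (simp add: case_prod_unfold)
  next
    fix e :: real assume e: "e > 0"
    define d where "d = min (r/4) (e / (12 * K + 1))"
    have d: "d > 0" using r e K0 by (simp add: d_def)
    have "norm ((case y of (x,y,z) \<Rightarrow> f x y z) - (case (a,b,c) of (x,y,z) \<Rightarrow> f x y z)
        - (case y - (a,b,c) of (v,w,e) \<Rightarrow> A * v + B * w + C * e)) \<le> e * norm (y - (a,b,c))"
      if y: "norm (y - (a,b,c)) < d" for y
    proof -
      obtain v w z where vwz: "y - (a,b,c) = (v,w,z)" by (cases "y - (a,b,c)")
      then have y': "y = (a+v,b+w,c+z)" by (metis add.commute add_Pair diff_add_cancel)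
      have n: "norm (v,w,z) < d" using y vwz by simp
      have "12 * K * norm (v,w,z) \<le> e"
      proof -
        have "12 * K * norm (v,w,z) \<le> 12 * K * (e / (12 * K + 1))"
          using n K0 by (intro mult_left_mono) (auto simp: d_def)
        also have "\<dots> \<le> e" using K0 e by (simp add: field_simps)
        finally show ?thesis .
      qed
      then have "12 * K * norm (v,w,z)^2 \<le> e * norm (v,w,z)"
        using mult_right_mono[of "12 * K * norm (v,w,z)" e "norm (v,w,z)"] by (simp add: power2_eq_square mult.assoc)
      then show ?thesis using main[of v w z] n unfolding y' vwz by (simp add: d_def)
    qed
    then show "\<exists>d>0. \<forall>y. norm (y - (a,b,c)) < d \<longrightarrow> norm ((case y of (x,y,z) \<Rightarrow> f x y z) - (case (a,b,c) of (x,y,z) \<Rightarrow> f x y z)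
        - (case y - (a,b,c) of (v,w,e) \<Rightarrow> A * v + B * w + C * e)) \<le> e * norm (y - (a,b,c))"
      using d by blast
  qed
  then show ?thesis by blast
qed

lemma holomorphic_uniform_limit_sequence:
  assumes "open S" "\<And>n. f n holomorphic_on S" "uniform_limit S f g sequentially"
  shows "g holomorphic_on S"
proof (rule holomorphic_uniform_sequence[OF assms(1,2)])
  fix x assume "x \<in> S"
  then obtain d where "d > 0" "cball x d \<subseteq> S" using assms(1) open_contains_cball by metis
  then show "\<exists>d>0. cball x d \<subseteq> S \<and> uniform_limit (cball x d) f g sequentially"
    using uniform_limit_on_subset[OF assms(3)] by blast
qed

text \<open>Only pointwise statements in each variable and local boundedness are available, but
  boundedness makes the difference quotients in \<open>\<tau>\<close> converge uniformly in \<open>\<epsilon>\<close>. The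
  induction carries local boundedness along by Cauchy's estimate.\<close>

lemma higher_deriv_holomorphic_parameter:
  fixes f :: "complex \<Rightarrow> complex \<Rightarrow> complex"
  assumes B: "open B" and N: "open N"
    and h: "\<And>\<epsilon>. \<epsilon> \<in> B \<Longrightarrow> (\<lambda>\<tau>. f \<tau> \<epsilon>) holomorphic_on N"
    and p: "\<And>\<tau>. \<tau> \<in> N \<Longrightarrow> (\<lambda>\<epsilon>. f \<tau> \<epsilon>) holomorphic_on B"
    and bd: "\<And>\<tau>. \<tau> \<in> N \<Longrightarrow> \<exists>r>0. \<exists>M. ball \<tau> r \<subseteq> N \<and> (\<forall>\<tau>'\<in>ball \<tau> r. \<forall>\<epsilon>\<in>B. cmod (f \<tau>' \<epsilon>) \<le> M)"
    and \<tau>: "\<tau> \<in> N"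
  shows "(\<lambda>\<epsilon>. (deriv ^^ n) (\<lambda>\<tau>. f \<tau> \<epsilon>) \<tau>) holomorphic_on B"
proof -
  have "(\<forall>\<tau>\<in>N. (\<lambda>\<epsilon>. (deriv ^^ n) (\<lambda>\<tau>. f \<tau> \<epsilon>) \<tau>) holomorphic_on B) \<and>
        (\<forall>\<tau>\<in>N. \<exists>r>0. \<exists>M. ball \<tau> r \<subseteq> N \<and> (\<forall>\<tau>'\<in>ball \<tau> r. \<forall>\<epsilon>\<in>B. cmod ((deriv ^^ n) (\<lambda>\<tau>. f \<tau> \<epsilon>) \<tau>') \<le> M))"
  proof (induction n)
    case 0
    then show ?case using p bd by simp
  next
    case (Suc n)
    define g where "g \<tau> \<epsilon> = (deriv ^^ n) (\<lambda>\<tau>. f \<tau> \<epsilon>) \<tau>" for \<tau> \<epsilon>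
    have gh: "(\<lambda>\<tau>. g \<tau> \<epsilon>) holomorphic_on N" if "\<epsilon> \<in> B" for \<epsilon>
      unfolding g_def using holomorphic_higher_deriv[OF h[OF that] N, of n] by simp
    have gp: "(\<lambda>\<epsilon>. g \<tau> \<epsilon>) holomorphic_on B" if "\<tau> \<in> N" for \<tau>
      unfolding g_def using Suc that by blast
    have gd: "(deriv ^^ Suc n) (\<lambda>\<tau>. f \<tau> \<epsilon>) \<tau> = deriv (\<lambda>\<tau>. g \<tau> \<epsilon>) \<tau>" for \<tau> \<epsilon>
      by (simp add: g_def[abs_def])
    have gb: "\<exists>r>0. \<exists>M. ball \<tau> r \<subseteq> N \<and> (\<forall>\<tau>'\<in>ball \<tau> r. \<forall>\<epsilon>\<in>B. cmod (g \<tau>' \<epsilon>) \<le> M)" if "\<tau> \<in> N" for \<tau>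
      using Suc that unfolding g_def by blast
    have "(\<lambda>\<epsilon>. deriv (\<lambda>\<tau>. g \<tau> \<epsilon>) \<tau>) holomorphic_on B \<and>
       (\<exists>r>0. \<exists>M. ball \<tau> r \<subseteq> N \<and> (\<forall>\<tau>'\<in>ball \<tau> r. \<forall>\<epsilon>\<in>B. cmod (deriv (\<lambda>\<tau>. g \<tau> \<epsilon>) \<tau>') \<le> M))" if \<tau>: "\<tau> \<in> N" for \<tau>
    proof
      obtain r M where r: "r > 0" "ball \<tau> r \<subseteq> N" and M: "\<And>\<tau>' \<epsilon>. \<tau>'\<in>ball \<tau> r \<Longrightarrow> \<epsilon> \<in> B \<Longrightarrow> cmod (g \<tau>' \<epsilon>) \<le> M"
        using gb[OF \<tau>] by blast
      have hb: "(\<lambda>\<tau>. g \<tau> \<epsilon>) holomorphic_on ball \<tau> r" if "\<epsilon> \<in> B" for \<epsilon>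
        using holomorphic_on_subset[OF gh[OF that] r(2)] .
      show "\<exists>r>0. \<exists>M. ball \<tau> r \<subseteq> N \<and> (\<forall>\<tau>'\<in>ball \<tau> r. \<forall>\<epsilon>\<in>B. cmod (deriv (\<lambda>\<tau>. g \<tau> \<epsilon>) \<tau>') \<le> M)"
      proof (rule exI[of _ "r/2"], intro exI[of _ "4*M/r"] conjI ballI)
        show "ball \<tau> (r/2) \<subseteq> N" using r subset_ball[of "r/2" r \<tau>] by auto
        fix \<tau>' \<epsilon> assume "\<tau>' \<in> ball \<tau> (r/2)" "\<epsilon> \<in> B"
        then show "cmod (deriv (\<lambda>\<tau>. g \<tau> \<epsilon>) \<tau>') \<le> 4*M/r"
          using cauchy_lipschitz(1)[OF hb r(1) M] by blast
      qed (use r in simp)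
      \<comment> \<open>A null sequence of increments inside the radius \<open>r/4\<close> of the Taylor estimate.\<close>
      define X where "X n = complex_of_real (r / (8 * real (Suc n)))" for n
      have X: "X n \<noteq> 0" "cmod (X n) = r / (8 * real (Suc n))" for n
        using r unfolding X_def norm_of_real by (simp_all del: of_nat_Suc)
      have X3: "cmod (X n) < r / 4" for n
      proof -
        have "cmod (X n) \<le> r / 8" unfolding X(2) using r by (intro divide_left_mono) auto
        then show ?thesis using r by simp
      qed
      have "uniform_limit B (\<lambda>n \<epsilon>. (g (\<tau> + X n) \<epsilon> - g \<tau> \<epsilon>) / X n) (\<lambda>\<epsilon>. deriv (\<lambda>\<tau>. g \<tau> \<epsilon>) \<tau>) sequentially"
      proof (rule uniform_limitI)
        fix e :: real assume e: "e > 0"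
        have "(\<lambda>n. (32 * M / r^2 * (r/8)) * (1 / real (Suc n))) \<longlonglongrightarrow> (32 * M / r^2 * (r/8)) * 0"
          by (intro tendsto_intros lim_1_over_n LIMSEQ_Suc[OF lim_1_over_n])
        then have "\<forall>\<^sub>F n in sequentially. (32 * M / r^2 * (r/8)) * (1 / real (Suc n)) < e"
          using order_tendstoD(2)[of _ 0 _ e] e by simp
        then show "\<forall>\<^sub>F n in sequentially. \<forall>\<epsilon>\<in>B. dist ((g (\<tau> + X n) \<epsilon> - g \<tau> \<epsilon>) / X n) (deriv (\<lambda>\<tau>. g \<tau> \<epsilon>) \<tau>) < e"
        proof eventually_elim
          case (elim n)
          show ?case
          proof
            fix \<epsilon> assume \<epsilon>: "\<epsilon> \<in> B"
            have "cmod (g (\<tau> + X n) \<epsilon> - g \<tau> \<epsilon> - deriv (\<lambda>\<tau>. g \<tau> \<epsilon>) \<tau> * X n) \<le> 32 * M / r^2 * cmod (X n)^2"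
              by (rule cauchy_taylor1[OF hb[OF \<epsilon>] r(1) M[OF _ \<epsilon>] X3])
            moreover have "dist ((g (\<tau> + X n) \<epsilon> - g \<tau> \<epsilon>) / X n) (deriv (\<lambda>\<tau>. g \<tau> \<epsilon>) \<tau>) =
               cmod (g (\<tau> + X n) \<epsilon> - g \<tau> \<epsilon> - deriv (\<lambda>\<tau>. g \<tau> \<epsilon>) \<tau> * X n) / cmod (X n)"
              using X(1)[of n] by (simp add: dist_norm norm_divide[symmetric] field_simps)
            ultimately have "dist ((g (\<tau> + X n) \<epsilon> - g \<tau> \<epsilon>) / X n) (deriv (\<lambda>\<tau>. g \<tau> \<epsilon>) \<tau>) \<le> 32 * M / r^2 * cmod (X n)"
              using X(1)[of n] by (simp add: divide_le_eq power2_eq_square)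
            also have "\<dots> = 32 * M / r^2 * (r/8) * (1 / real (Suc n))"
              unfolding X(2) by (simp del: of_nat_Suc)
            also have "\<dots> < e" by (rule elim)
            finally show "dist ((g (\<tau> + X n) \<epsilon> - g \<tau> \<epsilon>) / X n) (deriv (\<lambda>\<tau>. g \<tau> \<epsilon>) \<tau>) < e" .
          qed
        qed
      qed
      moreover have "(\<lambda>\<epsilon>. (g (\<tau> + X n) \<epsilon> - g \<tau> \<epsilon>) / X n) holomorphic_on B" for n
        using X(1)[of n] X3[of n] r by (intro holomorphic_intros gp \<tau> subsetD[OF r(2)]) (auto simp: dist_norm)
      ultimately show "(\<lambda>\<epsilon>. deriv (\<lambda>\<tau>. g \<tau> \<epsilon>) \<tau>) holomorphic_on B"
        by (rule holomorphic_uniform_limit_sequence[OF B, rotated])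
    qed
    then show ?case unfolding gd by blast
  qed
  then show ?thesis using \<tau> by blast
qed

text \<open>The Taylor coefficients at the centre are holomorphic in \<open>\<epsilon>\<close>, and by Cauchy's estimate the Taylor
  series converges uniformly in \<open>\<epsilon>\<close>; so holomorphy near the centre reaches points whose distance from
  it is governed only by where \<open>f\<close> is bounded.\<close>

lemma holomorphic_parameter_on_ball:
  fixes f :: "complex \<Rightarrow> complex \<Rightarrow> complex"
  assumes B: "open B" and r: "r > 0"
    and h: "\<And>\<epsilon>. \<epsilon> \<in> B \<Longrightarrow> (\<lambda>\<tau>. f \<tau> \<epsilon>) holomorphic_on ball c r"
    and bd: "\<And>\<tau> \<epsilon>. \<tau> \<in> ball c r \<Longrightarrow> \<epsilon> \<in> B \<Longrightarrow> cmod (f \<tau> \<epsilon>) \<le> M"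
    and N: "open N" "c \<in> N" and p: "\<And>\<tau>. \<tau> \<in> N \<Longrightarrow> (\<lambda>\<epsilon>. f \<tau> \<epsilon>) holomorphic_on B"
    and \<tau>: "\<tau> \<in> ball c (r/2)"
  shows "(\<lambda>\<epsilon>. f \<tau> \<epsilon>) holomorphic_on B"
proof -
  define a where "a n \<epsilon> = (deriv ^^ n) (\<lambda>\<tau>. f \<tau> \<epsilon>) c / fact n" for n \<epsilon>
  have ah: "a n holomorphic_on B" for n
  proof -
    have "(\<lambda>\<epsilon>. (deriv ^^ n) (\<lambda>\<tau>. f \<tau> \<epsilon>) c) holomorphic_on B"
    proof (rule higher_deriv_holomorphic_parameter[where N="N \<inter> ball c r"])
      fix \<tau> assume t: "\<tau> \<in> N \<inter> ball c r"
      then obtain s where "s > 0" "ball \<tau> s \<subseteq> N \<inter> ball c r"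
        using open_contains_ball[of "N \<inter> ball c r"] N by blast
      then show "\<exists>r'>0. \<exists>M. ball \<tau> r' \<subseteq> N \<inter> ball c r \<and> (\<forall>\<tau>'\<in>ball \<tau> r'. \<forall>\<epsilon>\<in>B. cmod (f \<tau>' \<epsilon>) \<le> M)"
        using bd by blast
    qed (use B N p r h in \<open>auto intro: holomorphic_on_subset\<close>)
    then show ?thesis unfolding a_def[abs_def] by (intro holomorphic_intros) auto
  qed
  define x where "x = cmod (\<tau> - c) / (r/2)"
  have x: "0 \<le> x" "x < 1" using \<tau> r unfolding x_def by (auto simp: dist_norm norm_minus_commute)
  have "uniform_limit B (\<lambda>n \<epsilon>. \<Sum>i<n. a i \<epsilon> * (\<tau> - c)^i) (\<lambda>\<epsilon>. \<Sum>i. a i \<epsilon> * (\<tau> - c)^i) sequentially"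
  proof (rule Weierstrass_m_test)
    fix n \<epsilon> assume \<epsilon>: "\<epsilon> \<in> B"
    have "cmod ((deriv ^^ n) (\<lambda>\<tau>. f \<tau> \<epsilon>) c) \<le> fact n * M / (r/2)^n"
      by (rule cauchy_bound_deriv[OF h[OF \<epsilon>] r bd[OF _ \<epsilon>]])
    then have "cmod (a n \<epsilon>) \<le> M / (r/2)^n"
      unfolding a_def norm_divide by (simp add: field_simps)
    then have "cmod (a n \<epsilon>) * cmod (\<tau> - c)^n \<le> M / (r/2)^n * cmod (\<tau> - c)^n"
      by (intro mult_right_mono) auto
    then show "cmod (a n \<epsilon> * (\<tau> - c)^n) \<le> M * x^n"
      by (simp add: norm_mult norm_power x_def power_divide power_mult_distrib mult_ac)
  next
    show "summable (\<lambda>n. M * x^n)" using x by (intro summable_mult summable_geometric) auto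
  qed
  then have "(\<lambda>\<epsilon>. \<Sum>i. a i \<epsilon> * (\<tau> - c)^i) holomorphic_on B"
    by (rule holomorphic_uniform_limit_sequence[OF B, rotated]) (intro holomorphic_intros ah)
  moreover have "(\<Sum>i. a i \<epsilon> * (\<tau> - c)^i) = f \<tau> \<epsilon>" if "\<epsilon> \<in> B" for \<epsilon>
  proof -
    have "\<tau> \<in> ball c r" using \<tau> r by auto
    then show ?thesis using holomorphic_power_series[OF h[OF that]] unfolding a_def by (simp add: sums_iff)
  qed
  ultimately show ?thesis by (subst holomorphic_cong[OF refl]) auto
qed

text \<open>Holomorphic dependence on a parameter is preserved by analytic continuation: the set of points near
  which it holds is open by definition, and closed because each of its points controls a disc whose
  radius does not shrink near a limit point.\<close>

lemma holomorphic_parameter_propagates: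
  fixes f :: "complex \<Rightarrow> complex \<Rightarrow> complex"
  assumes B: "open B" and W: "open W" "connected W"
    and h: "\<And>\<epsilon>. \<epsilon> \<in> B \<Longrightarrow> (\<lambda>\<tau>. f \<tau> \<epsilon>) holomorphic_on W"
    and bd: "\<And>\<tau>. \<tau> \<in> W \<Longrightarrow> \<exists>r>0. \<exists>M. ball \<tau> r \<subseteq> W \<and> (\<forall>\<tau>'\<in>ball \<tau> r. \<forall>\<epsilon>\<in>B. cmod (f \<tau>' \<epsilon>) \<le> M)"
    and N: "open N" "N \<noteq> {}" "N \<subseteq> W" and p: "\<And>\<tau>. \<tau> \<in> N \<Longrightarrow> (\<lambda>\<epsilon>. f \<tau> \<epsilon>) holomorphic_on B"
    and \<tau>: "\<tau> \<in> W"
  shows "(\<lambda>\<epsilon>. f \<tau> \<epsilon>) holomorphic_on B"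
proof -
  define G where "G = {\<tau>\<in>W. \<exists>N'. open N' \<and> \<tau> \<in> N' \<and> (\<forall>\<tau>'\<in>N'. (\<lambda>\<epsilon>. f \<tau>' \<epsilon>) holomorphic_on B)}"
  have GW: "G \<subseteq> W" by (auto simp: G_def)
  have NG: "N \<subseteq> G" using N p by (auto simp: G_def)
  have oG: "open G"
  proof (subst open_subopen, intro ballI)
    fix \<tau> assume "\<tau> \<in> G"
    then obtain N' where N': "open N'" "\<tau> \<in> N'" "\<forall>\<tau>'\<in>N'. (\<lambda>\<epsilon>. f \<tau>' \<epsilon>) holomorphic_on B" "\<tau> \<in> W"
      by (auto simp: G_def)
    then have "N' \<inter> W \<subseteq> G" by (auto simp: G_def)
    then show "\<exists>T. open T \<and> \<tau> \<in> T \<and> T \<subseteq> G" using N' W by (intro exI[of _ "N' \<inter> W"]) auto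
  qed
  have "closedin (top_of_set W) G"
    unfolding closedin_limpt
  proof (intro conjI GW allI impI)
    fix \<tau>0 assume t0: "\<tau>0 islimpt G \<and> \<tau>0 \<in> W"
    obtain r M where r: "r > 0" "ball \<tau>0 r \<subseteq> W" and M: "\<And>\<tau>' \<epsilon>. \<tau>'\<in>ball \<tau>0 r \<Longrightarrow> \<epsilon>\<in>B \<Longrightarrow> cmod (f \<tau>' \<epsilon>) \<le> M"
      using bd t0 by meson
    obtain c where c: "c \<in> G" "dist c \<tau>0 < r/8"
      using t0 r(1) unfolding islimpt_approachable by (meson divide_pos_pos zero_less_numeral)
    obtain N' where N': "open N'" "c \<in> N'" "\<And>\<tau>'. \<tau>'\<in>N' \<Longrightarrow> (\<lambda>\<epsilon>. f \<tau>' \<epsilon>) holomorphic_on B"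
      using c by (auto simp: G_def)
    have sub: "ball c (r/2) \<subseteq> ball \<tau>0 r"
    proof
      fix x assume "x \<in> ball c (r/2)"
      then show "x \<in> ball \<tau>0 r" using c(2) r(1) dist_triangle[of \<tau>0 x c] by (simp add: dist_commute)
    qed
    have *: "(\<lambda>\<epsilon>. f \<tau>' \<epsilon>) holomorphic_on B" if "\<tau>' \<in> ball c (r/2/2)" for \<tau>'
    proof (rule holomorphic_parameter_on_ball[where c=c and r="r/2" and N=N' and M=M])
      show "(\<lambda>\<tau>. f \<tau> \<epsilon>) holomorphic_on ball c (r/2)" if "\<epsilon> \<in> B" for \<epsilon>
        using holomorphic_on_subset[OF h[OF that]] sub r by blast
    qed (use that B r M sub N' in auto)
    show "\<tau>0 \<in> G"
      unfolding G_def using t0 c(2) * r by (auto intro!: exI[of _ "ball c (r/2/2)"])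
  qed
  moreover have "openin (top_of_set W) G" using oG GW by (simp add: openin_open_eq W)
  ultimately have "G = W" using W(2) NG N(2) unfolding connected_clopen by blast
  then show ?thesis using \<tau> by (auto simp: G_def)
qed

section \<open>The theta function and its zeros\<close>

text \<open>The q-Pochhammer symbol \<open>(p; p)\<^sub>n\<close>, from which the Gaussian binomial coefficients are built.\<close>

definition qpoch :: "real \<Rightarrow> nat \<Rightarrow> real" where
  "qpoch p n = (\<Prod>i<n. 1 - p ^ Suc i)"

definition qbinom :: "real \<Rightarrow> nat \<Rightarrow> nat \<Rightarrow> real" where
  "qbinom p n j = (if j \<le> n then qpoch p n / (qpoch p j * qpoch p (n - j)) else 0)"

lemma qpoch_bounds:
  assumes p: "0 < p" "p < 1"
  shows "0 < qpoch p n" "qpoch p n \<le> 1"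
proof -
  show "0 < qpoch p n" using p unfolding qpoch_def
    by (intro prod_pos) (simp add: power_Suc_less_one del: power_Suc)
  show "qpoch p n \<le> 1" using p unfolding qpoch_def
    by (intro prod_le_1) (simp add: power_le_one del: power_Suc)
qed

text \<open>The q-analogue of Pascal's rule.\<close>

lemma qbinom_rec:
  assumes p: "0 < p" "p < 1"
  shows "qbinom p (Suc n) (Suc j) = qbinom p n (Suc j) + p ^ (n - j) * qbinom p n j"
proof -
  have nz: "qpoch p k \<noteq> 0" for k using qpoch_bounds[OF p, of k] by simp
  have nz1: "1 - p ^ Suc k \<noteq> 0" for k using p power_Suc_less_one[of p k] by simp
  consider "j > n" | "j = n" | "j < n" by linarith
  then show ?thesis
  proof cases
    case 3
    define k where "k = n - Suc j"
    have n: "n = j + Suc k" "n - j = Suc k" "n - Suc j = k" using 3 by (auto simp: k_def)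
    have q1: "qpoch p (Suc n) = qpoch p n * (1 - p ^ Suc n)" by (simp add: qpoch_def)
    have q2: "qpoch p (Suc j) = qpoch p j * (1 - p ^ Suc j)" by (simp add: qpoch_def)
    have q3: "qpoch p (Suc k) = qpoch p k * (1 - p ^ Suc k)" by (simp add: qpoch_def)
    have id: "1 - p ^ Suc n = (1 - p ^ Suc k) + p ^ Suc k * (1 - p ^ Suc j)"
      by (simp add: n(1) power_add algebra_simps)
    have "qbinom p (Suc n) (Suc j) = qpoch p n * (1 - p ^ Suc n) / (qpoch p j * (1 - p ^ Suc j) * (qpoch p k * (1 - p ^ Suc k)))"
      using 3 by (simp only: qbinom_def diff_Suc_Suc n(2) q1 q2 q3) (simp add: n del: power_Suc)
    also have "\<dots> = qpoch p n / (qpoch p j * (1 - p ^ Suc j) * qpoch p k) + p ^ Suc k * (qpoch p n / (qpoch p j * (qpoch p k * (1 - p ^ Suc k))))"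
      unfolding id
    proof -
      have "P * (a + x * b) / (A * b * (B * a)) = P / (A * b * B) + x * (P / (A * (B * a)))"
        if "A \<noteq> 0" "B \<noteq> 0" "a \<noteq> 0" "b \<noteq> 0" for P a b x A B :: real
        using that by (simp add: field_simps)
      from this[OF nz nz nz1 nz1] show "qpoch p n * (1 - p ^ Suc k + p ^ Suc k * (1 - p ^ Suc j)) / (qpoch p j * (1 - p ^ Suc j) * (qpoch p k * (1 - p ^ Suc k)))
        = qpoch p n / (qpoch p j * (1 - p ^ Suc j) * qpoch p k) + p ^ Suc k * (qpoch p n / (qpoch p j * (qpoch p k * (1 - p ^ Suc k))))" .
    qed
    also have "\<dots> = qbinom p n (Suc j) + p ^ (n - j) * qbinom p n j"
      using 3 by (simp only: qbinom_def n(2,3) q2 q3) (simp add: n del: power_Suc)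
    finally show ?thesis .
  qed (use nz in \<open>auto simp: qbinom_def\<close>)
qed

lemma q_binomial_theorem:
  fixes x :: "'a :: {comm_ring_1,real_algebra_1}"
  assumes p: "0 < p" "p < 1"
  shows "(\<Prod>i<n. 1 + x * of_real (p ^ i)) = (\<Sum>j\<le>n. of_real (qbinom p n j * p ^ (j * (j-1) div 2)) * x ^ j)"
proof (induction n)
  case 0
  then show ?case by (simp add: qbinom_def qpoch_def)
next
  case (Suc n)
  define c where "c n j = qbinom p n j * p ^ (j * (j-1) div 2)" for n j
  have nz: "qpoch p k \<noteq> 0" for k using qpoch_bounds[OF p, of k] by simp
  have c0: "c n 0 = 1" for n using nz by (simp add: c_def qbinom_def qpoch_def)
  have cn: "c n (Suc n) = 0" by (simp add: c_def qbinom_def)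
  have rec: "c (Suc n) (Suc j) = c n (Suc j) + p ^ n * c n j" if "j \<le> n" for j
  proof -
    have t: "Suc j * (Suc j - 1) div 2 = j + j * (j - 1) div 2"
      by (cases j) (auto simp: algebra_simps)
    have "p ^ (n - j) * p ^ (j + j * (j-1) div 2) = p ^ n * p ^ (j * (j-1) div 2)"
      using that by (simp add: power_add[symmetric])
    then show ?thesis unfolding c_def qbinom_rec[OF p] t by (simp add: algebra_simps)
  qed
  have "(\<Prod>i<Suc n. 1 + x * of_real (p ^ i)) = (\<Sum>j\<le>n. of_real (c n j) * x ^ j) * (1 + x * of_real (p ^ n))"
    using Suc by (simp add: c_def)
  also have "\<dots> = (\<Sum>j\<le>n. of_real (c n j) * x ^ j) + (\<Sum>j\<le>n. of_real (p ^ n * c n j) * x ^ Suc j)"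
    by (simp add: distrib_left sum_distrib_left sum_distrib_right sum.distrib mult_ac)
  also have "(\<Sum>j\<le>n. of_real (c n j) * x ^ j) = (\<Sum>j\<le>Suc n. of_real (c n j) * x ^ j)"
    using cn by simp
  also have "\<dots> = 1 + (\<Sum>j\<le>n. of_real (c n (Suc j)) * x ^ Suc j)"
    by (simp add: sum.atMost_Suc_shift c0 del: sum.atMost_Suc)
  also have "1 + (\<Sum>j\<le>n. of_real (c n (Suc j)) * x ^ Suc j) + (\<Sum>j\<le>n. of_real (p ^ n * c n j) * x ^ Suc j)
     = 1 + (\<Sum>j\<le>n. of_real (c (Suc n) (Suc j)) * x ^ Suc j)"
    unfolding add.assoc sum.distrib[symmetric]
    by (intro arg_cong2[where f="(+)"] refl sum.cong) (simp add: rec distrib_right del: power_Suc)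
  also have "\<dots> = (\<Sum>j\<le>Suc n. of_real (c (Suc n) j) * x ^ j)"
    by (simp add: sum.atMost_Suc_shift c0 del: sum.atMost_Suc)
  finally show ?case by (simp add: c_def)
qed

text \<open>The theta function in the variable \<open>p = q\<^sup>-\<^sup>1\<^sup>/\<^sup>k < 1\<close>, whose quasi-period is then \<open>p\<close>
  itself.\<close>

definition theta :: "real \<Rightarrow> complex \<Rightarrow> complex" where
  "theta p x = (\<Sum>\<^sub>\<infinity>n\<in>(UNIV :: int set). of_real (p powr (real_of_int (n * (n-1)) / 2)) * x powi n)"

lemma jacobi_theta_eq_theta:
  assumes "q > 1" "k > 0"
  shows "jacobi_theta q k = theta (q powr (- 1 / k))"
proof
  fix x
  have "q powr (- (of_int n * (of_int n - 1)) / (2 * k)) = (q powr (- 1 / k)) powr (real_of_int (n * (n-1)) / 2)" for n :: int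
    unfolding powr_powr using assms by (intro arg_cong[where f="(powr) q"]) (simp add: field_simps)
  then show "jacobi_theta q k x = theta (q powr (- 1 / k)) x"
    by (simp add: jacobi_theta_def theta_def)
qed

text \<open>The moduli of the terms of the theta series on the circle of radius \<open>y\<close>.\<close>

definition theta_term :: "real \<Rightarrow> real \<Rightarrow> int \<Rightarrow> real" where
  "theta_term p y n = p powr (real_of_int (n * (n-1)) / 2) * y powi n"

lemma theta_term_abs_summable:
  assumes p: "0 < p" "p < 1" and y: "y > 0"
  shows "(\<lambda>n. theta_term p y n) summable_on UNIV"
proof -
  have nat: "summable (\<lambda>n. p powr (real n * (real n - 1) / 2) * y ^ n)" if y: "y > 0" for y
  proof -
    have *: "p powr (real (Suc n) * (real (Suc n) - 1) / 2) * y ^ Suc n = (p ^ n * y) * (p powr (real n * (real n - 1) / 2) * y ^ n)" for n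
    proof -
      have "p powr (real (Suc n) * (real (Suc n) - 1) / 2) = p powr (real n + real n * (real n - 1) / 2)"
        by (simp add: field_simps)
      also have "\<dots> = p ^ n * p powr (real n * (real n - 1) / 2)"
        using p by (simp add: powr_add powr_realpow)
      finally show ?thesis by simp
    qed
    have "(\<lambda>n. p ^ n * y) \<longlonglongrightarrow> 0 * y"
      using p by (intro tendsto_intros LIMSEQ_realpow_zero) auto
    then have "\<forall>\<^sub>F n in sequentially. p ^ n * y < 1/2"
      by (intro order_tendstoD(2)[of _ 0]) auto
    then obtain N where N: "\<And>n. n \<ge> N \<Longrightarrow> p ^ n * y < 1/2" by (auto simp: eventually_sequentially)
    show ?thesis
    proof (rule summable_ratio_test[of "1/2" N])
      fix n assume "n \<ge> N"
      then have "(p ^ n * y) * (p powr (real n * (real n - 1) / 2) * y ^ n) \<le> 1/2 * (p powr (real n * (real n - 1) / 2) * y ^ n)"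
        using N[of n] y by (intro mult_right_mono) auto
      then show "norm (p powr (real (Suc n) * (real (Suc n) - 1) / 2) * y ^ Suc n) \<le> 1/2 * norm (p powr (real n * (real n - 1) / 2) * y ^ n)"
        unfolding * using p y by (simp add: abs_mult)
    qed simp
  qed
  have pos: "theta_term p y n \<ge> 0" for n using y by (simp add: theta_term_def)
  have "(\<lambda>n. theta_term p y (int n)) summable_on UNIV"
    using nat[OF y] by (subst summable_on_UNIV_nonneg_real_iff[OF pos]) (simp add: theta_term_def)
  then have s1: "theta_term p y summable_on (range int)"
    by (subst summable_on_reindex) (auto simp: o_def)
  have "summable (\<lambda>n. (p powr (real n * (real n - 1) / 2) * (p / y) ^ n))"
    using p y by (intro nat) auto
  also have "(\<lambda>n. (p powr (real n * (real n - 1) / 2) * (p / y) ^ n)) = (\<lambda>n. theta_term p y (- int n))"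
  proof
    fix n
    have "p powr (real_of_int (- int n * (- int n - 1)) / 2) = p powr (real n + real n * (real n - 1) / 2)"
      by (simp add: field_simps)
    also have "\<dots> = p ^ n * p powr (real n * (real n - 1) / 2)"
      using p by (simp add: powr_add powr_realpow)
    finally have e: "p powr (real_of_int (- int n * (- int n - 1)) / 2) = p ^ n * p powr (real n * (real n - 1) / 2)" .
    have "y powi (- int n) = 1 / y ^ n" by (simp add: power_int_minus inverse_eq_divide)
    then show "(p powr (real n * (real n - 1) / 2) * (p / y) ^ n) = theta_term p y (- int n)"
      unfolding theta_term_def e by (simp add: power_divide)
  qed
  finally have "(\<lambda>n. theta_term p y (- int n)) summable_on UNIV"
    by (subst summable_on_UNIV_nonneg_real_iff[OF pos])
  then have s2: "theta_term p y summable_on (range (\<lambda>n. - int n))"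
    by (subst summable_on_reindex) (auto simp: o_def inj_on_def)
  have "UNIV = range int \<union> range (\<lambda>n. - int n)"
    by (metis (no_types, lifting) UNIV_eq_I UnCI int_cases2 rangeI)
  then show ?thesis using summable_on_union[OF s1 s2] by simp
qed

lemma theta_summable:
  assumes p: "0 < p" "p < 1" and x: "x \<noteq> 0"
  shows "(\<lambda>n. norm (complex_of_real (p powr (real_of_int (n * (n-1)) / 2)) * x powi n)) summable_on UNIV"
proof -
  have "norm (complex_of_real (p powr (real_of_int (n * (n-1)) / 2)) * x powi n) = theta_term p (cmod x) n" for n
    by (simp add: theta_term_def norm_mult norm_power_int)
  then show ?thesis using theta_term_abs_summable[OF p, of "cmod x"] x by simp
qed

text \<open>Multiplying \<open>x\<close> by \<open>p\<close> shifts the index of summation by one.\<close>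

lemma theta_shift:
  assumes p: "0 < p" "p < 1" and x: "x \<noteq> 0"
  shows "theta p (of_real p * x) = theta p x / x"
proof -
  define t where "t x n = complex_of_real (p powr (real_of_int (n * (n-1)) / 2)) * x powi n" for x n
  have "t (of_real p * x) n = t x (n + 1) / x" for n
  proof -
    have "p powr (real_of_int ((n+1) * (n+1-1)) / 2) = p powr (of_int n + real_of_int (n * (n-1)) / 2)"
      by (simp add: field_simps)
    also have "\<dots> = p powi n * p powr (real_of_int (n * (n-1)) / 2)"
      using p by (simp add: powr_add powr_real_of_int')
    finally show ?thesis
      using x p by (simp add: t_def power_int_mult_distrib power_int_add of_real_power_int)
  qed
  then have t1: "t (of_real p * x) = (\<lambda>n. t x (n+1) * inverse x)"
    by (simp add: fun_eq_iff divide_inverse)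
  have th: "theta p x = (\<Sum>\<^sub>\<infinity>n. t x n)" for x
    by (simp add: theta_def t_def)
  have "theta p (of_real p * x) = (\<Sum>\<^sub>\<infinity>n. t x (n+1) * inverse x)"
    unfolding th t1 ..
  also have "\<dots> = (\<Sum>\<^sub>\<infinity>n. t x (n+1)) * inverse x" by (rule infsum_cmult_left')
  also have "(\<Sum>\<^sub>\<infinity>n. t x (n+1)) = (\<Sum>\<^sub>\<infinity>n. t x n)"
    by (rule infsum_reindex_bij_witness[of _ "\<lambda>n. n - 1" "\<lambda>n. n + 1"]) auto
  finally show ?thesis unfolding th divide_inverse .
qed

lemma theta_shift_power:
  assumes p: "0 < p" "p < 1" and x: "x \<noteq> 0"
  shows "theta p (of_real (p ^ m) * x) = theta p x / (x ^ m * of_real (p powr (real m * (real m - 1) / 2)))"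
proof (induction m)
  case 0
  then show ?case using p by simp
next
  case (Suc m)
  have "p powr (real (Suc m) * (real (Suc m) - 1) / 2) = p powr (real m + real m * (real m - 1) / 2)"
    by (simp add: field_simps)
  also have "\<dots> = p ^ m * p powr (real m * (real m - 1) / 2)"
    using p by (simp add: powr_add powr_realpow)
  finally have *: "p powr (real (Suc m) * (real (Suc m) - 1) / 2) = p ^ m * p powr (real m * (real m - 1) / 2)" .
  have "theta p (of_real (p ^ Suc m) * x) = theta p (of_real p * (of_real (p ^ m) * x))" by (simp add: mult.assoc)
  also have "\<dots> = theta p (of_real (p ^ m) * x) / (of_real (p ^ m) * x)"
    using p x by (intro theta_shift) auto
  also have "\<dots> = theta p x / (x ^ Suc m * of_real (p powr (real (Suc m) * (real (Suc m) - 1) / 2)))"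
    unfolding Suc * using p x by (simp add: field_simps)
  finally show ?case .
qed

text \<open>As an integral over the counting measure the series is accessible to dominated convergence.\<close>

lemma theta_eq_integral:
  assumes p: "0 < p" "p < 1" and x: "x \<noteq> 0"
  shows "theta p x = (\<integral>n. of_real (p powr (real_of_int (n * (n-1)) / 2)) * x powi n \<partial>count_space UNIV)"
    and "integrable (count_space UNIV) (\<lambda>n::int. of_real (p powr (real_of_int (n * (n-1)) / 2)) * x powi n)"
proof -
  let ?f = "\<lambda>n::int. of_real (p powr (real_of_int (n * (n-1)) / 2)) * x powi n"
  have "Infinite_Set_Sum.abs_summable_on ?f UNIV"
    using theta_summable[OF p x] abs_summable_equivalent by blast
  then show "theta p x = (\<integral>n. ?f n \<partial>count_space UNIV)" "integrable (count_space UNIV) ?f"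
    using infsetsum_infsum[of ?f UNIV] unfolding theta_def infsetsum_def Infinite_Set_Sum.abs_summable_on_def by auto
qed

lemma theta_term_integrable:
  assumes p: "0 < p" "p < 1" and y: "y > 0"
  shows "integrable (count_space UNIV) (theta_term p y)"
proof -
  have "integrable (count_space UNIV) (\<lambda>n::int. norm (complex_of_real (p powr (real_of_int (n * (n-1)) / 2)) * of_real y powi n))"
    using theta_eq_integral(2)[OF p, of "of_real y"] y by (intro integrable_norm) auto
  also have "(\<lambda>n::int. norm (complex_of_real (p powr (real_of_int (n * (n-1)) / 2)) * of_real y powi n)) = theta_term p y"
    using y by (auto simp: theta_term_def norm_mult norm_power_int)
  finally show ?thesis .
qed

text \<open>Near \<open>x\<close> the powers \<open>w\<^sup>n\<close> of both signs are dominated by \<open>a\<^sup>n + b\<^sup>n\<close> for radii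
  \<open>a < b\<close> enclosing a neighbourhood of \<open>x\<close>.\<close>

lemma theta_holomorphic:
  assumes p: "0 < p" "p < 1"
  shows "theta p holomorphic_on (- {0})"
proof -
  have "(\<lambda>x. \<integral>n. of_real (p powr (real_of_int (n * (n-1)) / 2)) * x powi n \<partial>count_space (UNIV :: int set)) holomorphic_on (- {0})"
  proof (rule holomorphic_lebesgue_integral)
    fix x :: complex assume x: "x \<in> - {0}"
    define a where "a = cmod x / 2"
    define b where "b = 2 * cmod x"
    have ab: "a > 0" "b > 0" using x by (auto simp: a_def b_def)
    have bd: "cmod (of_real (p powr (real_of_int (n * (n-1)) / 2)) * w powi n) \<le> theta_term p a n + theta_term p b n"
      if w: "w \<in> ball x a" for w :: complex and n :: int
    proof -
      have "cmod w \<ge> cmod x - cmod (x - w)" "cmod w \<le> cmod x + cmod (x - w)"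
        using norm_triangle_ineq2[of x "x - w"] norm_triangle_ineq4[of x "x - w"] by auto
      then have w': "a \<le> cmod w" "cmod w \<le> b" using w by (auto simp: a_def b_def dist_norm)
      have "cmod w powi n \<le> a powi n + b powi n"
      proof (cases "n \<ge> 0")
        case True
        then have "cmod w powi n \<le> b powi n" using w' by (simp add: power_int_mono)
        then show ?thesis using ab by (simp add: add_increasing)
      next
        case False
        then have "cmod w powi n \<le> a powi n" using w' ab
          by (cases n rule: int_cases2) (auto simp: power_int_minus intro!: le_imp_inverse_le power_mono)
        then show ?thesis using ab by (simp add: add_increasing2)
      qed
      then have "p powr (real_of_int (n * (n-1)) / 2) * cmod w powi n \<le> p powr (real_of_int (n * (n-1)) / 2) * (a powi n + b powi n)"
        by (intro mult_left_mono) auto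
      then show ?thesis by (simp add: theta_term_def norm_mult norm_power_int distrib_left)
    qed
    have "ball x a \<subseteq> - {0}" using ab by (auto simp: a_def)
    then show "\<exists>r g. 0 < r \<and> ball x r \<subseteq> - {0} \<and> integrable (count_space UNIV) g \<and>
        (\<forall>w\<in>ball x r. \<forall>n. cmod (of_real (p powr (real_of_int (n * (n-1)) / 2)) * w powi n) \<le> g n)"
      using ab bd by (intro exI[of _ a] exI[of _ "\<lambda>n. theta_term p a n + theta_term p b n"])
        (auto intro!: Bochner_Integration.integrable_add theta_term_integrable p)
  qed (auto intro!: holomorphic_intros)
  then show ?thesis
    by (rule holomorphic_transform) (use theta_eq_integral(1)[OF p] in auto)
qed

text \<open>The q-binomial theorem with \<open>2 N\<close> factors at the point \<open>x / p\<^sup>N\<close>, whose factors are centred around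
  index \<open>N\<close>; pulling \<open>x / p\<^sup>i\<close> out of the first half of the factors makes the product symmetric.\<close>

lemma finite_jacobi_triple_product:
  fixes x :: complex
  assumes p: "0 < p" "p < 1" and x: "x \<noteq> 0"
  shows "(\<Sum>n\<in>{-int N..int N}. of_real (qbinom p (2*N) (nat (n + int N)) * p powr (real_of_int (n * (n-1)) / 2)) * x powi n)
       = (\<Prod>i<N. (1 + x * of_real (p ^ i)) * (1 + of_real (p ^ Suc i) / x))"
proof -
  define t where "t n = complex_of_real (qbinom p (2*N) (nat (n + int N)) * p powr (real_of_int (n * (n-1)) / 2)) * x powi n" for n
  \<comment> \<open>The product of the monomials pulled out of the factors with negative powers of \<open>p\<close>.\<close>
  define A where "A = x ^ N * complex_of_real (p powr (- (real N * (real N + 1) / 2)))"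
  have A0: "A \<noteq> 0" using x p by (simp add: A_def)
  have A_prod: "A = (\<Prod>i<N. x / of_real (p ^ Suc i))"
  proof -
    have "complex_of_real (p powr (- (real N * (real N + 1) / 2))) = (\<Prod>i<N. 1 / of_real (p ^ Suc i))"
    proof (induction N)
      case 0
      show ?case using p by simp
    next
      case (Suc N)
      have "p powr (- (real (Suc N) * (real (Suc N) + 1) / 2)) = p powr (- (real N * (real N + 1) / 2) - real (Suc N))"
        by (intro arg_cong[where f="(powr) p"]) (simp add: field_simps)
      also have "\<dots> = p powr (- (real N * (real N + 1) / 2)) / p ^ Suc N"
        using p by (simp only: powr_diff powr_realpow)
      finally have e: "p powr (- (real (Suc N) * (real (Suc N) + 1) / 2)) = p powr (- (real N * (real N + 1) / 2)) / p ^ Suc N" .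
      show ?case unfolding e of_real_divide Suc prod.lessThan_Suc by (simp del: power_Suc)
    qed
    then show ?thesis unfolding A_def by (simp add: prod_dividef)
  qed
  have "A * (\<Sum>n\<in>{-int N..int N}. t n) = (\<Sum>j\<le>2*N. A * t (int j - int N))"
    unfolding sum_distrib_left
    by (rule sum.reindex_bij_witness[of _ "\<lambda>j. int j - int N" "\<lambda>n. nat (n + int N)"]) auto
  also have "\<dots> = (\<Sum>j\<le>2*N. of_real (qbinom p (2*N) j * p ^ (j * (j-1) div 2)) * (x / of_real (p ^ N)) ^ j)"
  proof (rule sum.cong[OF refl])
    fix j assume j: "j \<in> {..2*N}"
    have e1: "p ^ (j * (j-1) div 2) = p powr (real j * (real j - 1) / 2)"
    proof -
      have e0: "real (j * (j-1) div 2) = real j * (real j - 1) / 2"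
        by (cases j) (simp_all add: real_of_nat_div algebra_simps)
      show ?thesis unfolding e0[symmetric] powr_realpow[OF p(1)] ..
    qed
    have e2: "p powr (real_of_int ((int j - int N) * (int j - int N - 1)) / 2)
        = p powr (real j * (real j - 1) / 2) * p powr (real N * (real N + 1) / 2) / (p ^ N) ^ j"
    proof -
      have "real_of_int ((int j - int N) * (int j - int N - 1)) / 2 = real j * (real j - 1) / 2 + real N * (real N + 1) / 2 - real (N * j)"
        by (simp add: field_simps)
      then show ?thesis using p by (simp only: powr_diff powr_add powr_realpow power_mult)
    qed
    have e3: "x powi (int j - int N) = x ^ j / x ^ N"
      using x by (simp add: power_int_diff)
    have nj: "nat (int j - int N + int N) = j" by simp
    have e4: "p powr (- (real N * (real N + 1) / 2)) = 1 / p powr (real N * (real N + 1) / 2)"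
      by (simp add: powr_minus_divide)
    show "A * t (int j - int N) = of_real (qbinom p (2*N) j * p ^ (j * (j-1) div 2)) * (x / of_real (p ^ N)) ^ j"
      unfolding A_def t_def nj e1 e2 e3 e4 using p x by (simp add: field_simps)
  qed
  also have "\<dots> = (\<Prod>i<2*N. 1 + x / of_real (p ^ N) * of_real (p ^ i))"
    by (rule q_binomial_theorem[OF p, symmetric])
  also have "\<dots> = (\<Prod>i<N. 1 + x / of_real (p ^ N) * of_real (p ^ i)) * (\<Prod>i<N. 1 + x / of_real (p ^ N) * of_real (p ^ (N + i)))"
  proof -
    have "(\<Prod>i<N+M. f i) = (\<Prod>i<N. f i) * (\<Prod>i<M. f (N + i))" for M and f :: "nat \<Rightarrow> complex"
      by (induction M) (simp_all add: mult.assoc)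
    then show ?thesis unfolding mult_2 .
  qed
  also have "(\<Prod>i<N. 1 + x / of_real (p ^ N) * of_real (p ^ (N + i))) = (\<Prod>i<N. 1 + x * of_real (p ^ i))"
    using p by (intro prod.cong refl) (simp add: power_add)
  also have "(\<Prod>i<N. 1 + x / of_real (p ^ N) * of_real (p ^ i)) = (\<Prod>i<N. x / of_real (p ^ Suc i) * (1 + of_real (p ^ Suc i) / x))"
  proof -
    have "(\<Prod>i<N. 1 + x / of_real (p ^ N) * of_real (p ^ i)) = (\<Prod>i<N. 1 + x / of_real (p ^ N) * of_real (p ^ (N - Suc i)))"
      by (rule prod.nat_diff_reindex[symmetric])
    also have "\<dots> = (\<Prod>i<N. x / of_real (p ^ Suc i) * (1 + of_real (p ^ Suc i) / x))"
    proof (rule prod.cong[OF refl])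
      fix i assume "i \<in> {..<N}"
      then have "p ^ N = p ^ (N - Suc i) * p ^ Suc i" by (simp add: power_add[symmetric] del: power_Suc)
      then show "1 + x / of_real (p ^ N) * of_real (p ^ (N - Suc i)) = x / of_real (p ^ Suc i) * (1 + of_real (p ^ Suc i) / x)"
        using p x by (simp add: distrib_left del: power_Suc)
    qed
    finally show ?thesis .
  qed
  also have "\<dots> = A * (\<Prod>i<N. 1 + of_real (p ^ Suc i) / x)"
    unfolding A_prod by (rule prod.distrib)
  finally have "A * (\<Sum>n\<in>{-int N..int N}. t n) = A * ((\<Prod>i<N. 1 + x * of_real (p ^ i)) * (\<Prod>i<N. 1 + of_real (p ^ Suc i) / x))"
    by (simp add: mult_ac)
  then show ?thesis using A0 by (simp add: t_def prod.distrib)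
qed

lemma qpoch_limit:
  assumes p: "0 < p" "p < 1"
  obtains L where "qpoch p \<longlonglongrightarrow> L" "L > 0" "\<And>n. L \<le> qpoch p n"
proof -
  have "abs_convergent_prod (\<lambda>i. 1 - p ^ Suc i)"
    unfolding abs_convergent_prod_conv_summable using p by (auto intro!: summable_mult)
  then have c: "convergent_prod (\<lambda>i. 1 - p ^ Suc i)" by (rule abs_convergent_prod_imp_convergent_prod)
  define L where "L = prodinf (\<lambda>i. 1 - p ^ Suc i)"
  have nz: "1 - p ^ Suc i \<noteq> 0" for i using p power_Suc_less_one[of p i] by simp
  have "(\<lambda>n. qpoch p (Suc n)) \<longlonglongrightarrow> L"
    unfolding qpoch_def L_def lessThan_Suc_atMost by (rule convergent_prod_LIMSEQ[OF c])
  then have lim: "qpoch p \<longlonglongrightarrow> L" by (rule LIMSEQ_imp_Suc)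
  have dec: "decseq (qpoch p)"
  proof (rule decseq_SucI)
    fix n
    have "qpoch p (Suc n) = qpoch p n * (1 - p ^ Suc n)" by (simp add: qpoch_def)
    also have "\<dots> \<le> qpoch p n * 1" using p qpoch_bounds[OF p, of n] by (intro mult_left_mono) auto
    finally show "qpoch p (Suc n) \<le> qpoch p n" by simp
  qed
  have le: "L \<le> qpoch p n" for n by (rule decseq_ge[OF dec lim])
  have "L \<ge> 0" by (rule LIMSEQ_le_const[OF lim]) (use qpoch_bounds(1)[OF p] less_imp_le in blast)
  moreover have "L \<noteq> 0" unfolding L_def by (rule prodinf_nonzero[OF c nz])
  ultimately show thesis using that[OF lim _ le] by simp
qed

text \<open>As \<open>N \<rightarrow> \<infinity>\<close>, the coefficients of the finite identity tend to \<open>1/L\<close> and stay below \<open>1/L\<^sup>2\<close>, so the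
  sum over all integers converges dominatedly.\<close>

lemma theta_triple_product_limit:
  assumes p: "0 < p" "p < 1" and x: "x \<noteq> 0" and L: "qpoch p \<longlonglongrightarrow> L" "L > 0" "\<And>n. L \<le> qpoch p n"
  shows "(\<lambda>N. \<Prod>i<N. (1 + x * of_real (p ^ i)) * (1 + of_real (p ^ Suc i) / x)) \<longlonglongrightarrow> theta p x / of_real L"
proof -
  define t where "t n = complex_of_real (p powr (real_of_int (n * (n-1)) / 2)) * x powi n" for n
  define b where "b N n = (if n \<in> {-int N..int N} then qbinom p (2*N) (nat (n + int N)) else 0)" for N n
  have P: "(\<Prod>i<N. (1 + x * of_real (p ^ i)) * (1 + of_real (p ^ Suc i) / x)) = (\<integral>n. of_real (b N n) * t n \<partial>count_space UNIV)" for N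
  proof -
    have sub: "{n. of_real (b N n) * t n \<noteq> 0} \<subseteq> {-int N..int N}" by (auto simp: b_def)
    have "(\<integral>n. of_real (b N n) * t n \<partial>count_space UNIV) = (\<Sum>n | n \<in> UNIV \<and> of_real (b N n) * t n \<noteq> 0. of_real (b N n) * t n)"
      by (rule lebesgue_integral_count_space_finite_support) (use finite_subset[OF sub] in simp)
    also have "\<dots> = (\<Sum>n\<in>{-int N..int N}. of_real (b N n) * t n)"
      by (rule sum.mono_neutral_left) (use sub in auto)
    also have "\<dots> = (\<Sum>n\<in>{-int N..int N}. of_real (qbinom p (2*N) (nat (n + int N)) * p powr (real_of_int (n * (n-1)) / 2)) * x powi n)"
      by (intro sum.cong refl) (simp add: b_def t_def)
    finally show ?thesis using finite_jacobi_triple_product[OF p x, of N] by simp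
  qed
  have int: "integrable (count_space UNIV) t" unfolding t_def by (rule theta_eq_integral(2)[OF p x])
  have blim: "(\<lambda>N. b N n) \<longlonglongrightarrow> 1 / L" for n
  proof -
    have "(\<lambda>N. qpoch p (2*N) / (qpoch p (nat (n + int N)) * qpoch p (nat (int N - n)))) \<longlonglongrightarrow> L / (L * L)"
    proof (intro tendsto_intros)
      have f: "filterlim (\<lambda>N::nat. 2 * N) at_top sequentially"
        "filterlim (\<lambda>N. nat (n + int N)) at_top sequentially" "filterlim (\<lambda>N. nat (int N - n)) at_top sequentially"
        unfolding filterlim_at_top eventually_sequentially
      proof safe
        fix Z :: nat
        show "\<exists>N. \<forall>m\<ge>N. Z \<le> 2 * m" by (rule exI[of _ Z]) auto
        show "\<exists>N. \<forall>m\<ge>N. Z \<le> nat (n + int m)" by (rule exI[of _ "Z + nat \<bar>n\<bar>"]) auto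
        show "\<exists>N. \<forall>m\<ge>N. Z \<le> nat (int m - n)" by (rule exI[of _ "Z + nat \<bar>n\<bar>"]) auto
      qed
      show "(\<lambda>N. qpoch p (2*N)) \<longlonglongrightarrow> L" "(\<lambda>N. qpoch p (nat (n + int N))) \<longlonglongrightarrow> L" "(\<lambda>N. qpoch p (nat (int N - n))) \<longlonglongrightarrow> L"
        using f by (auto intro: filterlim_compose[OF L(1)])
    qed (use L in auto)
    moreover have "\<forall>\<^sub>F N in sequentially. b N n = qpoch p (2*N) / (qpoch p (nat (n + int N)) * qpoch p (nat (int N - n)))"
      unfolding eventually_sequentially
    proof (intro exI[of _ "nat \<bar>n\<bar>"] allI impI)
      fix N assume "nat \<bar>n\<bar> \<le> N"
      then have *: "n \<in> {-int N..int N}" "2 * N - nat (n + int N) = nat (int N - n)" "nat (n + int N) \<le> 2 * N" by auto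
      show "b N n = qpoch p (2*N) / (qpoch p (nat (n + int N)) * qpoch p (nat (int N - n)))"
        unfolding b_def qbinom_def *(2) using * by simp
    qed
    ultimately show ?thesis using L by (subst tendsto_cong) auto
  qed
  have bb: "0 \<le> b N n" "b N n \<le> 1 / (L * L)" for N n
  proof -
    have "0 \<le> qbinom p m j \<and> qbinom p m j \<le> 1 / (L * L)" for m j
      using L(2) L(3)[of j] L(3)[of "m-j"] qpoch_bounds[OF p, of m] qpoch_bounds[OF p, of j] qpoch_bounds[OF p, of "m-j"]
      unfolding qbinom_def by (auto intro!: frac_le mult_mono)
    then show "0 \<le> b N n" "b N n \<le> 1 / (L * L)" using L by (auto simp: b_def)
  qed
  have "(\<lambda>N. \<integral>n. of_real (b N n) * t n \<partial>count_space UNIV) \<longlonglongrightarrow> (\<integral>n. of_real (1/L) * t n \<partial>count_space UNIV)"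
  proof (rule integral_dominated_convergence)
    show "integrable (count_space UNIV) (\<lambda>n. 1 / (L * L) * norm (t n))" using int by simp
    show "AE n in count_space UNIV. (\<lambda>N. of_real (b N n) * t n) \<longlonglongrightarrow> of_real (1/L) * t n"
      by (intro AE_I2 tendsto_intros blim)
    show "AE n in count_space UNIV. norm (of_real (b N n) * t n) \<le> 1 / (L * L) * norm (t n)" for N
      unfolding norm_mult norm_of_real using bb[of N] by (intro AE_I2 mult_right_mono) auto
  qed auto
  moreover have "(\<integral>n. of_real (1/L) * t n \<partial>count_space UNIV) = of_real (1/L) * theta p x"
    unfolding theta_eq_integral(1)[OF p x] t_def by (rule integral_mult_right_zero)
  moreover have "of_real (1/L) * theta p x = theta p x / of_real L" by simp
  ultimately show ?thesis unfolding P by metis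
qed

text \<open>By the triple product, zeros can only come from single factors, and these vanish only on the
  negative real half-line.\<close>

lemma theta_nonzero:
  assumes p: "0 < p" "p < 1" and x: "\<And>r. r > 0 \<Longrightarrow> 1 + of_real r * x \<noteq> 0" "x \<noteq> 0"
  shows "theta p x \<noteq> 0"
proof -
  obtain L where L: "qpoch p \<longlonglongrightarrow> L" "L > 0" "\<And>n. L \<le> qpoch p n" using qpoch_limit[OF p] by blast
  define f where "f i = (1 + x * of_real (p ^ i))" for i
  define g where "g i = (1 + of_real (p ^ Suc i) / x)" for i
  have "abs_convergent_prod f" "abs_convergent_prod g"
    unfolding abs_convergent_prod_conv_summable f_def g_def using p
    by (auto simp: norm_mult norm_power norm_divide intro!: summable_mult summable_divide)
  then have c: "convergent_prod f" "convergent_prod g" by (auto intro: abs_convergent_prod_imp_convergent_prod)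
  have fnz: "f i \<noteq> 0" for i using x(1)[of "p ^ i"] p by (simp add: f_def mult.commute)
  have gnz: "g i \<noteq> 0" for i
  proof -
    have "1 + of_real (1 / p ^ Suc i) * x \<noteq> 0" using x(1)[of "1 / p ^ Suc i"] p by simp
    moreover have "g i = of_real (p ^ Suc i) / x * (1 + of_real (1 / p ^ Suc i) * x)"
      using x(2) p by (simp add: g_def field_simps)
    ultimately show ?thesis using x(2) p by auto
  qed
  have "(\<lambda>n. (\<Prod>i\<le>n. f i) * (\<Prod>i\<le>n. g i)) \<longlonglongrightarrow> prodinf f * prodinf g"
    by (intro tendsto_mult convergent_prod_LIMSEQ c)
  then have "(\<lambda>n. \<Prod>i<Suc n. f i * g i) \<longlonglongrightarrow> prodinf f * prodinf g"
    by (simp add: lessThan_Suc_atMost prod.distrib)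
  then have "(\<lambda>N. \<Prod>i<N. f i * g i) \<longlonglongrightarrow> prodinf f * prodinf g" by (rule LIMSEQ_imp_Suc)
  moreover have "(\<lambda>N. \<Prod>i<N. f i * g i) \<longlonglongrightarrow> theta p x / of_real L"
    unfolding f_def g_def by (rule theta_triple_product_limit[OF p x(2) L])
  ultimately have "theta p x / of_real L = prodinf f * prodinf g" by (rule LIMSEQ_unique[symmetric])
  then show ?thesis using prodinf_nonzero[OF c(1) fnz] prodinf_nonzero[OF c(2) gnz] by auto
qed

text \<open>The radial function with the same behaviour as theta under \<open>x \<mapsto> p x\<close> (\<open>theta_growth_shift\<close>).\<close>

definition theta_growth :: "real \<Rightarrow> real \<Rightarrow> real" where
  "theta_growth p y = exp ((ln y)\<^sup>2 / (2 * (- ln p)) + ln y / 2)"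

lemma theta_growth_shift:
  assumes p: "0 < p" "p < 1" and y: "y > 0"
  shows "theta_growth p (p * y) = theta_growth p y / y"
proof -
  define l where "l = - ln p"
  have l: "l > 0" "ln p = - l" using p by (auto simp: l_def)
  have "(ln y - l)\<^sup>2 / (2 * l) + (ln y - l) / 2 = (ln y)\<^sup>2 / (2 * l) + ln y / 2 - ln y"
    using l by (simp add: field_simps power2_eq_square)
  then have "(ln (p * y))\<^sup>2 / (2 * l) + ln (p * y) / 2 = (ln y)\<^sup>2 / (2 * l) + ln y / 2 - ln y"
    using p y l(2) by (simp add: ln_mult)
  then show ?thesis using y unfolding theta_growth_def l_def[symmetric] by (simp only: exp_diff exp_ln)
qed

text \<open>The quotient of \<open>|theta|\<close> and \<open>theta_growth\<close> is invariant under \<open>x \<mapsto> p x\<close>. On the closed cone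
  it therefore takes all its values on the compact part of the cone with \<open>p \<le> |x| \<le> 1\<close>, where it is
  continuous and positive.\<close>

lemma theta_lower_bound:
  assumes p: "0 < p" "p < 1" and \<delta>: "\<delta> > 0"
  shows "\<exists>c>0. \<forall>x. x \<noteq> 0 \<longrightarrow> (\<forall>r\<ge>0. \<delta> \<le> cmod (1 + of_real r * x)) \<longrightarrow> c * theta_growth p (cmod x) \<le> cmod (theta p x)"
proof -
  define Cone where "Cone = {x :: complex. \<forall>r\<ge>0. \<delta> \<le> cmod (1 + of_real r * x)}"
  define K where "K = Cone \<inter> (cball 0 1 - ball 0 p)"
  define \<Phi> where "\<Phi> x = cmod (theta p x) / theta_growth p (cmod x)" for x
  have Cone: "r > 0 \<Longrightarrow> x \<in> Cone \<Longrightarrow> of_real r * x \<in> Cone" for r x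
  proof -
    assume r: "r > 0" and x: "x \<in> Cone"
    show "of_real r * x \<in> Cone"
      unfolding Cone_def
    proof (intro CollectI allI impI)
      fix s :: real assume "s \<ge> 0"
      then have "s * r \<ge> 0" using r by simp
      then have "\<delta> \<le> cmod (1 + of_real (s * r) * x)" using x unfolding Cone_def by blast
      then show "\<delta> \<le> cmod (1 + of_real s * (of_real r * x))" by (simp add: mult.assoc)
    qed
  qed
  have "closed Cone"
  proof -
    have "Cone = (\<Inter>r\<in>{0..}. {x. \<delta> \<le> cmod (1 + of_real r * x)})" by (auto simp: Cone_def)
    moreover have "closed {x. \<delta> \<le> cmod (1 + of_real r * x)}" for r
      by (intro closed_Collect_le continuous_intros)
    ultimately show ?thesis by (metis (no_types, lifting) closed_INT)
  qed
  then have cK: "compact K" unfolding K_def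
    by (intro closed_Int_compact compact_diff compact_cball open_ball)
  have K0: "x \<noteq> 0" if "x \<in> K" for x using that p by (auto simp: K_def)
  have \<Phi>pos: "\<Phi> x > 0" if "x \<in> Cone" "x \<noteq> 0" for x
  proof -
    have "theta p x \<noteq> 0"
    proof (rule theta_nonzero[OF p])
      fix r :: real assume "r > 0"
      then have "\<delta> \<le> cmod (1 + of_real r * x)" using that by (simp add: Cone_def)
      then show "1 + of_real r * x \<noteq> 0" using \<delta> by auto
    qed (use that in auto)
    then show ?thesis by (simp add: \<Phi>_def theta_growth_def)
  qed
  have cont: "continuous_on K \<Phi>"
  proof -
    have "continuous_on K (theta p)"
      by (rule continuous_on_subset[OF holomorphic_on_imp_continuous_on[OF theta_holomorphic[OF p]]]) (use K0 in auto)
    then show ?thesis unfolding \<Phi>_def theta_growth_def using K0 p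
      by (intro continuous_intros) auto
  qed
  obtain c where c: "c > 0" "\<And>x. x \<in> K \<Longrightarrow> c \<le> \<Phi> x"
  proof (cases "K = {}")
    case True
    then show ?thesis using that[of 1] by simp
  next
    case False
    from continuous_attains_inf[OF cK this cont] obtain y where y: "y \<in> K" "\<And>x. x \<in> K \<Longrightarrow> \<Phi> y \<le> \<Phi> x" by blast
    then show ?thesis using that[of "\<Phi> y"] \<Phi>pos K0[of y] by (auto simp: K_def)
  qed
  have inv: "\<Phi> (of_real p * x) = \<Phi> x" if "x \<noteq> 0" for x
    using theta_shift[OF p that] theta_growth_shift[OF p, of "cmod x"] that p
    by (simp add: \<Phi>_def norm_mult norm_divide)
  have inv_nat: "\<Phi> (of_real (p ^ n) * x) = \<Phi> x" if "x \<noteq> 0" for x n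
  proof (induction n)
    case (Suc n)
    then show ?case using inv[of "of_real (p ^ n) * x"] that p by (simp add: mult.assoc)
  qed simp
  have bound: "c \<le> \<Phi> x" if x: "x \<in> Cone" "x \<noteq> 0" for x
  proof -
    define l where "l = - ln p"
    have l: "l > 0" using p by (simp add: l_def)
    define m where "m = \<lceil>ln (cmod x) / l\<rceil>"
    have m: "ln (cmod x) - m * l \<le> 0" "ln (cmod x) - m * l > - l"
    proof -
      have "ln (cmod x) / l \<le> m" "m < ln (cmod x) / l + 1"
        using ceiling_correct[of "ln (cmod x) / l"] by (auto simp: m_def)
      then show "ln (cmod x) - m * l \<le> 0" "ln (cmod x) - m * l > - l"
        using l by (simp_all add: field_simps)
    qed
    define y where "y = of_real (p powr m) * x"
    have yC: "y \<in> Cone" "y \<noteq> 0" using Cone[of "p powr m" x] x p by (auto simp: y_def)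
    have "ln (cmod y) = ln (cmod x) - m * l" using x p by (simp add: y_def norm_mult ln_mult ln_powr l_def)
    then have "ln (cmod y) \<le> ln 1" "ln p \<le> ln (cmod y)" using m by (auto simp: l_def)
    then have "cmod y \<le> 1" "p \<le> cmod y" using p yC(2) by (auto simp: ln_le_cancel_iff simp del: ln_one ln_le_zero_iff)
    then have "y \<in> K" using yC by (auto simp: K_def)
    then have "c \<le> \<Phi> y" by (rule c(2))
    also have "\<Phi> y = \<Phi> x"
    proof (cases "m \<ge> 0")
      case True
      then have "p powr m = p ^ nat m" using p by (metis of_nat_nat powr_realpow of_int_of_nat_eq)
      then show ?thesis using inv_nat[OF x(2)] by (simp add: y_def)
    next
      case False
      have "p ^ nat (- m) = p powr (- m)" using p False by (subst powr_realpow[symmetric]) auto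
      then have "x = of_real (p ^ nat (- m)) * y"
        using p by (simp add: y_def powr_minus_divide del: of_real_power)
      then show ?thesis using inv_nat[OF yC(2)] by metis
    qed
    finally show ?thesis .
  qed
  show ?thesis
  proof (intro exI[of _ c] conjI allI impI c(1))
    fix x assume x: "x \<noteq> 0" "\<forall>r\<ge>0. \<delta> \<le> cmod (1 + of_real r * x)"
    then have "c \<le> \<Phi> x" by (intro bound) (auto simp: Cone_def)
    then show "c * theta_growth p (cmod x) \<le> cmod (theta p x)"
      by (simp add: \<Phi>_def theta_growth_def pos_le_divide_eq)
  qed
qed

section \<open>Inverse Fourier transform of exponentially decaying functions\<close>

lemma integrable_powr_decay:
  assumes a: "a > 1"
  shows "integrable lborel (\<lambda>x::real. (1 + \<bar>x\<bar>) powr (- a))"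
proof -
  define f where "f x = indicator {0..} x * (1 + x) powr (- a)" for x :: real
  have "integrable lborel f"
  proof (rule integrableI_nonneg)
    show "f \<in> borel_measurable lborel" unfolding f_def by measurable
    show "AE x in lborel. 0 \<le> f x" by (simp add: f_def)
    have lim: "((\<lambda>x::real. (1 + x) powr (1 - a) / (1 - a)) \<longlongrightarrow> 0) at_top"
    proof -
      have "((\<lambda>x::real. (1 + x) powr (1 - a)) \<longlongrightarrow> 0) at_top"
        by (rule tendsto_neg_powr) (use a in \<open>auto intro: filterlim_tendsto_add_at_top[OF tendsto_const filterlim_ident]\<close>)
      from tendsto_divide[OF this tendsto_const[of "1 - a"]] show ?thesis using a by simp
    qed
    have "(\<integral>\<^sup>+x. ennreal ((1 + x) powr (- a)) * indicator {0..} x \<partial>lborel) = ennreal (0 - (1 + 0) powr (1 - a) / (1 - a))"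
    proof (rule nn_integral_FTC_atLeast[OF _ _ _ lim])
      fix x :: real assume x: "0 \<le> x"
      show "((\<lambda>x. (1 + x) powr (1 - a) / (1 - a)) has_real_derivative (1 + x) powr (- a)) (at x)"
      proof -
        have "((\<lambda>x. (1 + x) powr (1 - a)) has_real_derivative (1 - a) * (1 + x) powr (1 - a - of_nat 1) * 1) (at x)"
          by (rule DERIV_fun_powr) (use x in \<open>auto intro!: derivative_eq_intros\<close>)
        from DERIV_cdivide[OF this, of "1 - a"] show ?thesis using a by simp
      qed
    qed auto
    also have "(\<integral>\<^sup>+x. ennreal ((1 + x) powr (- a)) * indicator {0..} x \<partial>lborel) = (\<integral>\<^sup>+x. ennreal (f x) \<partial>lborel)"
      by (intro nn_integral_cong) (auto simp: f_def split: split_indicator)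
    finally show "(\<integral>\<^sup>+x. ennreal (f x) \<partial>lborel) < \<infinity>" by simp
  qed
  then have "integrable lborel (\<lambda>x. f x + f (0 + (-1) * x))"
    by (intro Bochner_Integration.integrable_add lborel_integrable_real_affine) auto
  then show ?thesis
    by (rule Bochner_Integration.integrable_bound) (auto simp: f_def split: split_indicator)
qed

lemma Fubini_swap_lborel:
  fixes f :: "real \<Rightarrow> real \<Rightarrow> complex"
  assumes m: "case_prod f \<in> borel_measurable (borel \<Otimes>\<^sub>M borel)"
    and i: "\<And>x. integrable lborel (f x)"
    and g: "integrable lborel g" "\<And>x. (\<integral>y. cmod (f x y) \<partial>lborel) \<le> g x"
  shows "(\<integral>x. (\<integral>y. f x y \<partial>lborel) \<partial>lborel) = (\<integral>y. (\<integral>x. f x y \<partial>lborel) \<partial>lborel)"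
proof -
  have m'[measurable]: "case_prod f \<in> borel_measurable (lborel \<Otimes>\<^sub>M lborel)"
    using m by (simp cong: measurable_cong_sets sets_pair_measure_cong)
  have "integrable (lborel \<Otimes>\<^sub>M lborel) (case_prod f)"
  proof (rule lborel_pair.Fubini_integrable[OF m'])
    show "AE x in lborel. integrable lborel (\<lambda>y. case (x, y) of (x, y) \<Rightarrow> f x y)" using i by simp
    show "integrable lborel (\<lambda>x. \<integral>y. norm (case (x, y) of (x, y) \<Rightarrow> f x y) \<partial>lborel)"
    proof (rule Bochner_Integration.integrable_bound[OF g(1)])
      show "(\<lambda>x. \<integral>y. norm (case (x, y) of (x, y) \<Rightarrow> f x y) \<partial>lborel) \<in> borel_measurable lborel" by measurable
      show "AE x in lborel. norm (\<integral>y. norm (case (x, y) of (x, y) \<Rightarrow> f x y) \<partial>lborel) \<le> norm (g x)"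
      proof (rule AE_I2)
        fix x
        have "0 \<le> (\<integral>y. cmod (f x y) \<partial>lborel)" by (rule Bochner_Integration.integral_nonneg) simp
        then show "norm (\<integral>y. norm (case (x, y) of (x, y) \<Rightarrow> f x y) \<partial>lborel) \<le> norm (g x)" using g(2)[of x] by simp
      qed
    qed
  qed
  from lborel_pair.Fubini_integral[OF this] show ?thesis by simp
qed

lemma poly_le_exp:
  assumes "\<eta> > 0"
  shows "\<exists>C>0. \<forall>x\<ge>0. (1 + x) ^ n \<le> C * exp (\<eta> * x :: real)"
proof (cases "n = 0")
  case True
  then show ?thesis using assms by (intro exI[of _ 1]) auto
next
  case False
  define c where "c = max 1 (real n / \<eta>)"
  have c: "c \<ge> 1" "c * \<eta> \<ge> n" using assms by (auto simp: c_def pos_divide_le_eq[symmetric])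
  have "(1 + x) ^ n \<le> c ^ n * exp (\<eta> * x)" if x: "x \<ge> 0" for x
  proof -
    have "n * x \<le> c * \<eta> * x" using c x by (intro mult_right_mono) auto
    then have "x \<le> c * \<eta> * x / n" using False by (simp add: field_simps)
    then have "1 + x \<le> c * (1 + \<eta> * x / n)" using c by (simp add: distrib_left)
    then have "(1 + x) ^ n \<le> (c * (1 + \<eta> * x / n)) ^ n" using x by (intro power_mono) auto
    also have "\<dots> = c ^ n * (1 + \<eta> * x / n) ^ n" by (rule power_mult_distrib)
    also have "\<dots> \<le> c ^ n * exp (\<eta> * x)"
    proof (rule mult_left_mono)
      have "(1 + \<eta> * x / n) ^ n \<le> exp (\<eta> * x / n) ^ n"
        using assms x by (intro power_mono) (auto simp: exp_ge_add_one_self)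
      also have "\<dots> = exp (\<eta> * x)" using False by (simp add: exp_of_nat_mult[symmetric])
      finally show "(1 + \<eta> * x / n) ^ n \<le> exp (\<eta> * x)" .
    qed (use c in auto)
    finally show ?thesis .
  qed
  then show ?thesis using c by (intro exI[of _ "c ^ n"]) auto
qed

text \<open>The polynomial factor makes the class stable under multiplication by the symbols of differential
  operators, of whatever degree; inside the strip the exponential always wins.\<close>

definition exp_decay :: "real \<Rightarrow> (real \<Rightarrow> complex) \<Rightarrow> bool" where
  "exp_decay \<beta> h \<longleftrightarrow> h \<in> borel_measurable borel \<and>
     (\<exists>K N. \<forall>m. cmod (h m) \<le> K * (1 + \<bar>m\<bar>) ^ N * exp (- \<beta> * \<bar>m\<bar>))"

lemma exp_decay_add:
  assumes "exp_decay \<beta> f" "exp_decay \<beta> g"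
  shows "exp_decay \<beta> (\<lambda>m. f m + g m)"
proof -
  obtain K N K' N' where 1: "\<And>m. cmod (f m) \<le> K * (1 + \<bar>m\<bar>) ^ N * exp (- \<beta> * \<bar>m\<bar>)"
     "\<And>m. cmod (g m) \<le> K' * (1 + \<bar>m\<bar>) ^ N' * exp (- \<beta> * \<bar>m\<bar>)" using assms unfolding exp_decay_def by blast
  have "cmod (f m + g m) \<le> (\<bar>K\<bar> + \<bar>K'\<bar>) * (1 + \<bar>m\<bar>) ^ (N + N') * exp (- \<beta> * \<bar>m\<bar>)" for m
  proof -
    have "K * (1 + \<bar>m\<bar>) ^ N \<le> \<bar>K\<bar> * (1 + \<bar>m\<bar>) ^ (N + N')" "K' * (1 + \<bar>m\<bar>) ^ N' \<le> \<bar>K'\<bar> * (1 + \<bar>m\<bar>) ^ (N + N')"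
      by (intro mult_mono power_increasing; simp)+
    then have "K * (1 + \<bar>m\<bar>) ^ N * exp (- \<beta> * \<bar>m\<bar>) + K' * (1 + \<bar>m\<bar>) ^ N' * exp (- \<beta> * \<bar>m\<bar>)
      \<le> (\<bar>K\<bar> + \<bar>K'\<bar>) * (1 + \<bar>m\<bar>) ^ (N + N') * exp (- \<beta> * \<bar>m\<bar>)"
      unfolding distrib_right[symmetric] by (intro mult_right_mono) (simp_all add: distrib_right)
    then show ?thesis using 1[of m] norm_triangle_ineq[of "f m" "g m"] by linarith
  qed
  then show ?thesis using assms unfolding exp_decay_def by (auto intro!: exI[of _ "\<bar>K\<bar> + \<bar>K'\<bar>"] exI[of _ "N+N'"])
qed

lemma exp_decay_cmult: "exp_decay \<beta> f \<Longrightarrow> exp_decay \<beta> (\<lambda>m. c * f m)"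
  unfolding exp_decay_def
proof safe
  fix K N assume "\<forall>m. cmod (f m) \<le> K * (1 + \<bar>m\<bar>) ^ N * exp (- \<beta> * \<bar>m\<bar>)"
  then have "\<forall>m. cmod (c * f m) \<le> (cmod c * K) * (1 + \<bar>m\<bar>) ^ N * exp (- \<beta> * \<bar>m\<bar>)"
    by (simp add: norm_mult mult.assoc mult_left_mono)
  then show "\<exists>K N. \<forall>m. cmod (c * f m) \<le> K * (1 + \<bar>m\<bar>) ^ N * exp (- \<beta> * \<bar>m\<bar>)" by blast
qed auto

lemma exp_decay_mult_ident: "exp_decay \<beta> f \<Longrightarrow> exp_decay \<beta> (\<lambda>m. (\<i> * of_real m) * f m)"
  unfolding exp_decay_def
proof safe
  fix K N assume *: "\<forall>m. cmod (f m) \<le> K * (1 + \<bar>m\<bar>) ^ N * exp (- \<beta> * \<bar>m\<bar>)"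
  have "cmod ((\<i> * of_real m) * f m) \<le> K * (1 + \<bar>m\<bar>) ^ (Suc N) * exp (- \<beta> * \<bar>m\<bar>)" for m
  proof -
    have "\<bar>m\<bar> * cmod (f m) \<le> (1 + \<bar>m\<bar>) * (K * (1 + \<bar>m\<bar>) ^ N * exp (- \<beta> * \<bar>m\<bar>))"
      by (rule mult_mono) (use * in auto)
    then show ?thesis by (simp add: norm_mult mult_ac)
  qed
  then show "\<exists>K N. \<forall>m. cmod ((\<i> * of_real m) * f m) \<le> K * (1 + \<bar>m\<bar>) ^ N * exp (- \<beta> * \<bar>m\<bar>)" by blast
qed auto

lemma exp_decay_poly:
  assumes "exp_decay \<beta> f"
  shows "exp_decay \<beta> (\<lambda>m. poly R (\<i> * of_real m) * f m)"
proof (induction R)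
  case 0
  have "exp_decay \<beta> (\<lambda>m. 0 * f m)" by (rule exp_decay_cmult[OF assms])
  then show ?case by simp
next
  case (pCons a R)
  have "exp_decay \<beta> (\<lambda>m. a * f m + (\<i> * of_real m) * (poly R (\<i> * of_real m) * f m))"
    by (intro exp_decay_add exp_decay_cmult exp_decay_mult_ident assms pCons)
  then show ?case by (simp add: algebra_simps)
qed

text \<open>On the line of height \<open>Im z\<close> the Fourier kernel costs a factor \<open>exp (|Im z| |m|)\<close>.\<close>

lemma fourier_kernel_bound:
  assumes "\<bar>Im z\<bar> \<le> b" "\<forall>m. cmod (h m) \<le> K * (1 + \<bar>m\<bar>) ^ N * exp (- \<beta> * \<bar>m\<bar>)"
  shows "cmod (h m * exp (\<i> * z * of_real m)) \<le> K * ((1 + \<bar>m\<bar>) ^ N * exp (- (\<beta> - b) * \<bar>m\<bar>))"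
proof -
  have "- (Im z * m) \<le> b * \<bar>m\<bar>"
    using mult_right_mono[OF assms(1), of "\<bar>m\<bar>"] abs_ge_minus_self[of "Im z * m"] by (simp add: abs_mult)
  then have "cmod (exp (\<i> * z * of_real m)) \<le> exp (b * \<bar>m\<bar>)" by simp
  then have "cmod (h m * exp (\<i> * z * of_real m)) \<le> cmod (h m) * exp (b * \<bar>m\<bar>)"
    unfolding norm_mult by (intro mult_left_mono) auto
  also have "\<dots> \<le> K * (1 + \<bar>m\<bar>) ^ N * exp (- \<beta> * \<bar>m\<bar>) * exp (b * \<bar>m\<bar>)"
    using assms(2) by (intro mult_right_mono) auto
  also have "\<dots> = K * ((1 + \<bar>m\<bar>) ^ N * exp (- (\<beta> - b) * \<bar>m\<bar>))"
    by (simp add: mult.assoc exp_add[symmetric] algebra_simps)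
  finally show ?thesis .
qed

lemma integrable_poly_exp:
  assumes "\<eta> > 0"
  shows "integrable lborel (\<lambda>m. (1 + \<bar>m\<bar>) ^ N * exp (- \<eta> * \<bar>m\<bar>) :: real)"
proof -
  obtain C where C: "C > 0" "\<And>x. x \<ge> 0 \<Longrightarrow> (1 + x) ^ (N + 2) \<le> C * exp (\<eta> * x)" using poly_le_exp[OF assms] by blast
  have "integrable lborel (\<lambda>m. C * (1 + \<bar>m\<bar>) powr (- 2))" by (intro integrable_mult_right integrable_powr_decay) simp
  then show ?thesis
  proof (rule Bochner_Integration.integrable_bound)
    show "AE m in lborel. norm ((1 + \<bar>m\<bar>) ^ N * exp (- \<eta> * \<bar>m\<bar>)) \<le> norm (C * (1 + \<bar>m\<bar>) powr (- 2))"
    proof (rule AE_I2)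
      fix m :: real
      have *: "(1 + \<bar>m\<bar>) powr (- 2) = 1 / (1 + \<bar>m\<bar>)^2" by (simp add: powr_minus_divide powr_numeral)
      show "norm ((1 + \<bar>m\<bar>) ^ N * exp (- \<eta> * \<bar>m\<bar>)) \<le> norm (C * (1 + \<bar>m\<bar>) powr (- 2))"
      proof -
        have gen: "A / E \<le> C / B" if "A * B \<le> C * E" "B > 0" "E > 0" for A B E :: real
          using that by (simp add: field_simps)
        have "(1 + \<bar>m\<bar>) ^ N / exp (\<eta> * \<bar>m\<bar>) \<le> C / (1 + \<bar>m\<bar>)^2"
          by (rule gen) (use C(2)[of "\<bar>m\<bar>", unfolded power_add] in simp_all)
        then show ?thesis using C(1) *(1) by (simp add: exp_minus inverse_eq_divide)
      qed
    qed
  qed measurable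
qed

lemma exp_decay_integrable:
  assumes "exp_decay \<beta> h" "z \<in> strip \<beta>"
  shows "integrable lborel (\<lambda>m. h m * exp (\<i> * z * of_real m))"
proof -
  obtain K N where K: "\<forall>m. cmod (h m) \<le> K * (1 + \<bar>m\<bar>) ^ N * exp (- \<beta> * \<bar>m\<bar>)" and [measurable]: "h \<in> borel_measurable borel"
    using assms unfolding exp_decay_def by blast
  have "integrable lborel (\<lambda>m. K * ((1 + \<bar>m\<bar>) ^ N * exp (- (\<beta> - \<bar>Im z\<bar>) * \<bar>m\<bar>)))"
    using assms by (intro integrable_mult_right integrable_poly_exp) (simp add: strip_def)
  then show ?thesis
  proof (rule Bochner_Integration.integrable_bound)
    show "AE m in lborel. norm (h m * exp (\<i> * z * of_real m)) \<le> norm (K * ((1 + \<bar>m\<bar>) ^ N * exp (- (\<beta> - \<bar>Im z\<bar>) * \<bar>m\<bar>)))"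
      unfolding real_norm_def by (intro AE_I2 order_trans[OF fourier_kernel_bound[OF order_refl K] abs_ge_self])
  qed measurable
qed

lemma open_strip: "open (strip b)"
  unfolding strip_def by (intro open_Collect_less continuous_intros)

lemma
  assumes h: "exp_decay \<beta> h"
  shows inv_fourier_holomorphic: "inv_fourier h holomorphic_on strip \<beta>"
    and deriv_inv_fourier: "z \<in> strip \<beta> \<Longrightarrow> deriv (inv_fourier h) z = inv_fourier (\<lambda>m. (\<i> * of_real m) * h m) z"
proof -
  obtain K N where K: "\<forall>m. cmod (h m) \<le> K * (1 + \<bar>m\<bar>) ^ N * exp (- \<beta> * \<bar>m\<bar>)" and [measurable]: "h \<in> borel_measurable borel"
    using h unfolding exp_decay_def by blast
  have dom: "\<exists>r g. 0 < r \<and> ball z r \<subseteq> strip \<beta> \<and> integrable lborel g \<and>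
      (\<forall>w\<in>ball z r. \<forall>m. cmod (h m * exp (\<i> * w * of_real m)) \<le> g m)" if z: "z \<in> strip \<beta>" for z
  proof -
    define b where "b = (\<bar>Im z\<bar> + \<beta>) / 2"
    have b: "\<bar>Im z\<bar> < b" "b < \<beta>" using z by (auto simp: b_def strip_def)
    have *: "\<bar>Im w\<bar> \<le> b" if "w \<in> ball z (b - \<bar>Im z\<bar>)" for w
      using that abs_Im_le_cmod[of "z - w"] by (auto simp: dist_norm)
    show ?thesis
    proof (intro exI conjI ballI allI)
      show "0 < b - \<bar>Im z\<bar>" using b by simp
      show "ball z (b - \<bar>Im z\<bar>) \<subseteq> strip \<beta>" using * b by (force simp: strip_def)
      show "integrable lborel (\<lambda>m. K * ((1 + \<bar>m\<bar>) ^ N * exp (- (\<beta> - b) * \<bar>m\<bar>)))"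
        using b by (intro integrable_mult_right integrable_poly_exp) simp
      show "cmod (h m * exp (\<i> * w * of_real m)) \<le> K * ((1 + \<bar>m\<bar>) ^ N * exp (- (\<beta> - b) * \<bar>m\<bar>))"
        if "w \<in> ball z (b - \<bar>Im z\<bar>)" for w m
        by (rule fourier_kernel_bound[OF *[OF that] K])
    qed
  qed
  have hol: "(\<lambda>z. \<integral>m. h m * exp (\<i> * z * of_real m) \<partial>lborel) holomorphic_on strip \<beta>"
    by (rule holomorphic_lebesgue_integral[OF open_strip _ _ dom]) (auto intro!: holomorphic_intros)
  show "inv_fourier h holomorphic_on strip \<beta>"
    unfolding inv_fourier_def[abs_def] by (intro holomorphic_intros hol) auto
  assume z: "z \<in> strip \<beta>"
  have "deriv (\<lambda>z. \<integral>m. h m * exp (\<i> * z * of_real m) \<partial>lborel) z = (\<integral>m. deriv (\<lambda>z. h m * exp (\<i> * z * of_real m)) z \<partial>lborel)"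
    by (rule deriv_lebesgue_integral[OF open_strip _ _ dom z]) (auto intro!: holomorphic_intros)
  also have "(\<lambda>m. deriv (\<lambda>z. h m * exp (\<i> * z * of_real m)) z) = (\<lambda>m. (\<i> * of_real m) * h m * exp (\<i> * z * of_real m))"
    by (intro ext DERIV_imp_deriv) (auto intro!: derivative_eq_intros)
  finally have d: "deriv (\<lambda>z. \<integral>m. h m * exp (\<i> * z * of_real m) \<partial>lborel) z = (\<integral>m. (\<i> * of_real m) * h m * exp (\<i> * z * of_real m) \<partial>lborel)" .
  have "(\<lambda>z. \<integral>m. h m * exp (\<i> * z * of_real m) \<partial>lborel) field_differentiable at z"
    by (rule holomorphic_on_imp_differentiable_at[OF hol open_strip z])
  then have "deriv (\<lambda>z. (\<integral>m. h m * exp (\<i> * z * of_real m) \<partial>lborel) / of_real (sqrt (2*pi))) z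
      = deriv (\<lambda>z. \<integral>m. h m * exp (\<i> * z * of_real m) \<partial>lborel) z / of_real (sqrt (2*pi))"
    by (rule deriv_cdivide_right)
  then show "deriv (inv_fourier h) z = inv_fourier (\<lambda>m. (\<i> * of_real m) * h m) z"
    unfolding inv_fourier_def[abs_def] d .
qed

lemma higher_deriv_inv_fourier:
  assumes h: "exp_decay \<beta> h"
  shows "z \<in> strip \<beta> \<Longrightarrow> (deriv ^^ j) (inv_fourier h) z = inv_fourier (\<lambda>m. (\<i> * of_real m) ^ j * h m) z"
    and "exp_decay \<beta> (\<lambda>m. (\<i> * of_real m) ^ j * h m)"
proof (induction j arbitrary: z)
  case (Suc j)
  { case 1
    have "(deriv ^^ Suc j) (inv_fourier h) z = deriv ((deriv ^^ j) (inv_fourier h)) z" by simp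
    also have "\<dots> = deriv (inv_fourier (\<lambda>m. (\<i> * of_real m) ^ j * h m)) z"
    proof (rule deriv_cong_ev)
      show "\<forall>\<^sub>F w in nhds z. (deriv ^^ j) (inv_fourier h) w = inv_fourier (\<lambda>m. (\<i> * of_real m) ^ j * h m) w"
        using eventually_nhds_in_open[OF open_strip 1] by eventually_elim (rule Suc(1))
    qed simp
    also have "\<dots> = inv_fourier (\<lambda>m. (\<i> * of_real m) ^ Suc j * h m) z"
      using deriv_inv_fourier[OF Suc(2) 1] by (simp add: mult.assoc)
    finally show ?case . }
  { case 2
    show ?case using exp_decay_mult_ident[OF Suc(2)] by (simp add: mult.assoc) }
qed (use h in auto)

lemma inv_fourier_sum:
  assumes "finite A" "\<And>j. j \<in> A \<Longrightarrow> exp_decay \<beta> (h j)" "z \<in> strip \<beta>"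
  shows "inv_fourier (\<lambda>m. \<Sum>j\<in>A. h j m) z = (\<Sum>j\<in>A. inv_fourier (h j) z)"
  unfolding inv_fourier_def sum_distrib_right sum_divide_distrib[symmetric]
  by (subst Bochner_Integration.integral_sum) (use assms exp_decay_integrable in auto)

lemma inv_fourier_add:
  assumes "exp_decay \<beta> f" "exp_decay \<beta> g" "z \<in> strip \<beta>"
  shows "inv_fourier (\<lambda>m. f m + g m) z = inv_fourier f z + inv_fourier g z"
  unfolding inv_fourier_def distrib_right add_divide_distrib[symmetric]
  by (subst Bochner_Integration.integral_add) (use assms exp_decay_integrable in auto)

lemma inv_fourier_cmult: "inv_fourier (\<lambda>m. c * f m) z = c * inv_fourier f z"
  unfolding inv_fourier_def mult.assoc by simp

lemma diff_op_inv_fourier: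
  assumes h: "exp_decay \<beta> h" and z: "z \<in> strip \<beta>"
  shows "diff_op R (inv_fourier h) z = inv_fourier (\<lambda>m. poly R (\<i> * of_real m) * h m) z"
proof -
  have "(\<lambda>m. poly R (\<i> * of_real m) * h m) = (\<lambda>m. \<Sum>j\<le>degree R. coeff R j * ((\<i> * of_real m) ^ j * h m))"
    by (simp add: poly_altdef sum_distrib_right mult.assoc)
  then have "inv_fourier (\<lambda>m. poly R (\<i> * of_real m) * h m) z = (\<Sum>j\<le>degree R. inv_fourier (\<lambda>m. coeff R j * ((\<i> * of_real m) ^ j * h m)) z)"
    by (simp only:) (intro inv_fourier_sum[OF _ _ z] exp_decay_cmult higher_deriv_inv_fourier(2) h, simp)
  then show ?thesis
    unfolding diff_op_def inv_fourier_cmult by (simp add: higher_deriv_inv_fourier(1)[OF h z])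
qed

text \<open>Products become convolutions: Fubini's theorem, with the kernel split as \<open>e (m) = e (m - m1) e (m1)\<close>.\<close>

lemma inv_fourier_mult:
  assumes f: "exp_decay \<beta> f" and g: "exp_decay \<beta> g" and z: "z \<in> strip \<beta>"
  shows "inv_fourier f z * inv_fourier g z
       = inv_fourier (\<lambda>m. (\<integral>m1. f (m - m1) * g m1 \<partial>lborel) / of_real (sqrt (2 * pi))) z"
proof -
  define e where "e m = exp (\<i> * z * complex_of_real m)" for m
  have [measurable]: "f \<in> borel_measurable borel" "g \<in> borel_measurable borel" "e \<in> borel_measurable borel"
    using f g unfolding exp_decay_def e_def by auto
  have e_add: "e (x + y) = e x * e y" for x y by (simp add: e_def exp_add[symmetric] algebra_simps)
  have iF: "integrable lborel (\<lambda>m. f m * e m)" and iG: "integrable lborel (\<lambda>m. g m * e m)"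
    using exp_decay_integrable[OF f z] exp_decay_integrable[OF g z] by (simp_all add: e_def)
  have iFs: "integrable lborel (\<lambda>m. f (m - m1) * e (m - m1))" for m1
    using lborel_integrable_real_affine[OF iF, of 1 "- m1"] by simp
  have sF: "(\<integral>m. f (m - m1) * e (m - m1) \<partial>lborel) = (\<integral>m. f m * e m \<partial>lborel)" for m1
    using lborel_integral_real_affine[of 1 "\<lambda>m. f m * e m" "- m1"] by simp
  have sFn: "(\<integral>m. cmod (f (m - m1) * e (m - m1)) \<partial>lborel) = (\<integral>m. cmod (f m * e m) \<partial>lborel)" for m1
    using lborel_integral_real_affine[of 1 "\<lambda>m. cmod (f m * e m)" "- m1"] by simp
  have "(\<integral>m. f m * e m \<partial>lborel) * (\<integral>m. g m * e m \<partial>lborel)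
      = (\<integral>m1. (\<integral>m. (f (m - m1) * e (m - m1)) * (g m1 * e m1) \<partial>lborel) \<partial>lborel)"
    using sF by simp
  also have "\<dots> = (\<integral>m. (\<integral>m1. (f (m - m1) * e (m - m1)) * (g m1 * e m1) \<partial>lborel) \<partial>lborel)"
  proof (rule Fubini_swap_lborel)
    show "(\<lambda>(m1, m). (f (m - m1) * e (m - m1)) * (g m1 * e m1)) \<in> borel_measurable (borel \<Otimes>\<^sub>M borel)" by measurable
    show "integrable lborel (\<lambda>m. (f (m - m1) * e (m - m1)) * (g m1 * e m1))" for m1 using iFs by simp
    show "integrable lborel (\<lambda>m1. (\<integral>m. cmod (f m * e m) \<partial>lborel) * cmod (g m1 * e m1))"
      by (intro integrable_mult_right integrable_norm iG)
    show "(\<integral>m. cmod ((f (m - m1) * e (m - m1)) * (g m1 * e m1)) \<partial>lborel) \<le> (\<integral>m. cmod (f m * e m) \<partial>lborel) * cmod (g m1 * e m1)" for m1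
      using sFn[of m1] by (simp add: norm_mult)
  qed
  also have "(\<lambda>m. \<integral>m1. (f (m - m1) * e (m - m1)) * (g m1 * e m1) \<partial>lborel) = (\<lambda>m. (\<integral>m1. f (m - m1) * g m1 \<partial>lborel) * e m)"
  proof
    fix m
    have "(\<lambda>m1. (f (m - m1) * e (m - m1)) * (g m1 * e m1)) = (\<lambda>m1. f (m - m1) * g m1 * e m)"
      using e_add[of "m - _" _] by (intro ext) (metis (no_types, opaque_lifting) diff_add_cancel mult.assoc mult.left_commute)
    then show "(\<integral>m1. (f (m - m1) * e (m - m1)) * (g m1 * e m1) \<partial>lborel) = (\<integral>m1. f (m - m1) * g m1 \<partial>lborel) * e m" by simp
  qed
  finally have *: "(\<integral>m. f m * e m \<partial>lborel) * (\<integral>m. g m * e m \<partial>lborel) = (\<integral>m. (\<integral>m1. f (m - m1) * g m1 \<partial>lborel) * e m \<partial>lborel)" .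
  show ?thesis unfolding inv_fourier_def e_def[symmetric] times_divide_times_eq *
    by simp
qed

section \<open>A linear convolution equation with a small kernel\<close>

definition fourier_weight :: "real \<Rightarrow> real \<Rightarrow> real \<Rightarrow> real" where
  "fourier_weight \<beta> \<mu> m = (1 + \<bar>m\<bar>) powr (- \<mu>) * exp (- \<beta> * \<bar>m\<bar>)"

lemma fourier_weight_nonneg: "fourier_weight \<beta> \<mu> m \<ge> 0"
  by (simp add: fourier_weight_def)

text \<open>The larger of \<open>u\<close> and \<open>v\<close> is at least \<open>w / 2\<close>; the power of the smaller one stays.\<close>

lemma powr_decay_product:
  fixes u v w :: real
  assumes "u \<ge> 1" "v \<ge> 1" "w \<ge> 1" "w \<le> u + v" "a \<ge> 0"
  shows "u powr (- a) * v powr (- a) \<le> 2 powr a * w powr (- a) * (u powr (- a) + v powr (- a))"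
proof -
  have *: "u powr (- a) * v powr (- a) \<le> 2 powr a * w powr (- a) * (u powr (- a) + v powr (- a))"
    if "v \<le> u" "u \<ge> 1" "v \<ge> 1" "w \<le> u + v" for u v
  proof -
    have "u powr (- a) \<le> (w / 2) powr (- a)"
      using that assms by (intro powr_mono2') auto
    also have "\<dots> = 2 powr a * w powr (- a)"
      using assms by (simp add: powr_divide powr_minus field_simps)
    finally have "u powr (- a) * v powr (- a) \<le> 2 powr a * w powr (- a) * v powr (- a)"
      by (intro mult_right_mono) auto
    also have "\<dots> \<le> 2 powr a * w powr (- a) * (u powr (- a) + v powr (- a))"
      by (intro mult_left_mono) auto
    finally show ?thesis .
  qed
  show ?thesis
    using *[of v u] *[of u v] assms by (cases "v \<le> u") (auto simp: add.commute mult.commute)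
qed

text \<open>A polynomial factor of degree \<open>\<gamma>\<close> on one side of the convolution reappears outside, and what
  remains is integrable in \<open>x\<close> uniformly in \<open>m\<close> as soon as \<open>\<mu> - \<gamma> > 1\<close>.\<close>

lemma fourier_weight_convolution:
  assumes \<beta>: "\<beta> \<ge> 0" and \<gamma>: "\<gamma> \<ge> 0" "\<mu> - \<gamma> \<ge> 0"
  shows "fourier_weight \<beta> \<mu> (m - x) * ((1 + \<bar>x\<bar>) powr \<gamma> * fourier_weight \<beta> \<mu> x)
     \<le> 2 powr (\<mu> - \<gamma>) * ((1 + \<bar>m\<bar>) powr \<gamma> * fourier_weight \<beta> \<mu> m)
         * ((1 + \<bar>m - x\<bar>) powr (- (\<mu> - \<gamma>)) + (1 + \<bar>x\<bar>) powr (- (\<mu> - \<gamma>)))"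
proof -
  define a where "a = \<mu> - \<gamma>"
  have pw: "(1 + \<bar>x\<bar>) powr \<gamma> * fourier_weight \<beta> \<mu> x = (1 + \<bar>x\<bar>) powr (- a) * exp (- \<beta> * \<bar>x\<bar>)" for x
    unfolding fourier_weight_def a_def by (simp add: mult.assoc[symmetric] powr_add[symmetric])
  have tri: "\<bar>m\<bar> \<le> \<bar>m - x\<bar> + \<bar>x\<bar>" by linarith
  have e: "exp (- \<beta> * \<bar>m - x\<bar>) * exp (- \<beta> * \<bar>x\<bar>) \<le> exp (- \<beta> * \<bar>m\<bar>)"
    using mult_left_mono[OF tri \<beta>] by (simp add: exp_add[symmetric] algebra_simps)
  have "fourier_weight \<beta> \<mu> (m - x) \<le> (1 + \<bar>m - x\<bar>) powr (- a) * exp (- \<beta> * \<bar>m - x\<bar>)"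
    unfolding fourier_weight_def a_def using \<gamma> by (intro mult_right_mono powr_mono) auto
  then have "fourier_weight \<beta> \<mu> (m - x) * ((1 + \<bar>x\<bar>) powr \<gamma> * fourier_weight \<beta> \<mu> x)
     \<le> (1 + \<bar>m - x\<bar>) powr (- a) * exp (- \<beta> * \<bar>m - x\<bar>) * ((1 + \<bar>x\<bar>) powr (- a) * exp (- \<beta> * \<bar>x\<bar>))"
    unfolding pw by (intro mult_right_mono) auto
  also have "\<dots> = ((1 + \<bar>m - x\<bar>) powr (- a) * (1 + \<bar>x\<bar>) powr (- a)) * (exp (- \<beta> * \<bar>m - x\<bar>) * exp (- \<beta> * \<bar>x\<bar>))"
    by (simp only: mult_ac)
  also have "\<dots> \<le> (2 powr a * (1 + \<bar>m\<bar>) powr (- a) * ((1 + \<bar>m - x\<bar>) powr (- a) + (1 + \<bar>x\<bar>) powr (- a))) * exp (- \<beta> * \<bar>m\<bar>)"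
    using tri \<gamma> e by (intro mult_mono powr_decay_product) (auto simp: a_def)
  also have "\<dots> = 2 powr a * ((1 + \<bar>m\<bar>) powr (- a) * exp (- \<beta> * \<bar>m\<bar>)) * ((1 + \<bar>m - x\<bar>) powr (- a) + (1 + \<bar>x\<bar>) powr (- a))"
    by (simp only: mult_ac)
  finally show ?thesis unfolding pw[of m, unfolded a_def] a_def .
qed

lemma borel_measurable_pair_compose:
  assumes "(\<lambda>(r, m). w r m) \<in> borel_measurable (borel \<Otimes>\<^sub>M borel)" "f \<in> borel_measurable N" "g \<in> borel_measurable N"
  shows "(\<lambda>p. w (f p) (g p)) \<in> borel_measurable N"
  using measurable_compose[OF measurable_Pair[OF assms(2,3)] assms(1)] by simp

text \<open>The class in which the equation on the ray is solved: \<open>r\<close> is the radial coordinate, \<open>m\<close> the Fourier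
  variable, \<open>\<epsilon>\<close> the parameter. Joint measurability in \<open>(r, m)\<close> is what Fubini's theorem needs, and it
  survives parameter integrals and limits without further argument.\<close>

definition dominated_family ::
    "complex set \<Rightarrow> (real \<Rightarrow> real) \<Rightarrow> (real \<Rightarrow> real) \<Rightarrow> real \<Rightarrow> (real \<Rightarrow> real \<Rightarrow> complex \<Rightarrow> complex) \<Rightarrow> bool" where
  "dominated_family B W V K w \<longleftrightarrow>
     (\<forall>\<epsilon>\<in>B. (\<lambda>(r, m). w r m \<epsilon>) \<in> borel_measurable (borel \<Otimes>\<^sub>M borel)) \<and>
     (\<forall>r m. (\<lambda>\<epsilon>. w r m \<epsilon>) holomorphic_on B) \<and>
     (\<forall>r m. \<forall>\<epsilon>\<in>B. cmod (w r m \<epsilon>) \<le> K * (W r * V m))"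

lemma dominated_familyD:
  assumes "dominated_family B W V K w"
  shows "\<epsilon> \<in> B \<Longrightarrow> (\<lambda>(r, m). w r m \<epsilon>) \<in> borel_measurable (borel \<Otimes>\<^sub>M borel)"
    and "(\<lambda>\<epsilon>. w r m \<epsilon>) holomorphic_on B"
    and "\<epsilon> \<in> B \<Longrightarrow> cmod (w r m \<epsilon>) \<le> K * (W r * V m)"
  using assms unfolding dominated_family_def by auto

text \<open>The coefficients \<open>b j\<close> compensate both the passage of the weight from \<open>r\<close> to \<open>s j * r\<close> and the
  polynomial growth \<open>\<rho> j\<close> in the Fourier variable; \<open>\<zeta>\<close> is the size of the convolution kernels. The last
  assumption bounds the norm of the resulting operator by \<open>1/2\<close>.\<close>

locale weighted_convolution =
  fixes B :: "complex set" and W :: "real \<Rightarrow> real" and \<beta> \<mu> \<gamma> M \<zeta> :: real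
    and J :: "'j set" and b :: "'j \<Rightarrow> real \<Rightarrow> real \<Rightarrow> complex \<Rightarrow> complex"
    and C :: "'j \<Rightarrow> real \<Rightarrow> complex \<Rightarrow> complex" and \<rho> :: "'j \<Rightarrow> real \<Rightarrow> complex" and s :: "'j \<Rightarrow> real"
  assumes B: "open B" and J: "finite J" and \<beta>: "\<beta> \<ge> 0" and \<gamma>: "\<gamma> \<ge> 0" "\<mu> - \<gamma> > 1"
    and W: "\<And>r. W r \<ge> 0" and M: "M \<ge> 0" "\<zeta> \<ge> 0"
    and b_meas: "\<And>j \<epsilon>. j \<in> J \<Longrightarrow> \<epsilon> \<in> B \<Longrightarrow> (\<lambda>(r, m). b j r m \<epsilon>) \<in> borel_measurable (borel \<Otimes>\<^sub>M borel)"
    and b_hol: "\<And>j r m. j \<in> J \<Longrightarrow> (\<lambda>\<epsilon>. b j r m \<epsilon>) holomorphic_on B"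
    and b_bound: "\<And>j r m \<epsilon>. j \<in> J \<Longrightarrow> \<epsilon> \<in> B \<Longrightarrow> cmod (b j r m \<epsilon>) * W (s j * r) \<le> M * W r * (1 + \<bar>m\<bar>) powr (- \<gamma>)"
    and C_meas: "\<And>j \<epsilon>. j \<in> J \<Longrightarrow> \<epsilon> \<in> B \<Longrightarrow> (\<lambda>m. C j m \<epsilon>) \<in> borel_measurable borel"
    and C_hol: "\<And>j m. j \<in> J \<Longrightarrow> (\<lambda>\<epsilon>. C j m \<epsilon>) holomorphic_on B"
    and C_bound: "\<And>j m \<epsilon>. j \<in> J \<Longrightarrow> \<epsilon> \<in> B \<Longrightarrow> cmod (C j m \<epsilon>) \<le> \<zeta> * fourier_weight \<beta> \<mu> m"
    and \<rho>_meas: "\<And>j. j \<in> J \<Longrightarrow> \<rho> j \<in> borel_measurable borel"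
    and \<rho>_bound: "\<And>j m. j \<in> J \<Longrightarrow> cmod (\<rho> j m) \<le> M * (1 + \<bar>m\<bar>) powr \<gamma>"
    and small: "\<zeta> * (M * M * (2 powr (\<mu> - \<gamma>) * (2 * (\<integral>x. (1 + \<bar>x\<bar>) powr (- (\<mu> - \<gamma>)) \<partial>lborel)))) * card J \<le> 1 / 2"
begin

abbreviation "V \<equiv> fourier_weight \<beta> \<mu>"
abbreviation "family \<equiv> dominated_family B W V"

definition decay_mass :: real where "decay_mass = (\<integral>x. (1 + \<bar>x\<bar>) powr (- (\<mu> - \<gamma>)) \<partial>lborel)"

definition conv :: "'j \<Rightarrow> (real \<Rightarrow> real \<Rightarrow> complex \<Rightarrow> complex) \<Rightarrow> real \<Rightarrow> real \<Rightarrow> complex \<Rightarrow> complex" where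
  "conv j w r m \<epsilon> = (\<integral>x. C j (m - x) \<epsilon> * \<rho> j x * w (s j * r) x \<epsilon> \<partial>lborel)"

definition conv_op :: "(real \<Rightarrow> real \<Rightarrow> complex \<Rightarrow> complex) \<Rightarrow> real \<Rightarrow> real \<Rightarrow> complex \<Rightarrow> complex" where
  "conv_op w r m \<epsilon> = (\<Sum>j\<in>J. b j r m \<epsilon> * conv j w r m \<epsilon>)"

definition conv_majorant :: "real \<Rightarrow> real \<Rightarrow> real" where
  "conv_majorant m x = 2 powr (\<mu> - \<gamma>) * ((1 + \<bar>m\<bar>) powr \<gamma> * V m)
     * ((1 + \<bar>m - x\<bar>) powr (- (\<mu> - \<gamma>)) + (1 + \<bar>x\<bar>) powr (- (\<mu> - \<gamma>)))"

lemma conv_majorant: "integrable lborel (conv_majorant m)" "integral\<^sup>L lborel (conv_majorant m) = 2 powr (\<mu> - \<gamma>) * ((1 + \<bar>m\<bar>) powr \<gamma> * V m) * (2 * decay_mass)"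
proof -
  have i: "integrable lborel (\<lambda>x::real. (1 + \<bar>x\<bar>) powr (- (\<mu> - \<gamma>)))" by (rule integrable_powr_decay[OF \<gamma>(2)])
  have i2: "integrable lborel (\<lambda>x::real. (1 + \<bar>m - x\<bar>) powr (- (\<mu> - \<gamma>)))"
    using lborel_integrable_real_affine[OF i, of "-1" m] by simp
  have e2: "(\<integral>x. (1 + \<bar>m - x\<bar>) powr (- (\<mu> - \<gamma>)) \<partial>lborel) = decay_mass"
    unfolding decay_mass_def using lborel_integral_real_affine[of "-1" "\<lambda>x. (1 + \<bar>x\<bar>) powr (- (\<mu> - \<gamma>))" m] by simp
  show "integrable lborel (conv_majorant m)" unfolding conv_majorant_def[abs_def]
    by (intro integrable_mult_right Bochner_Integration.integrable_add i i2)
  show "integral\<^sup>L lborel (conv_majorant m) = 2 powr (\<mu> - \<gamma>) * ((1 + \<bar>m\<bar>) powr \<gamma> * V m) * (2 * decay_mass)"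
    unfolding conv_majorant_def[abs_def] integral_mult_right_zero
    by (subst Bochner_Integration.integral_add[OF i2 i]) (simp only: e2 decay_mass_def[symmetric], simp)
qed

text \<open>The majorant is a product of a function of \<open>r\<close> and one of \<open>x\<close>, as Fubini's theorem will require.\<close>

lemma integrand_bound:
  assumes "family K w" "K \<ge> 0" "j \<in> J" "\<epsilon> \<in> B"
  shows "cmod (C j (m - x) \<epsilon> * \<rho> j x * w (s j * r) x \<epsilon>) \<le> \<zeta> * M * K * W (s j * r) * conv_majorant m x"
proof -
  have "cmod (C j (m - x) \<epsilon> * \<rho> j x * w (s j * r) x \<epsilon>)
      \<le> (\<zeta> * V (m - x)) * (M * (1 + \<bar>x\<bar>) powr \<gamma>) * (K * (W (s j * r) * V x))"
    unfolding norm_mult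
    by (intro mult_mono C_bound \<rho>_bound dominated_familyD(3)[OF assms(1)] assms)
      (auto intro!: mult_nonneg_nonneg M fourier_weight_nonneg)
  also have "\<dots> = \<zeta> * M * K * W (s j * r) * (V (m - x) * ((1 + \<bar>x\<bar>) powr \<gamma> * V x))"
    by (simp only: mult_ac)
  also have "\<dots> \<le> \<zeta> * M * K * W (s j * r) * conv_majorant m x"
    unfolding conv_majorant_def using \<gamma> by (intro mult_left_mono fourier_weight_convolution \<beta> mult_nonneg_nonneg M W assms) auto
  finally show ?thesis .
qed

lemma integrand_measurable:
  assumes "family K w" "j \<in> J" "\<epsilon> \<in> B"
  shows "(\<lambda>(p, x). C j (snd p - x) \<epsilon> * \<rho> j x * w (s j * fst p) x \<epsilon>) \<in> borel_measurable ((borel \<Otimes>\<^sub>M borel) \<Otimes>\<^sub>M lborel)"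
proof -
  note [measurable] = C_meas[OF assms(2,3)] \<rho>_meas[OF assms(2)]
  have "(\<lambda>q. w (s j * fst (fst q)) (snd q) \<epsilon>) \<in> borel_measurable ((borel \<Otimes>\<^sub>M borel) \<Otimes>\<^sub>M lborel)"
    by (rule borel_measurable_pair_compose[OF dominated_familyD(1)[OF assms(1,3)]]) measurable
  then show ?thesis unfolding case_prod_unfold by measurable
qed

lemma integrand_integrable:
  assumes "family K w" "K \<ge> 0" "j \<in> J" "\<epsilon> \<in> B"
  shows "integrable lborel (\<lambda>x. C j (m - x) \<epsilon> * \<rho> j x * w (s j * r) x \<epsilon>)"
proof (rule Bochner_Integration.integrable_bound)
  show "integrable lborel (\<lambda>x. \<zeta> * M * K * W (s j * r) * conv_majorant m x)" by (intro integrable_mult_right conv_majorant)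
  show "(\<lambda>x. C j (m - x) \<epsilon> * \<rho> j x * w (s j * r) x \<epsilon>) \<in> borel_measurable lborel"
    using measurable_compose[OF measurable_Pair1' integrand_measurable[OF assms(1,3,4)], of "(r, m)"] by (simp add: space_pair_measure)
  show "AE x in lborel. cmod (C j (m - x) \<epsilon> * \<rho> j x * w (s j * r) x \<epsilon>) \<le> norm (\<zeta> * M * K * W (s j * r) * conv_majorant m x)"
    unfolding real_norm_def by (intro AE_I2 order_trans[OF integrand_bound[OF assms] abs_ge_self])
qed

text \<open>The factor \<open>(1 + |m|)\<^sup>\<gamma>\<close> that the convolution leaves behind and the passage of the weight to
  \<open>s j * r\<close> are both compensated by the coefficient \<open>b j\<close>.\<close>

lemma conv_op_family:
  assumes w: "family K w" "K \<ge> 0"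
  shows "family (K / 2) (conv_op w)"
  unfolding dominated_family_def
proof (intro conjI allI ballI)
  fix \<epsilon> assume \<epsilon>: "\<epsilon> \<in> B"
  have "(\<lambda>p. conv j w (fst p) (snd p) \<epsilon>) \<in> borel_measurable (borel \<Otimes>\<^sub>M borel)" if j: "j \<in> J" for j
    unfolding conv_def by (rule lborel.borel_measurable_lebesgue_integral) (use integrand_measurable[OF w(1) j \<epsilon>] in \<open>simp add: case_prod_unfold\<close>)
  then show "(\<lambda>(r, m). conv_op w r m \<epsilon>) \<in> borel_measurable (borel \<Otimes>\<^sub>M borel)"
    unfolding conv_op_def case_prod_unfold
    by (intro borel_measurable_sum borel_measurable_times) (use b_meas \<epsilon> in \<open>auto simp: case_prod_unfold\<close>)
next
  fix r m
  have "(\<lambda>\<epsilon>. conv j w r m \<epsilon>) holomorphic_on B" if j: "j \<in> J" for j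
    unfolding conv_def
  proof (rule holomorphic_lebesgue_integral[OF B])
    fix \<epsilon> assume \<epsilon>: "\<epsilon> \<in> B"
    show "(\<lambda>x. C j (m - x) \<epsilon> * \<rho> j x * w (s j * r) x \<epsilon>) \<in> borel_measurable lborel"
      using integrand_integrable[OF w j \<epsilon>] by (rule borel_measurable_integrable)
    obtain d where "d > 0" "ball \<epsilon> d \<subseteq> B" using B \<epsilon> open_contains_ball by metis
    then show "\<exists>d g. 0 < d \<and> ball \<epsilon> d \<subseteq> B \<and> integrable lborel g \<and>
        (\<forall>e\<in>ball \<epsilon> d. \<forall>x. cmod (C j (m - x) e * \<rho> j x * w (s j * r) x e) \<le> g x)"
      using integrand_bound[OF w j]
      by (intro exI[of _ d] exI[of _ "\<lambda>x. \<zeta> * M * K * W (s j * r) * conv_majorant m x"]) (auto intro!: integrable_mult_right conv_majorant)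
  next
    show "(\<lambda>\<epsilon>. C j (m - x) \<epsilon> * \<rho> j x * w (s j * r) x \<epsilon>) holomorphic_on B" for x
      by (intro holomorphic_intros C_hol j dominated_familyD(2)[OF w(1)])
  qed
  then show "(\<lambda>\<epsilon>. conv_op w r m \<epsilon>) holomorphic_on B"
    unfolding conv_op_def by (intro holomorphic_intros b_hol) auto
  fix \<epsilon> assume \<epsilon>: "\<epsilon> \<in> B"
  have H0: "decay_mass \<ge> 0" unfolding decay_mass_def by (rule Bochner_Integration.integral_nonneg) simp
  define c where "c = \<zeta> * (M * M * (2 powr (\<mu> - \<gamma>) * (2 * decay_mass)))"
  have "cmod (b j r m \<epsilon> * conv j w r m \<epsilon>) \<le> c * (K * (W r * V m))" if j: "j \<in> J" for j
  proof -
    have "cmod (conv j w r m \<epsilon>) \<le> (\<integral>x. \<zeta> * M * K * W (s j * r) * conv_majorant m x \<partial>lborel)"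
      unfolding conv_def
      by (rule order_trans[OF integral_norm_bound])
        (rule integral_mono[OF integrable_norm[OF integrand_integrable[OF w j \<epsilon>]] integrable_mult_right[OF conv_majorant(1)] integrand_bound[OF w j \<epsilon>]])
    also have "\<dots> = W (s j * r) * (\<zeta> * M * K * (2 powr (\<mu> - \<gamma>) * ((1 + \<bar>m\<bar>) powr \<gamma> * V m) * (2 * decay_mass)))"
      unfolding integral_mult_right_zero conv_majorant by (simp only: mult_ac)
    finally have "cmod (b j r m \<epsilon> * conv j w r m \<epsilon>)
        \<le> cmod (b j r m \<epsilon>) * (W (s j * r) * (\<zeta> * M * K * (2 powr (\<mu> - \<gamma>) * ((1 + \<bar>m\<bar>) powr \<gamma> * V m) * (2 * decay_mass))))"
      unfolding norm_mult by (intro mult_left_mono) auto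
    also have "\<dots> = (cmod (b j r m \<epsilon>) * W (s j * r)) * (\<zeta> * M * K * (2 powr (\<mu> - \<gamma>) * ((1 + \<bar>m\<bar>) powr \<gamma> * V m) * (2 * decay_mass)))"
      by (simp only: mult_ac)
    also have "\<dots> \<le> (M * W r * (1 + \<bar>m\<bar>) powr (- \<gamma>)) * (\<zeta> * M * K * (2 powr (\<mu> - \<gamma>) * ((1 + \<bar>m\<bar>) powr \<gamma> * V m) * (2 * decay_mass)))"
      by (intro mult_right_mono b_bound j \<epsilon> mult_nonneg_nonneg M w H0 fourier_weight_nonneg) auto
    also have "\<dots> = ((1 + \<bar>m\<bar>) powr (- \<gamma>) * (1 + \<bar>m\<bar>) powr \<gamma>) * (c * (K * (W r * V m)))"
      unfolding c_def by (simp only: mult_ac)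
    also have "(1 + \<bar>m\<bar>) powr (- \<gamma>) * (1 + \<bar>m\<bar>) powr \<gamma> = 1" by (simp add: powr_add[symmetric])
    finally show ?thesis by simp
  qed
  then have "cmod (conv_op w r m \<epsilon>) \<le> (\<Sum>j\<in>J. c * (K * (W r * V m)))"
    unfolding conv_op_def by (intro sum_norm_le) auto
  also have "\<dots> = (c * card J) * (K * (W r * V m))" by simp
  also have "\<dots> \<le> 1 / 2 * (K * (W r * V m))"
    using small unfolding c_def decay_mass_def by (intro mult_right_mono mult_nonneg_nonneg w W fourier_weight_nonneg)
  finally show "cmod (conv_op w r m \<epsilon>) \<le> K / 2 * (W r * V m)" by simp
qed

lemma conv_op_add:
  assumes "family K u" "K \<ge> 0" "family K' v" "K' \<ge> 0" "\<epsilon> \<in> B"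
  shows "conv_op (\<lambda>r m \<epsilon>. u r m \<epsilon> + v r m \<epsilon>) r m \<epsilon> = conv_op u r m \<epsilon> + conv_op v r m \<epsilon>"
proof -
  have "conv j (\<lambda>r m \<epsilon>. u r m \<epsilon> + v r m \<epsilon>) r m \<epsilon> = conv j u r m \<epsilon> + conv j v r m \<epsilon>" if "j \<in> J" for j
    unfolding conv_def distrib_left
    by (rule Bochner_Integration.integral_add[OF integrand_integrable[OF assms(1,2) that assms(5)] integrand_integrable[OF assms(3,4) that assms(5)]])
  then show ?thesis unfolding conv_op_def by (simp add: distrib_left sum.distrib)
qed

lemma conv_op_zero: "conv_op (\<lambda>r m \<epsilon>. 0) r m \<epsilon> = 0"
  by (simp add: conv_op_def conv_def)

text \<open>The Neumann series converges geometrically at each point, uniformly in \<open>\<epsilon>\<close>. Its sum solves the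
  equation because the operator, applied to the remainder, again yields half of a quantity that tends
  to zero.\<close>

lemma solution_exists:
  assumes g: "family K g" "K \<ge> 0"
  shows "\<exists>w. family (2 * K) w \<and> (\<forall>r m. \<forall>\<epsilon>\<in>B. w r m \<epsilon> = g r m \<epsilon> + conv_op w r m \<epsilon>)"
proof -
  define G where "G n = (conv_op ^^ n) g" for n
  have G0: "G 0 = g" and GS: "G (Suc n) = conv_op (G n)" for n by (simp_all add: G_def)
  have GF: "family (K * (1/2) ^ n) (G n)" for n
  proof (induction n)
    case (Suc n)
    show ?case using conv_op_family[OF Suc] g(2) by (simp add: GS)
  qed (use g in \<open>simp add: G0\<close>)
  define S where "S N r m \<epsilon> = (\<Sum>n<N. G n r m \<epsilon>)" for N r m \<epsilon>
  define w where "w r m \<epsilon> = (\<Sum>n. G n r m \<epsilon>)" for r m \<epsilon>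
  have Wn: "0 \<le> W r * V m" for r m by (intro mult_nonneg_nonneg W fourier_weight_nonneg)
  have Gb: "cmod (G n r m \<epsilon>) \<le> K * (W r * V m) * (1/2) ^ n" if "\<epsilon> \<in> B" for n r m \<epsilon>
    using dominated_familyD(3)[OF GF[of n] that, of r m] by (simp add: mult_ac)
  have gs: "(\<lambda>n. K * (W r * V m) * (1/2) ^ (n + N)) sums (2 * K * (1/2)^N * (W r * V m))" for r m N
  proof -
    have "(\<lambda>n. (K * (W r * V m) * (1/2)^N) * (1/2) ^ n) sums ((K * (W r * V m) * (1/2)^N) * (1 / (1 - 1/2)))"
      by (intro sums_mult geometric_sums) simp
    then show ?thesis by (simp add: power_add mult_ac)
  qed
  have Gs: "summable (\<lambda>n. G n r m \<epsilon>)" if "\<epsilon> \<in> B" for r m \<epsilon>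
    by (rule summable_comparison_test[OF _ sums_summable[OF gs[of r m 0]]]) (use Gb[OF that] in auto)
  have rem: "cmod (w r m \<epsilon> - S N r m \<epsilon>) \<le> 2 * K * (1/2)^N * (W r * V m)" if "\<epsilon> \<in> B" for r m \<epsilon> N
  proof -
    have "w r m \<epsilon> - S N r m \<epsilon> = (\<Sum>n. G (n + N) r m \<epsilon>)"
      unfolding w_def S_def using suminf_split_initial_segment[OF Gs[OF that, of r m], of N] by simp
    also have "cmod \<dots> \<le> (\<Sum>n. K * (W r * V m) * (1/2) ^ (n + N))"
      by (rule norm_suminf_le[OF Gb[OF that] sums_summable[OF gs]])
    also have "\<dots> = 2 * K * (1/2)^N * (W r * V m)" by (rule sums_unique[OF gs, symmetric])
    finally show ?thesis .
  qed
  have Sm: "(\<lambda>(r, m). S N r m \<epsilon>) \<in> borel_measurable (borel \<Otimes>\<^sub>M borel)" if "\<epsilon> \<in> B" for N \<epsilon>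
    unfolding S_def case_prod_unfold
    by (intro borel_measurable_sum) (use dominated_familyD(1)[OF GF that] in \<open>simp add: case_prod_unfold\<close>)
  have Sh: "(\<lambda>\<epsilon>. S N r m \<epsilon>) holomorphic_on B" for N r m
    unfolding S_def by (intro holomorphic_intros dominated_familyD(2)[OF GF])
  have lim: "(\<lambda>N. S N r m \<epsilon>) \<longlonglongrightarrow> w r m \<epsilon>" if "\<epsilon> \<in> B" for r m \<epsilon>
    unfolding S_def w_def using summable_LIMSEQ[OF Gs[OF that]] .
  have wF: "family (2 * K) w"
    unfolding dominated_family_def
  proof (intro conjI allI ballI)
    fix \<epsilon> assume \<epsilon>: "\<epsilon> \<in> B"
    show "(\<lambda>(r, m). w r m \<epsilon>) \<in> borel_measurable (borel \<Otimes>\<^sub>M borel)"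
      by (rule borel_measurable_LIMSEQ_metric[OF Sm[OF \<epsilon>]]) (use lim[OF \<epsilon>] in auto)
    show "cmod (w r m \<epsilon>) \<le> 2 * K * (W r * V m)" for r m using rem[OF \<epsilon>, of r m 0] by (simp add: S_def)
  next
    fix r m
    have "uniform_limit B (\<lambda>N \<epsilon>. \<Sum>n<N. G n r m \<epsilon>) (\<lambda>\<epsilon>. \<Sum>n. G n r m \<epsilon>) sequentially"
      by (rule Weierstrass_m_test[of _ _ "\<lambda>n. K * (W r * V m) * (1/2) ^ n"]) (use Gb gs[of r m 0] in \<open>auto simp: sums_iff\<close>)
    then show "(\<lambda>\<epsilon>. w r m \<epsilon>) holomorphic_on B"
      unfolding w_def by (rule holomorphic_uniform_limit_sequence[OF B Sh[unfolded S_def]])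
  qed
  have dF: "family (2 * K * (1/2)^N) (\<lambda>r m \<epsilon>. w r m \<epsilon> - S N r m \<epsilon>)" for N
    unfolding dominated_family_def
  proof (intro conjI allI ballI rem)
    fix \<epsilon> assume \<epsilon>: "\<epsilon> \<in> B"
    show "(\<lambda>(r, m). w r m \<epsilon> - S N r m \<epsilon>) \<in> borel_measurable (borel \<Otimes>\<^sub>M borel)"
      using dominated_familyD(1)[OF wF \<epsilon>] Sm[OF \<epsilon>, of N] unfolding case_prod_unfold by (rule borel_measurable_diff)
  next
    show "(\<lambda>\<epsilon>. w r m \<epsilon> - S N r m \<epsilon>) holomorphic_on B" for r m
      by (intro holomorphic_intros Sh dominated_familyD(2)[OF wF])
  qed
  have SF: "\<exists>K'\<ge>0. family K' (S N)" for N
  proof (intro exI[of _ "4 * K"] conjI)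
    show "family (4 * K) (S N)"
      unfolding dominated_family_def
    proof (intro conjI allI ballI Sm Sh)
      fix \<epsilon> r m assume \<epsilon>: "\<epsilon> \<in> B"
      have "cmod (S N r m \<epsilon>) \<le> cmod (w r m \<epsilon>) + cmod (w r m \<epsilon> - S N r m \<epsilon>)"
        using norm_triangle_ineq4[of "w r m \<epsilon>" "w r m \<epsilon> - S N r m \<epsilon>"] by simp
      also have "\<dots> \<le> 2 * K * (W r * V m) + 2 * K * (1/2)^N * (W r * V m)"
        by (intro add_mono rem[OF \<epsilon>] dominated_familyD(3)[OF wF \<epsilon>])
      also have "\<dots> \<le> 2 * K * (W r * V m) + 2 * K * 1 * (W r * V m)"
        using g(2) Wn by (intro add_left_mono mult_right_mono mult_left_mono power_le_one) auto
      finally show "cmod (S N r m \<epsilon>) \<le> 4 * K * (W r * V m)" by simp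
    qed
  qed (use g in simp)
  have TS: "conv_op (S N) r m \<epsilon> = (\<Sum>n<N. G (Suc n) r m \<epsilon>)" if \<epsilon>: "\<epsilon> \<in> B" for N r m \<epsilon>
  proof (induction N)
    case 0
    show ?case using conv_op_zero by (simp add: S_def[abs_def])
  next
    case (Suc N)
    obtain K' where K': "K' \<ge> 0" "family K' (S N)" using SF by blast
    have "S (Suc N) = (\<lambda>r m \<epsilon>. S N r m \<epsilon> + G N r m \<epsilon>)" by (simp add: S_def[abs_def])
    then have "conv_op (S (Suc N)) r m \<epsilon> = conv_op (S N) r m \<epsilon> + conv_op (G N) r m \<epsilon>"
      using conv_op_add[OF K'(2,1) GF _ \<epsilon>] g(2) by simp
    then show ?case using Suc by (simp add: GS)
  qed
  have "w r m \<epsilon> = g r m \<epsilon> + conv_op w r m \<epsilon>" if \<epsilon>: "\<epsilon> \<in> B" for r m \<epsilon>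
  proof -
    have b: "cmod (conv_op w r m \<epsilon> - (\<Sum>n<N. G (Suc n) r m \<epsilon>)) \<le> K * (W r * V m) * (1/2)^N" for N
    proof -
      obtain K' where K': "K' \<ge> 0" "family K' (S N)" using SF by blast
      have "conv_op (\<lambda>r m \<epsilon>. S N r m \<epsilon> + (w r m \<epsilon> - S N r m \<epsilon>)) r m \<epsilon> = conv_op (S N) r m \<epsilon> + conv_op (\<lambda>r m \<epsilon>. w r m \<epsilon> - S N r m \<epsilon>) r m \<epsilon>"
        by (rule conv_op_add[OF K'(2,1) dF _ \<epsilon>]) (use g in simp)
      then have "conv_op w r m \<epsilon> - (\<Sum>n<N. G (Suc n) r m \<epsilon>) = conv_op (\<lambda>r m \<epsilon>. w r m \<epsilon> - S N r m \<epsilon>) r m \<epsilon>"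
        by (simp add: TS[OF \<epsilon>])
      also have "cmod \<dots> \<le> 2 * K * (1/2)^N / 2 * (W r * V m)"
        by (rule dominated_familyD(3)[OF conv_op_family[OF dF] \<epsilon>]) (use g in simp)
      finally show ?thesis by (simp add: mult_ac)
    qed
    have "(\<lambda>N. K * (W r * V m) * (1/2)^N) \<longlonglongrightarrow> K * (W r * V m) * 0"
      by (intro tendsto_intros LIMSEQ_realpow_zero) auto
    then have z: "(\<lambda>N. K * (W r * V m) * (1/2)^N) \<longlonglongrightarrow> 0" by simp
    have "(\<lambda>N. conv_op w r m \<epsilon> - (\<Sum>n<N. G (Suc n) r m \<epsilon>)) \<longlonglongrightarrow> 0"
      by (rule Lim_null_comparison[OF _ z]) (use b in auto)
    moreover have "(\<lambda>N. conv_op w r m \<epsilon> - (\<Sum>n<N. G (Suc n) r m \<epsilon>)) \<longlonglongrightarrow> conv_op w r m \<epsilon> - (w r m \<epsilon> - g r m \<epsilon>)"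
    proof (intro tendsto_intros)
      have "(\<lambda>n. G (Suc n) r m \<epsilon>) sums (w r m \<epsilon> - g r m \<epsilon>)"
        using summable_sums[OF Gs[OF \<epsilon>, of r m]] by (subst sums_Suc_iff) (simp add: w_def G0)
      then show "(\<lambda>N. \<Sum>n<N. G (Suc n) r m \<epsilon>) \<longlonglongrightarrow> w r m \<epsilon> - g r m \<epsilon>" by (simp add: sums_def)
    qed
    ultimately have "conv_op w r m \<epsilon> - (w r m \<epsilon> - g r m \<epsilon>) = 0" by (rule LIMSEQ_unique[symmetric])
    then show ?thesis by (simp add: algebra_simps)
  qed
  then show ?thesis using wF by blast
qed

end

section \<open>The q-Laplace kernel and the weight on a ray\<close>

lemma q_base:
  fixes q k :: real
  assumes "q > 1" "k > 0"
  shows "0 < q powr (- 1 / k)" "q powr (- 1 / k) < 1" "ln (q powr (- 1 / k)) = - (ln q / k)"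
proof -
  have "q powr (- 1 / k) < q powr 0" using assms by (subst powr_less_cancel_iff) auto
  then show "q powr (- 1 / k) < 1" using assms by simp
qed (use assms in \<open>simp_all add: ln_powr\<close>)

lemma jacobi_theta_holomorphic:
  assumes "q > 1" "k > 0"
  shows "jacobi_theta q k holomorphic_on (- {0})"
  unfolding jacobi_theta_eq_theta[OF assms] by (rule theta_holomorphic[OF q_base(1,2)[OF assms]])

lemma jacobi_theta_lower_bound:
  assumes q: "q > 1" "k > 0" and \<delta>: "\<delta> > 0"
  shows "\<exists>c>0. \<forall>x. x \<noteq> 0 \<longrightarrow> (\<forall>r\<ge>0. \<delta> \<le> cmod (1 + of_real r * x)) \<longrightarrow>
     c * exp (k * (ln (cmod x))\<^sup>2 / (2 * ln q) + ln (cmod x) / 2) \<le> cmod (jacobi_theta q k x)"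
proof -
  have "theta_growth (q powr (- 1 / k)) y = exp (k * (ln y)\<^sup>2 / (2 * ln q) + ln y / 2)" for y
    unfolding theta_growth_def q_base(3)[OF q] using q by (simp add: field_simps)
  then show ?thesis
    unfolding jacobi_theta_eq_theta[OF q] using theta_lower_bound[OF q_base(1,2)[OF q] \<delta>] by simp
qed

text \<open>The definition of \<open>R_dom\<close> is invariant under scaling of the point on the ray, so it confines
  \<open>\<tau>/T\<close> to a cone on which theta is bounded below.\<close>

lemma R_dom_cone:
  assumes "T \<in> R_dom d \<delta>" "v > 0"
  shows "\<forall>r\<ge>0. \<delta> \<le> cmod (1 + of_real r * (of_real v * cis d / T))"
proof (intro allI impI)
  fix r :: real assume "r \<ge> 0"
  then have "r * v \<ge> 0" using assms by simp
  then have "cmod (1 + cis d * of_real (r * v) / T) > \<delta>" using assms(1) unfolding R_dom_def by blast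
  then show "\<delta> \<le> cmod (1 + of_real r * (of_real v * cis d / T))" by (simp add: mult_ac)
qed

text \<open>Vanishing for \<open>r \<le> 0\<close>, so that the q-Laplace transform is an integral over the whole line.\<close>

definition laplace_kernel :: "real \<Rightarrow> real \<Rightarrow> real \<Rightarrow> complex \<Rightarrow> real \<Rightarrow> complex" where
  "laplace_kernel q k d T r =
     (if 0 < r then 1 / (jacobi_theta q k (of_real r * cis d / T) * of_real r) / of_real (pi_q q k) else 0)"

lemma q_laplace_eq_kernel:
  "q_laplace q k d f T = (\<integral>r. f (of_real r * cis d) * laplace_kernel q k d T r \<partial>lborel)"
proof -
  have "(\<integral>r. f (of_real r * cis d) * laplace_kernel q k d T r \<partial>lborel)
     = (\<integral>r. (indicator {0<..} r *\<^sub>R (f (of_real r * cis d) / jacobi_theta q k (of_real r * cis d / T) / of_real r)) / of_real (pi_q q k) \<partial>lborel)"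
    by (intro Bochner_Integration.integral_cong refl) (auto simp: laplace_kernel_def split: split_indicator)
  then show ?thesis unfolding q_laplace_def set_lebesgue_integral_def by simp
qed

lemma borel_measurable_ray:
  assumes "continuous_on {0<..} (g :: real \<Rightarrow> complex)"
  shows "(\<lambda>r. if 0 < r then g r else 0) \<in> borel_measurable borel"
proof -
  have "(\<lambda>r. indicator {0<..} r *\<^sub>R g r) \<in> borel_measurable borel"
    by (rule borel_measurable_continuous_on_indicator[OF _ assms]) simp
  also have "(\<lambda>r. indicator {0<..} r *\<^sub>R g r) = (\<lambda>r. if 0 < r then g r else 0)" by (auto split: split_indicator)
  finally show ?thesis .
qed

lemma laplace_kernel_measurable:
  assumes q: "q > 1" "k > 0" and T: "T \<noteq> 0"
  shows "laplace_kernel q k d T \<in> borel_measurable borel"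
proof -
  have "continuous_on {0<..} (\<lambda>r. jacobi_theta q k (of_real r * cis d / T))"
    by (rule continuous_on_compose2[OF holomorphic_on_imp_continuous_on[OF jacobi_theta_holomorphic[OF q]]])
      (use T in \<open>auto intro!: continuous_intros\<close>)
  from borel_measurable_ray[OF this]
  have m[measurable]: "(\<lambda>r. if 0 < r then jacobi_theta q k (of_real r * cis d / T) else 0) \<in> borel_measurable borel" .
  have "laplace_kernel q k d T = (\<lambda>r. 1 / ((if 0 < r then jacobi_theta q k (of_real r * cis d / T) else 0) * of_real r) / of_real (pi_q q k))"
    by (auto simp: laplace_kernel_def)
  also have "\<dots> \<in> borel_measurable borel" by measurable
  finally show ?thesis .
qed

text \<open>If the point at which the transform is evaluated is scaled by \<open>l\<close> and by the \<open>m\<close>-th power of the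
  quasi-period, the argument of theta moves by that power only, and theta changes by a monomial.\<close>

lemma laplace_kernel_scale:
  assumes q: "q > 1" "k > 0" and l: "l > 0" and T: "T1 \<noteq> 0" "T2 = of_real (l * q powr (real m / k)) * T1"
  shows "of_real l * laplace_kernel q k d T2 (l * v)
     = of_real ((q powr (- 1 / k)) powr (real m * (real m - 1) / 2)) * (of_real v * cis d) ^ m * laplace_kernel q k d T1 v / T1 ^ m"
proof (cases "v > 0")
  case True
  define p where "p = q powr (- 1 / k)"
  have p: "0 < p" "p < 1" using q_base[OF q] by (auto simp: p_def)
  define x where "x = of_real v * cis d / T1"
  have x0: "x \<noteq> 0" using True T by (simp add: x_def)
  have pm: "p ^ m * q powr (real m / k) = 1"
    using q by (simp add: p_def powr_realpow[symmetric] powr_powr powr_add[symmetric])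
  have qm: "q powr (real m / k) \<noteq> 0" using q by simp
  have "of_real (l * v) * cis d / T2 = of_real (1 / q powr (real m / k)) * x"
    unfolding T(2) x_def using l qm by (simp add: field_simps)
  also have "1 / q powr (real m / k) = p ^ m" using pm qm by (simp add: field_simps)
  finally have "jacobi_theta q k (of_real (l * v) * cis d / T2) = theta p x / (x ^ m * of_real (p powr (real m * (real m - 1) / 2)))"
    using theta_shift_power[OF p x0] unfolding jacobi_theta_eq_theta[OF q] p_def[symmetric] by simp
  then have "of_real l * laplace_kernel q k d T2 (l * v)
      = of_real (p powr (real m * (real m - 1) / 2)) * x ^ m / (theta p x * of_real v) / of_real (pi_q q k)"
    using True l by (simp add: laplace_kernel_def mult_ac)
  then show ?thesis
    using True unfolding laplace_kernel_def jacobi_theta_eq_theta[OF q] p_def[symmetric] x_def by (simp add: power_divide)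
next
  case False
  then have "\<not> 0 < l * v" using l by (simp add: zero_less_mult_iff)
  then show ?thesis using False by (simp add: laplace_kernel_def)
qed

text \<open>The commutation rule between powers of \<open>T\<close>, dilations and the q-Laplace transform.\<close>

lemma laplace_integral_scale:
  assumes q: "q > 1" "k > 0" and l: "l > 0" and T: "T1 \<noteq> 0" "T2 = of_real (l * q powr (real m / k)) * T1"
  shows "T1 ^ m * (\<integral>r. f r * laplace_kernel q k d T2 r \<partial>lborel)
     = of_real ((q powr (- 1 / k)) powr (real m * (real m - 1) / 2)) *
       (\<integral>v. (of_real v * cis d) ^ m * f (l * v) * laplace_kernel q k d T1 v \<partial>lborel)"
    and "integrable lborel (\<lambda>r. f r * laplace_kernel q k d T2 r) \<Longrightarrow>
       integrable lborel (\<lambda>v. (of_real v * cis d) ^ m * f (l * v) * laplace_kernel q k d T1 v)"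
proof -
  define c where "c = complex_of_real ((q powr (- 1 / k)) powr (real m * (real m - 1) / 2))"
  have c0: "c \<noteq> 0" using q by (simp add: c_def)
  have *: "of_real l * (f (l * v) * laplace_kernel q k d T2 (l * v)) = (c / T1 ^ m) * ((of_real v * cis d) ^ m * f (l * v) * laplace_kernel q k d T1 v)" for v
  proof -
    have "of_real l * (f (l * v) * laplace_kernel q k d T2 (l * v)) = f (l * v) * (of_real l * laplace_kernel q k d T2 (l * v))"
      by (simp only: mult_ac)
    also have "\<dots> = f (l * v) * (c * (of_real v * cis d) ^ m * laplace_kernel q k d T1 v / T1 ^ m)"
      unfolding laplace_kernel_scale[OF q l T] c_def ..
    finally show ?thesis by (simp add: mult_ac)
  qed
  have "(\<integral>r. f r * laplace_kernel q k d T2 r \<partial>lborel) = (\<integral>v. of_real l * (f (l * v) * laplace_kernel q k d T2 (l * v)) \<partial>lborel)"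
    using lborel_integral_real_affine[of l "\<lambda>r. f r * laplace_kernel q k d T2 r" 0] l by (simp add: scaleR_conv_of_real)
  also have "\<dots> = (c / T1 ^ m) * (\<integral>v. (of_real v * cis d) ^ m * f (l * v) * laplace_kernel q k d T1 v \<partial>lborel)"
    unfolding * by (rule integral_mult_right_zero)
  finally show "T1 ^ m * (\<integral>r. f r * laplace_kernel q k d T2 r \<partial>lborel)
     = of_real ((q powr (- 1 / k)) powr (real m * (real m - 1) / 2)) *
       (\<integral>v. (of_real v * cis d) ^ m * f (l * v) * laplace_kernel q k d T1 v \<partial>lborel)"
    using T by (simp add: c_def)
  assume "integrable lborel (\<lambda>r. f r * laplace_kernel q k d T2 r)"
  then have "integrable lborel (\<lambda>v. of_real l * (f (l * v) * laplace_kernel q k d T2 (l * v)))"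
    using lborel_integrable_real_affine[of "\<lambda>r. f r * laplace_kernel q k d T2 r" l 0] l by simp
  then have "integrable lborel (\<lambda>v. (c / T1 ^ m) * ((of_real v * cis d) ^ m * f (l * v) * laplace_kernel q k d T1 v))"
    unfolding * .
  then have "integrable lborel (\<lambda>v. (T1 ^ m / c) * ((c / T1 ^ m) * ((of_real v * cis d) ^ m * f (l * v) * laplace_kernel q k d T1 v)))"
    by (rule integrable_mult_right)
  then show "integrable lborel (\<lambda>v. (of_real v * cis d) ^ m * f (l * v) * laplace_kernel q k d T1 v)"
    using c0 T by (simp add: mult.assoc)
qed

text \<open>The positive part of the logarithm. The Gaussian weight built with the full logarithm blows up at
  the origin, where the functions considered are bounded.\<close>

definition log_plus :: "real \<Rightarrow> real" where
  "log_plus r = max 0 (ln r)"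

definition ray_weight :: "real \<Rightarrow> real \<Rightarrow> real \<Rightarrow> real \<Rightarrow> real" where
  "ray_weight q k \<nu> r = exp (k * (log_plus r)\<^sup>2 / (2 * ln q) + \<nu> * log_plus r)"

lemma ln_one_plus_le:
  assumes "r > 0"
  shows "log_plus r \<le> ln (1 + r)" "ln (1 + r) \<le> ln 2 + log_plus r"
proof -
  show "log_plus r \<le> ln (1 + r)" using assms by (auto simp: log_plus_def)
  have "ln (1 + r) \<le> ln (2 * max 1 r)" using assms by (subst ln_le_cancel_iff) auto
  also have "\<dots> = ln 2 + ln (max 1 r)" using assms by (subst ln_mult) auto
  also have "ln (max 1 r) = log_plus r" using assms by (auto simp: log_plus_def max_def)
  finally show "ln (1 + r) \<le> ln 2 + log_plus r" .
qed

text \<open>Estimates are made with exponents that are polynomials in \<open>log r\<close>; this converts them into an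
  integrable bound.\<close>

lemma exp_le_powr_decay:
  assumes r: "r > 0" and e: "E \<le> c - a * log_plus r" and a: "a \<ge> 0"
  shows "exp E \<le> exp (c + a * ln 2) * (1 + r) powr (- a)"
proof -
  have "a * ln (1 + r) \<le> a * (ln 2 + log_plus r)" by (intro mult_left_mono ln_one_plus_le r a)
  then have "E \<le> c + a * ln 2 + (- a) * ln (1 + r)" using e by (simp add: algebra_simps)
  then have "exp E \<le> exp (c + a * ln 2 + (- a) * ln (1 + r))" by simp
  also have "\<dots> = exp (c + a * ln 2) * (1 + r) powr (- a)" using r by (simp add: powr_def exp_add exp_diff exp_minus divide_inverse)
  finally show ?thesis .
qed

lemma complete_square_bound:
  fixes a b s :: real
  assumes "a > 0"
  shows "- a * s\<^sup>2 + b * s \<le> b\<^sup>2 / (4 * a)"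
proof -
  have "0 \<le> (2 * a * s - b)\<^sup>2 / (4 * a)" using assms by simp
  also have "\<dots> = a * s\<^sup>2 - b * s + b\<^sup>2 / (4 * a)"
    using assms by (simp add: power2_eq_square field_simps)
  finally show ?thesis by simp
qed

text \<open>The quadratic terms of the weight and of the kernel cancel for \<open>r \<ge> 1\<close>. What is left is a power of
  \<open>r\<close>, with exponent below \<open>-1\<close> exactly under the condition on \<open>b\<close>. For \<open>r < 1\<close> the weight is
  constant and the kernel is flat at the origin.\<close>

lemma laplace_kernel_bound:
  assumes q: "q > 1" "k > 0" and \<delta>: "\<delta> > 0" and a: "0 < a" and b: "0 < b" "ln b < (1/2 - \<nu>) * ln q / k"
  shows "\<exists>c \<eta>. 0 < c \<and> 0 < \<eta> \<and> (\<forall>T\<in>R_dom d \<delta>. a \<le> cmod T \<longrightarrow> cmod T \<le> b \<longrightarrow>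
     (\<forall>r>0. ray_weight q k \<nu> r * cmod (laplace_kernel q k d T r) \<le> c * (1 + r) powr (- (1 + \<eta>))))"
proof -
  define L where "L = ln q"
  have L: "L > 0" using q by (simp add: L_def)
  define \<eta> where "\<eta> = 1/2 - \<nu> - k * ln b / L"
  have \<eta>: "\<eta> > 0" using b q L by (simp add: \<eta>_def L_def[symmetric] field_simps)
  obtain c where c: "c > 0" "\<And>x. x \<noteq> 0 \<Longrightarrow> (\<forall>r\<ge>0. \<delta> \<le> cmod (1 + of_real r * x)) \<Longrightarrow>
     c * exp (k * (ln (cmod x))\<^sup>2 / (2 * L) + ln (cmod x) / 2) \<le> cmod (jacobi_theta q k x)"
    using jacobi_theta_lower_bound[OF q \<delta>] unfolding L_def by blast
  define E1 where "E1 = \<bar>ln a\<bar> + \<bar>ln b\<bar> + 9 * L / (8 * k)"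
  define \<pi>' where "\<pi>' = \<bar>pi_q q k\<bar>"
  define c' where "c' = exp (E1 + (1 + \<eta>) * ln 2) / (c * \<pi>') + 1"
  have c': "c' > 0" using c unfolding c'_def \<pi>'_def by (simp add: add_nonneg_pos)
  have "ray_weight q k \<nu> r * cmod (laplace_kernel q k d T r) \<le> c' * (1 + r) powr (- (1 + \<eta>))"
    if T: "T \<in> R_dom d \<delta>" "a \<le> cmod T" "cmod T \<le> b" and r: "r > 0" for T r
  proof -
    have T0: "T \<noteq> 0" using T a by auto
    define \<tau> where "\<tau> = ln (cmod T)"
    have \<tau>: "\<tau> \<le> ln b" "\<bar>\<tau>\<bar> \<le> \<bar>ln a\<bar> + \<bar>ln b\<bar>"
    proof -
      have "cmod T > 0" using T0 by simp
      then have "ln a \<le> \<tau>" "\<tau> \<le> ln b"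
        using T a b unfolding \<tau>_def by (simp_all only: ln_le_cancel_iff)
      then show "\<tau> \<le> ln b" "\<bar>\<tau>\<bar> \<le> \<bar>ln a\<bar> + \<bar>ln b\<bar>" by auto
    qed
    define l where "l = ln r"
    define x where "x = of_real r * cis d / T"
    have x0: "x \<noteq> 0" using r T0 by (simp add: x_def)
    have lx: "ln (cmod x) = l - \<tau>" using r T0 by (simp add: x_def norm_divide norm_mult ln_div l_def \<tau>_def)
    define G where "G = k * (l - \<tau>)\<^sup>2 / (2 * L) + (l - \<tau>) / 2"
    have th: "c * exp G \<le> cmod (jacobi_theta q k x)"
      using c(2)[OF x0 R_dom_cone[OF T(1) r, folded x_def]] unfolding lx G_def .
    have "cmod (laplace_kernel q k d T r) = 1 / (cmod (jacobi_theta q k x) * r * \<pi>')"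
      using r unfolding laplace_kernel_def x_def[symmetric] \<pi>'_def by (simp add: norm_divide norm_mult)
    also have "\<dots> \<le> 1 / (c * exp G * r * \<pi>')"
    proof (cases "\<pi>' = 0")
      case False
      then have "\<pi>' > 0" by (simp add: \<pi>'_def)
      moreover have "0 < c * exp G" using c by simp
      ultimately show ?thesis using c r th less_le_trans[OF \<open>0 < c * exp G\<close> th]
        by (intro divide_left_mono mult_right_mono mult_pos_pos) auto
    qed simp
    finally have "ray_weight q k \<nu> r * cmod (laplace_kernel q k d T r) \<le> ray_weight q k \<nu> r * (1 / (c * exp G * r * \<pi>'))"
      by (intro mult_left_mono) (auto simp: ray_weight_def)
    also have "\<dots> = exp (k * (log_plus r)\<^sup>2 / (2 * L) + \<nu> * log_plus r - G - l) / (c * \<pi>')"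
      using r unfolding ray_weight_def L_def[symmetric] exp_diff l_def by simp
    also have "\<dots> \<le> (exp (E1 + (1 + \<eta>) * ln 2) * (1 + r) powr (- (1 + \<eta>))) / (c * \<pi>')"
    proof (rule divide_right_mono[OF exp_le_powr_decay[OF r]])
      show "k * (log_plus r)\<^sup>2 / (2 * L) + \<nu> * log_plus r - G - l \<le> E1 - (1 + \<eta>) * log_plus r"
      proof (cases "l \<ge> 0")
        case True
        then have lp: "log_plus r = l" by (simp add: log_plus_def l_def)
        have "k * l\<^sup>2 / (2 * L) + \<nu> * l - G - l = - (1 + (1/2 - \<nu> - k * \<tau> / L)) * l - k * \<tau>\<^sup>2 / (2 * L) + \<tau> / 2"
          unfolding G_def using L by (simp add: field_simps power2_eq_square)
        also have "\<dots> \<le> - (1 + \<eta>) * l - 0 + E1"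
        proof (intro add_mono diff_mono mult_right_mono)
          have "k * \<tau> / L \<le> k * ln b / L" using \<tau> q L by (intro divide_right_mono mult_left_mono) auto
          then show "- (1 + (1/2 - \<nu> - k * \<tau> / L)) \<le> - (1 + \<eta>)" by (simp add: \<eta>_def)
          show "0 \<le> k * \<tau>\<^sup>2 / (2 * L)" using L q by simp
          have "0 \<le> 9 * L / (8 * k)" using L q by simp
          then show "\<tau> / 2 \<le> E1" using \<tau> unfolding E1_def by linarith
        qed (use True in auto)
        also have "- (1 + \<eta>) * l - 0 + E1 = E1 - (1 + \<eta>) * l" by (simp add: algebra_simps)
        finally show ?thesis unfolding lp .
      next
        case False
        then have lp: "log_plus r = 0" by (simp add: log_plus_def l_def)
        have "- G - l = - (k / (2 * L)) * (l - \<tau>)\<^sup>2 + (- 3/2) * (l - \<tau>) - \<tau>"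
        proof -
          have "- (A * X + s / 2) - (s + \<tau>) = - A * X + (- 3/2) * s - \<tau>" for A X s :: real
            by (simp add: algebra_simps)
          from this[of "k / (2 * L)" "(l - \<tau>)\<^sup>2" "l - \<tau>"] show ?thesis unfolding G_def by simp
        qed
        also have "\<dots> \<le> (- 3/2)\<^sup>2 / (4 * (k / (2 * L))) - \<tau>"
          using L q by (intro diff_right_mono complete_square_bound) auto
        also have "(- 3/2)\<^sup>2 / (4 * (k / (2 * L))) = 9 * L / (8 * k)" using L q by (simp add: power2_eq_square field_simps)
        finally show ?thesis unfolding lp E1_def using \<tau> by auto
      qed
    qed (use \<eta> c \<pi>'_def in auto)
    also have "\<dots> = exp (E1 + (1 + \<eta>) * ln 2) / (c * \<pi>') * (1 + r) powr (- (1 + \<eta>))" by simp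
    also have "\<dots> \<le> c' * (1 + r) powr (- (1 + \<eta>))" unfolding c'_def by (intro mult_right_mono) auto
    finally show ?thesis .
  qed
  then show ?thesis using c' \<eta> by blast
qed

text \<open>Expanding the square: with \<open>l = log_plus r\<close> and \<open>X = x log q\<close>, the quadratic part of the weight at
  the smaller point is at most that of \<open>l - X\<close>, which is smaller than that of \<open>l\<close> by \<open>k x l\<close> up to a
  constant.\<close>

lemma ray_weight_shift:
  assumes q: "q > 1" "k > 0" and x: "x \<ge> 0" and n: "real n - k * x \<le> real N"
  shows "\<exists>c>0. \<forall>r>0. r ^ n * ray_weight q k \<nu> (q powr (- x) * r) \<le> c * (ray_weight q k \<nu> r * (1 + r) ^ N)"
proof -
  define L where "L = ln q"
  have L: "L > 0" using q by (simp add: L_def)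
  define X where "X = x * L"
  have X: "X \<ge> 0" using x L by (simp add: X_def)
  define c where "c = exp (k * x\<^sup>2 * L / 2 + \<bar>\<nu>\<bar> * X)"
  have "r ^ n * ray_weight q k \<nu> (q powr (- x) * r) \<le> c * (ray_weight q k \<nu> r * (1 + r) ^ N)" if r: "r > 0" for r
  proof -
    define l where "l = log_plus r"
    define l' where "l' = log_plus (q powr (- x) * r)"
    have l0: "l \<ge> 0" "l' \<ge> 0" by (simp_all add: l_def l'_def log_plus_def)
    have "ln (q powr (- x) * r) = ln r - X" using q r by (simp add: ln_mult ln_powr X_def L_def)
    then have l': "l' = max 0 (ln r - X)" by (simp add: l'_def log_plus_def)
    have sq: "l'\<^sup>2 \<le> (l - X)\<^sup>2"
    proof (cases "ln r - X \<ge> 0")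
      case True
      then show ?thesis using X by (simp add: l' l_def log_plus_def max_def)
    next
      case False
      then have "l' = 0" by (simp add: l')
      then show ?thesis by simp
    qed
    have ab: "\<bar>l' - l\<bar> \<le> X" using X by (auto simp: l' l_def log_plus_def max_def)
    have nu: "\<nu> * (l' - l) \<le> \<bar>\<nu>\<bar> * X"
    proof -
      have "\<nu> * (l' - l) \<le> \<bar>\<nu>\<bar> * \<bar>l' - l\<bar>" by (metis abs_ge_self abs_mult)
      also have "\<dots> \<le> \<bar>\<nu>\<bar> * X" using ab by (intro mult_left_mono) auto
      finally show ?thesis .
    qed
    have "k * l'\<^sup>2 / (2 * L) \<le> k * (l - X)\<^sup>2 / (2 * L)" using sq q L by (intro divide_right_mono mult_left_mono) auto
    also have "\<dots> = k * l\<^sup>2 / (2 * L) - k * x * l + k * x\<^sup>2 * L / 2"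
      using L unfolding X_def by (simp add: field_simps power2_eq_square)
    finally have 1: "k * l'\<^sup>2 / (2 * L) \<le> k * l\<^sup>2 / (2 * L) - k * x * l + k * x\<^sup>2 * L / 2" .
    have 2: "real n * ln r \<le> real n * l" by (intro mult_left_mono) (auto simp: l_def log_plus_def)
    have 3: "(real n - k * x) * l \<le> real N * l" using n l0 by (intro mult_right_mono)
    have 4: "real N * l \<le> real N * ln (1 + r)" using ln_one_plus_le[OF r] by (intro mult_left_mono) (auto simp: l_def)
    have "real n * ln r + (k * l'\<^sup>2 / (2 * L) + \<nu> * l') \<le> (k * x\<^sup>2 * L / 2 + \<bar>\<nu>\<bar> * X) + ((k * l\<^sup>2 / (2 * L) + \<nu> * l) + real N * ln (1 + r))"
      using 1 2 3 4 nu by (simp add: algebra_simps)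
    then have "exp (real n * ln r + (k * l'\<^sup>2 / (2 * L) + \<nu> * l')) \<le> exp ((k * x\<^sup>2 * L / 2 + \<bar>\<nu>\<bar> * X) + ((k * l\<^sup>2 / (2 * L) + \<nu> * l) + real N * ln (1 + r)))"
      by simp
    then show ?thesis
      using r unfolding exp_add c_def ray_weight_def L_def[symmetric] l_def[symmetric] l'_def[symmetric]
      by (simp add: exp_of_nat_mult mult_ac)
  qed
  then show ?thesis by (intro exI[of _ c]) (auto simp: c_def)
qed

lemma poly_imaginary_upper_bound:
  "cmod (poly R (\<i> * of_real m)) \<le> (\<Sum>j\<le>degree R. cmod (coeff R j)) * (1 + \<bar>m\<bar>) ^ degree R"
proof -
  have "cmod (poly R (\<i> * of_real m)) \<le> (\<Sum>j\<le>degree R. cmod (coeff R j * (\<i> * of_real m) ^ j))"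
    unfolding poly_altdef by (rule norm_sum)
  also have "\<dots> \<le> (\<Sum>j\<le>degree R. cmod (coeff R j) * (1 + \<bar>m\<bar>) ^ degree R)"
  proof (rule sum_mono)
    fix j assume "j \<in> {..degree R}"
    then have "\<bar>m\<bar> ^ j \<le> (1 + \<bar>m\<bar>) ^ degree R"
      by (intro order_trans[OF power_mono[of "\<bar>m\<bar>" "1 + \<bar>m\<bar>" j] power_increasing]) auto
    then show "cmod (coeff R j * (\<i> * of_real m) ^ j) \<le> cmod (coeff R j) * (1 + \<bar>m\<bar>) ^ degree R"
      by (simp add: norm_mult norm_power mult_left_mono)
  qed
  finally show ?thesis by (simp add: sum_distrib_right)
qed

text \<open>Without zeros on the imaginary axis, the linear factors are bounded below by multiples of
  \<open>1 + |m|\<close>: away from zero by the real part of the root, and for large \<open>|m|\<close> by the triangle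
  inequality.\<close>

lemma poly_imaginary_lower_bound:
  assumes "\<And>m::real. poly R (\<i> * of_real m) \<noteq> 0"
  shows "\<exists>c>0. \<forall>m::real. c * (1 + \<bar>m\<bar>) ^ degree R \<le> cmod (poly R (\<i> * of_real m))"
proof -
  obtain root where R: "smult (lead_coeff R) (\<Prod>i<degree R. [:- root i, 1:]) = R"
    by (rule complex_poly_decompose')
  have ev: "poly R x = lead_coeff R * (\<Prod>i<degree R. x - root i)" for x
  proof -
    have "poly R x = poly (smult (lead_coeff R) (\<Prod>i<degree R. [:- root i, 1:])) x" by (simp only: R)
    then show ?thesis by (simp add: poly_prod)
  qed
  have "R \<noteq> 0" using assms by auto
  then have lc: "lead_coeff R \<noteq> 0" by simp
  have Re: "Re (root i) \<noteq> 0" if "i < degree R" for i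
  proof
    assume "Re (root i) = 0"
    then have "\<i> * of_real (Im (root i)) = root i" by (simp add: complex_eq_iff)
    then have "poly R (\<i> * of_real (Im (root i))) = 0" unfolding ev using that by (auto simp: prod_zero_iff)
    then show False using assms by blast
  qed
  define c where "c i = \<bar>Re (root i)\<bar> / (1 + \<bar>Re (root i)\<bar> + cmod (root i))" for i
  have c: "c i > 0" if "i < degree R" for i using Re[OF that] by (auto simp: c_def intro!: divide_pos_pos add_pos_nonneg)
  have cb: "c i * (1 + \<bar>m\<bar>) \<le> cmod (\<i> * of_real m - root i)" for i m
  proof -
    define u where "u = cmod (\<i> * of_real m - root i)"
    have 1: "\<bar>Re (root i)\<bar> \<le> u" unfolding u_def using abs_Re_le_cmod[of "\<i> * of_real m - root i"] by simp
    have 2: "\<bar>m\<bar> \<le> u + cmod (root i)" unfolding u_def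
      using norm_triangle_ineq[of "\<i> * of_real m - root i" "root i"] by (simp add: norm_mult)
    have "\<bar>Re (root i)\<bar> * (1 + \<bar>m\<bar>) \<le> \<bar>Re (root i)\<bar> * (1 + u + cmod (root i))" using 2 by (intro mult_left_mono) auto
    also have "\<dots> = \<bar>Re (root i)\<bar> * (1 + cmod (root i)) + \<bar>Re (root i)\<bar> * u" by (simp add: algebra_simps)
    also have "\<dots> \<le> u * (1 + cmod (root i)) + \<bar>Re (root i)\<bar> * u" using 1 by (intro add_right_mono mult_right_mono) auto
    also have "\<dots> = u * (1 + \<bar>Re (root i)\<bar> + cmod (root i))" by (simp add: algebra_simps)
    finally show ?thesis unfolding c_def u_def[symmetric]
      by (simp add: divide_le_eq add_pos_nonneg)
  qed
  have "cmod (lead_coeff R) * (\<Prod>i<degree R. c i) * (1 + \<bar>m\<bar>) ^ degree R \<le> cmod (poly R (\<i> * of_real m))" for m :: real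
  proof -
    have "(\<Prod>i<degree R. c i) * (1 + \<bar>m\<bar>) ^ degree R = (\<Prod>i<degree R. c i * (1 + \<bar>m\<bar>))" by (simp add: prod.distrib)
    also have "\<dots> \<le> (\<Prod>i<degree R. cmod (\<i> * of_real m - root i))"
      using c cb by (intro prod_mono) (auto intro!: mult_nonneg_nonneg simp: less_imp_le)
    finally show ?thesis unfolding ev norm_mult prod_norm[symmetric] mult.assoc by (intro mult_left_mono) auto
  qed
  moreover have "cmod (lead_coeff R) * (\<Prod>i<degree R. c i) > 0" using lc c by (auto intro!: mult_pos_pos prod_pos)
  ultimately show ?thesis by blast
qed

lemma power_minus_const_lower_bound:
  fixes A z :: complex
  assumes n: "n \<ge> 1" and A: "A \<noteq> 0" and roots: "\<And>w. w ^ n = A \<Longrightarrow> c \<le> cmod (z - w)" and c: "c \<ge> 0"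
  shows "c ^ n \<le> cmod (z ^ n - A)"
proof -
  define P where "P = monom 1 n - [:A:]"
  have P: "poly P x = x ^ n - A" for x by (simp add: P_def poly_monom)
  have deg: "degree P = n" 
  proof (rule antisym)
    show "degree P \<le> n" unfolding P_def by (rule degree_diff_le) (auto simp: degree_monom_le)
    show "n \<le> degree P" by (rule le_degree) (use n in \<open>simp add: P_def coeff_pCons split: nat.split\<close>)
  qed
  have lc: "lead_coeff P = 1" unfolding deg using n by (simp add: P_def coeff_pCons split: nat.split)
  obtain root where R: "smult (lead_coeff P) (\<Prod>i<degree P. [:- root i, 1:]) = P"
    by (rule complex_poly_decompose')
  have ev: "poly P x = (\<Prod>i<n. x - root i)" for x
  proof -
    have "poly P x = poly (smult 1 (\<Prod>i<n. [:- root i, 1:])) x" by (simp only: R[unfolded lc, unfolded deg])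
    then show ?thesis by (simp add: poly_prod)
  qed
  have "c \<le> cmod (z - root i)" if "i < n" for i
  proof (rule roots)
    have "poly P (root i) = 0" unfolding ev using that by (auto simp: prod_zero_iff)
    then show "root i ^ n = A" by (simp add: P)
  qed
  then have "(\<Prod>i<n. c) \<le> (\<Prod>i<n. cmod (z - root i))" using c by (intro prod_mono) auto
  also have "\<dots> = cmod (z ^ n - A)" unfolding P[symmetric] ev by (simp add: prod_norm)
  finally show ?thesis by simp
qed

section \<open>The forcing term on the ray\<close>

text \<open>This describes sectors without choosing an argument, also when they wind around the origin, and
  yields openness and connectedness at once.\<close>

lemma sector_eq_exp_image: "sector d \<theta> = exp ` {w. \<bar>Im w - d\<bar> < \<theta>}"
proof (intro subset_antisym subsetI)
  fix z assume "z \<in> sector d \<theta>"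
  then obtain r \<phi> where z: "z = of_real r * cis (d + \<phi>)" "0 < r" "\<bar>\<phi>\<bar> < \<theta>" by (auto simp: sector_def)
  then have "z = exp (Complex (ln r) (d + \<phi>))" by (simp add: exp_eq_polar)
  then show "z \<in> exp ` {w. \<bar>Im w - d\<bar> < \<theta>}" using z by auto
next
  fix z assume "z \<in> exp ` {w. \<bar>Im w - d\<bar> < \<theta>}"
  then obtain w where w: "z = exp w" "\<bar>Im w - d\<bar> < \<theta>" by auto
  then have "z = of_real (exp (Re w)) * cis (d + (Im w - d))" by (simp add: exp_eq_polar)
  then show "z \<in> sector d \<theta>" unfolding sector_def using w by (intro CollectI exI[of _ "exp (Re w)"] exI[of _ "Im w - d"]) auto
qed

lemma open_sector: "open (sector d \<theta>)"
  unfolding sector_eq_exp_image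
proof (rule open_mapping_thm[of exp UNIV])
  show "open {w. \<bar>Im w - d\<bar> < \<theta>}" by (intro open_Collect_less continuous_intros)
  show "\<not> (exp :: complex \<Rightarrow> complex) constant_on UNIV"
  proof
    assume "(exp :: complex \<Rightarrow> complex) constant_on UNIV"
    then have "exp (0::complex) = exp (of_real 1)" unfolding constant_on_def by (metis UNIV_I)
    then have "1 = exp (1::real)" by (metis exp_of_real exp_zero of_real_eq_iff of_real_1)
    then show False by simp
  qed
qed (auto intro: holomorphic_intros)

lemma connected_sector: "connected (sector d \<theta>)"
  unfolding sector_eq_exp_image
proof (intro connected_continuous_image convex_connected)
  have "{w. \<bar>Im w - d\<bar> < \<theta>} = {w. Im w < d + \<theta>} \<inter> {w. Im w > d - \<theta>}" by auto
  then show "convex {w. \<bar>Im w - d\<bar> < \<theta>}" by (simp add: convex_Int convex_halfspace_Im_lt convex_halfspace_Im_gt)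
qed (intro continuous_intros)

lemma ray_in_sector: "\<theta> > 0 \<Longrightarrow> r > 0 \<Longrightarrow> of_real r * cis d \<in> sector d \<theta>"
  unfolding sector_def by (intro CollectI exI[of _ r] exI[of _ 0]) auto

lemma ennreal_SUP_le_D:
  assumes "(SUP x\<in>A. ennreal (f x)) \<le> ennreal K" "x \<in> A" "K \<ge> 0"
  shows "f x \<le> K"
  using assms by (metis SUP_upper ennreal_le_iff order_trans)

lemma fourier_weight_transfer:
  assumes "(1 + \<bar>m\<bar>) powr \<mu> * exp (\<beta> * \<bar>m\<bar>) * X \<le> K"
  shows "X \<le> K * fourier_weight \<beta> \<mu> m"
proof -
  define u where "u = (1 + \<bar>m\<bar>) powr \<mu> * exp (\<beta> * \<bar>m\<bar>)"
  have u: "u > 0" by (simp add: u_def add_pos_nonneg)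
  have fw: "fourier_weight \<beta> \<mu> m = 1 / u" by (simp add: fourier_weight_def u_def powr_minus exp_minus field_simps)
  show ?thesis unfolding fw using assms u unfolding u_def[symmetric] by (simp add: pos_le_divide_eq mult.commute)
qed

lemma E_norm_bound:
  assumes "E_norm \<beta> \<mu> h \<le> ennreal K" "K \<ge> 0"
  shows "cmod (h m) \<le> K * fourier_weight \<beta> \<mu> m"
  using ennreal_SUP_le_D[OF assms(1)[unfolded E_norm_def] UNIV_I assms(2)] by (rule fourier_weight_transfer)

lemma Exp1_norm_bound:
  assumes "Exp1_norm q U \<delta> k \<beta> \<mu> \<alpha> \<rho> h \<le> ennreal K" "K \<ge> 0" "\<tau> \<in> U \<union> cball 0 \<rho>"
  shows "cmod (h \<tau> m) \<le> K * (fourier_weight \<beta> \<mu> m *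
    exp (k * (ln (cmod (\<tau> + of_real \<delta>)))\<^sup>2 / (2 * ln q) + \<alpha> * ln (cmod (\<tau> + of_real \<delta>))))"
proof -
  define X where "X = k * (ln (cmod (\<tau> + of_real \<delta>)))\<^sup>2 / (2 * ln q) + \<alpha> * ln (cmod (\<tau> + of_real \<delta>))"
  have "(\<tau>, m) \<in> (U \<union> cball 0 \<rho>) \<times> UNIV" using assms by auto
  from ennreal_SUP_le_D[OF _ this assms(2), of "\<lambda>(\<tau>, m). (1 + \<bar>m\<bar>) powr \<mu> * exp (\<beta> * \<bar>m\<bar>)
          * exp (- k * (ln (cmod (\<tau> + of_real \<delta>)))\<^sup>2 / (2 * ln q) - \<alpha> * ln (cmod (\<tau> + of_real \<delta>))) * cmod (h \<tau> m)"]
  have "(1 + \<bar>m\<bar>) powr \<mu> * exp (\<beta> * \<bar>m\<bar>) * (exp (- X) * cmod (h \<tau> m)) \<le> K"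
    using assms(1) unfolding Exp1_norm_def X_def by (simp add: case_prod_unfold mult.assoc)
  then have "exp (- X) * cmod (h \<tau> m) \<le> K * fourier_weight \<beta> \<mu> m" by (rule fourier_weight_transfer)
  then have "exp X * (exp (- X) * cmod (h \<tau> m)) \<le> exp X * (K * fourier_weight \<beta> \<mu> m)" by (intro mult_left_mono) auto
  moreover have "exp X * (exp (- X) * cmod (h \<tau> m)) = cmod (h \<tau> m)" by (simp add: exp_minus)
  ultimately have "cmod (h \<tau> m) \<le> exp X * (K * fourier_weight \<beta> \<mu> m)" by linarith
  then show ?thesis unfolding X_def[symmetric] by (simp add: mult_ac)
qed

lemma Exp2_norm_bound:
  assumes "Exp2_norm q S Rb k \<beta> \<mu> \<nu> h \<le> ennreal K" "K \<ge> 0" "\<tau> \<in> S" "\<tau> \<noteq> 0"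
  shows "cmod (h \<tau> m) \<le> K * (fourier_weight \<beta> \<mu> m * exp (k * (ln (cmod \<tau>))\<^sup>2 / (2 * ln q) + \<nu> * ln (cmod \<tau>)))"
proof -
  define X where "X = k * (ln (cmod \<tau>))\<^sup>2 / (2 * ln q) + \<nu> * ln (cmod \<tau>)"
  have "(\<tau>, m) \<in> (S \<union> closure Rb - {0}) \<times> UNIV" using assms by auto
  from ennreal_SUP_le_D[OF _ this assms(2), of "\<lambda>(\<tau>, m). (1 + \<bar>m\<bar>) powr \<mu> * exp (\<beta> * \<bar>m\<bar>)
          * exp (- k * (ln (cmod \<tau>))\<^sup>2 / (2 * ln q) - \<nu> * ln (cmod \<tau>)) * cmod (h \<tau> m)"]
  have "(1 + \<bar>m\<bar>) powr \<mu> * exp (\<beta> * \<bar>m\<bar>) * (exp (- X) * cmod (h \<tau> m)) \<le> K"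
    using assms(1) unfolding Exp2_norm_def X_def by (simp add: case_prod_unfold mult.assoc)
  then have "exp (- X) * cmod (h \<tau> m) \<le> K * fourier_weight \<beta> \<mu> m" by (rule fourier_weight_transfer)
  then have "exp X * (exp (- X) * cmod (h \<tau> m)) \<le> exp X * (K * fourier_weight \<beta> \<mu> m)" by (intro mult_left_mono) auto
  moreover have "exp X * (exp (- X) * cmod (h \<tau> m)) = cmod (h \<tau> m)" by (simp add: exp_minus)
  ultimately have "cmod (h \<tau> m) \<le> exp X * (K * fourier_weight \<beta> \<mu> m)" by linarith
  then show ?thesis unfolding X_def[symmetric] by (simp add: mult_ac)
qed

text \<open>The q-Gevrey growth of the coefficients is cancelled by \<open>cq\<close>, leaving a geometric series.\<close>

lemma q_borel_series_holomorphic: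
  assumes B: "open B" and q: "q > 1" and k: "k > 0" and \<rho>: "\<rho> > 0" and \<tau>: "cmod \<tau> < \<rho>"
    and hol: "\<And>n. F n holomorphic_on B"
    and bd: "\<And>n \<epsilon>. \<epsilon> \<in> B \<Longrightarrow> cmod (F n \<epsilon>) \<le> K / \<rho> ^ n * q powr (real n * (real n - 1) / (2 * k))"
    and sums: "\<And>\<epsilon>. \<epsilon> \<in> B \<Longrightarrow> (\<lambda>n. F n \<epsilon> * \<tau> ^ n / of_real (cq q k n)) sums f \<epsilon>"
  shows "f holomorphic_on B"
proof -
  have c: "cq q k n = q powr (real n * (real n - 1) / (2 * k))" for n
    by (simp add: cq_def powr_powr mult.commute)
  define G where "G n \<epsilon> = F n \<epsilon> * \<tau> ^ n / of_real (cq q k n)" for n \<epsilon>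
  have "cmod (G n \<epsilon>) \<le> K * (cmod \<tau> / \<rho>) ^ n" if "\<epsilon> \<in> B" for n \<epsilon>
  proof -
    have "cmod (F n \<epsilon>) * cmod \<tau> ^ n / cq q k n \<le> (K / \<rho> ^ n * cq q k n) * cmod \<tau> ^ n / cq q k n"
      using bd[OF that, of n] q unfolding c by (intro divide_right_mono mult_right_mono) auto
    also have "\<dots> = K * (cmod \<tau> / \<rho>) ^ n" using q by (simp add: c power_divide)
    finally show ?thesis using q by (simp add: G_def norm_divide norm_mult norm_power c)
  qed
  moreover have "summable (\<lambda>n. K * (cmod \<tau> / \<rho>) ^ n)"
    using \<tau> \<rho> by (intro summable_mult summable_geometric) auto
  ultimately have "uniform_limit B (\<lambda>n \<epsilon>. \<Sum>i<n. G i \<epsilon>) (\<lambda>\<epsilon>. \<Sum>i. G i \<epsilon>) sequentially"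
    by (intro Weierstrass_m_test)
  then have "(\<lambda>\<epsilon>. \<Sum>i. G i \<epsilon>) holomorphic_on B"
    by (rule holomorphic_uniform_limit_sequence[OF B, rotated])
      (use q in \<open>auto simp: G_def c intro!: holomorphic_intros hol\<close>)
  then show ?thesis
    by (rule holomorphic_transform) (use sums in \<open>simp add: G_def sums_iff\<close>)
qed

text \<open>The growth allowed for the first Borel transform has the Gaussian constant \<open>k1\<close>, the kernel decays with
  \<open>\<kappa> > k1\<close>. The bound is uniform for \<open>s\<close> in a bounded range because the logarithm of
  \<open>|s v e\<^sup>i\<^sup>d + \<delta>|\<close> is at most \<open>log_plus v\<close> up to a constant.\<close>

lemma first_borel_kernel_dominated:
  assumes q: "q > 1" and k: "0 < k1" "k1 < \<kappa>" and \<alpha>: "\<alpha> \<ge> 0" and \<delta>: "\<delta> > 0" and R: "R > 0" and c0: "c0 > 0"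
  shows "\<exists>C\<ge>0. \<forall>s v. 0 < s \<longrightarrow> s \<le> R \<longrightarrow> 0 < v \<longrightarrow> c0 \<le> cmod (of_real (s * v) * cis d + of_real \<delta>) \<longrightarrow>
     exp (k1 * (ln (cmod (of_real (s * v) * cis d + of_real \<delta>)))\<^sup>2 / (2 * ln q) + \<alpha> * ln (cmod (of_real (s * v) * cis d + of_real \<delta>)))
       * cmod (laplace_kernel q \<kappa> d (cis d) v) \<le> C * (1 + v) powr (- 2)"
proof -
  define L where "L = ln q"
  have L: "L > 0" using q by (simp add: L_def)
  define A where "A = \<bar>ln c0\<bar> + \<bar>ln (\<delta> + R)\<bar>"
  have A: "A \<ge> 0" by (simp add: A_def)
  obtain c where c: "c > 0" "\<And>x. x \<noteq> 0 \<Longrightarrow> (\<forall>r\<ge>0. 1 \<le> cmod (1 + of_real r * x)) \<Longrightarrow>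
     c * exp (\<kappa> * (ln (cmod x))\<^sup>2 / (2 * L) + ln (cmod x) / 2) \<le> cmod (jacobi_theta q \<kappa> x)"
    using jacobi_theta_lower_bound[OF q, of \<kappa> 1] k unfolding L_def by auto
  define E1 where "E1 = k1 * A\<^sup>2 / (2 * L) + \<alpha> * A + (k1 * A / L + \<alpha> + 1/2)\<^sup>2 / (4 * ((\<kappa> - k1) / (2 * L))) + 9 * L / (8 * \<kappa>)"
  define \<pi>' where "\<pi>' = \<bar>pi_q q \<kappa>\<bar>"
  define C where "C = exp (E1 + 2 * ln 2) / (c * \<pi>')"
  have "exp (k1 * Y\<^sup>2 / (2 * L) + \<alpha> * Y) * cmod (laplace_kernel q \<kappa> d (cis d) v) \<le> C * (1 + v) powr (- 2)"
    if s: "0 < s" "s \<le> R" and v: "v > 0" and Yc: "c0 \<le> cmod (of_real (s * v) * cis d + of_real \<delta>)"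
      and Y: "Y = ln (cmod (of_real (s * v) * cis d + of_real \<delta>))" for s v Y
  proof -
    define l where "l = ln v"
    define lp where "lp = log_plus v"
    have lp: "lp = max 0 l" "lp \<ge> 0" by (auto simp: lp_def log_plus_def l_def)
    have Yb: "\<bar>Y\<bar> \<le> A + lp"
    proof -
      have "cmod (of_real (s * v) * cis d + of_real \<delta>) \<le> s * v + \<delta>"
        using norm_triangle_ineq[of "of_real (s * v) * cis d" "of_real \<delta>"] s v \<delta> by (simp add: norm_mult)
      also have "\<dots> \<le> R * v + \<delta>" using s v by (intro add_right_mono mult_right_mono) auto
      also have "\<dots> \<le> R * max 1 v + \<delta> * max 1 v" using R \<delta> by (intro add_mono mult_left_mono) auto
      finally have "cmod (of_real (s * v) * cis d + of_real \<delta>) \<le> (\<delta> + R) * max 1 v" by (simp add: distrib_right)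
      then have "Y \<le> ln ((\<delta> + R) * max 1 v)" unfolding Y using Yc c0 R \<delta> by (subst ln_le_cancel_iff) auto
      also have "\<dots> = ln (\<delta> + R) + ln (max 1 v)" using R \<delta> by (subst ln_mult) auto
      also have "ln (max 1 v) = lp" using v by (auto simp: lp_def log_plus_def max_def)
      finally have 1: "Y \<le> A + lp" unfolding A_def by linarith
      have "ln c0 \<le> Y" unfolding Y using Yc c0 by (subst ln_le_cancel_iff) auto
      then have "- Y \<le> A + lp" using lp unfolding A_def by linarith
      then show ?thesis using 1 by linarith
    qed
    have Y2: "Y\<^sup>2 \<le> (A + lp)\<^sup>2" using Yb A lp by (metis abs_le_square_iff abs_of_nonneg add_nonneg_nonneg)
    define G where "G = \<kappa> * l\<^sup>2 / (2 * L) + l / 2"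
    have th: "c * exp G \<le> cmod (jacobi_theta q \<kappa> (of_real v))"
    proof -
      have "\<forall>r\<ge>0. 1 \<le> cmod (1 + of_real r * complex_of_real v)"
      proof (intro allI impI)
        fix r :: real assume "r \<ge> 0"
        then have "0 \<le> r * v" using v by simp
        then have "cmod (of_real (1 + r * v)) = 1 + r * v" by (simp only: norm_of_real)
        then show "1 \<le> cmod (1 + of_real r * complex_of_real v)" using \<open>0 \<le> r * v\<close> by simp
      qed
      then show ?thesis using c(2)[of "of_real v"] v unfolding G_def l_def by simp
    qed
    have "cmod (laplace_kernel q \<kappa> d (cis d) v) = 1 / (cmod (jacobi_theta q \<kappa> (of_real v)) * v * \<pi>')"
      using v unfolding laplace_kernel_def \<pi>'_def by (simp add: norm_divide norm_mult)
    also have "\<dots> \<le> 1 / (c * exp G * v * \<pi>')"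
    proof (cases "\<pi>' = 0")
      case False
      then have "\<pi>' > 0" by (simp add: \<pi>'_def)
      moreover have "0 < c * exp G" using c by simp
      ultimately show ?thesis using c v th less_le_trans[OF \<open>0 < c * exp G\<close> th]
        by (intro divide_left_mono mult_right_mono mult_pos_pos) auto
    qed simp
    finally have "exp (k1 * Y\<^sup>2 / (2 * L) + \<alpha> * Y) * cmod (laplace_kernel q \<kappa> d (cis d) v)
        \<le> exp (k1 * Y\<^sup>2 / (2 * L) + \<alpha> * Y) * (1 / (c * exp G * v * \<pi>'))"
      by (intro mult_left_mono) auto
    also have "\<dots> = exp (k1 * Y\<^sup>2 / (2 * L) + \<alpha> * Y - G - l) / (c * \<pi>')"
      using v unfolding exp_diff l_def by simp
    also have "\<dots> \<le> (exp (E1 + 2 * ln 2) * (1 + v) powr (- 2)) / (c * \<pi>')"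
    proof (rule divide_right_mono[OF exp_le_powr_decay[OF v]])
      have "k1 * Y\<^sup>2 / (2 * L) \<le> k1 * (A + lp)\<^sup>2 / (2 * L)" using Y2 k L by (intro divide_right_mono mult_left_mono) auto
      moreover have "\<alpha> * Y \<le> \<alpha> * (A + lp)" using Yb \<alpha> by (intro mult_left_mono) auto
      moreover have "k1 * (A + lp)\<^sup>2 / (2 * L) + \<alpha> * (A + lp) - G - l \<le> E1 - 2 * lp"
      proof (cases "l \<ge> 0")
        case True
        have "k1 * (A + l)\<^sup>2 / (2 * L) + \<alpha> * (A + l) - G - l + 2 * l
            = (k1 * A\<^sup>2 / (2 * L) + \<alpha> * A) + (- ((\<kappa> - k1) / (2 * L)) * l\<^sup>2 + (k1 * A / L + \<alpha> + 1/2) * l)"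
          unfolding G_def using L by (simp add: field_simps power2_eq_square)
        also have "\<dots> \<le> (k1 * A\<^sup>2 / (2 * L) + \<alpha> * A) + (k1 * A / L + \<alpha> + 1/2)\<^sup>2 / (4 * ((\<kappa> - k1) / (2 * L)))"
          using k L by (intro add_left_mono complete_square_bound) auto
        also have "\<dots> \<le> E1" using k L by (simp add: E1_def)
        finally show ?thesis using True by (simp add: lp)
      next
        case False
        have "k1 * A\<^sup>2 / (2 * L) + \<alpha> * A - G - l = (k1 * A\<^sup>2 / (2 * L) + \<alpha> * A) + (- (\<kappa> / (2 * L)) * l\<^sup>2 + (- 3/2) * l)"
          unfolding G_def by simp
        also have "\<dots> \<le> (k1 * A\<^sup>2 / (2 * L) + \<alpha> * A) + (- 3/2)\<^sup>2 / (4 * (\<kappa> / (2 * L)))"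
          using k L by (intro add_left_mono complete_square_bound) auto
        also have "(- 3/2)\<^sup>2 / (4 * (\<kappa> / (2 * L))) = 9 * L / (8 * \<kappa>)" using L k by (simp add: power2_eq_square field_simps)
        also have "(k1 * A\<^sup>2 / (2 * L) + \<alpha> * A) + 9 * L / (8 * \<kappa>) \<le> E1" using k L by (simp add: E1_def)
        finally show ?thesis using False by (simp add: lp)
      qed
      ultimately show "k1 * Y\<^sup>2 / (2 * L) + \<alpha> * Y - G - l \<le> E1 - 2 * log_plus v"
        unfolding lp_def[symmetric] by linarith
    qed (use c \<pi>'_def in auto)
    finally show ?thesis unfolding C_def by simp
  qed
  moreover have "C \<ge> 0" using c unfolding C_def \<pi>'_def by simp
  ultimately show ?thesis unfolding L_def by blast
qed

text \<open>After the substitution \<open>r' = r v\<close> the kernel of the first Laplace transform is fixed and only the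
  argument of \<open>\<psi>\<close> depends on \<open>r\<close>. Holomorphy in \<open>\<epsilon>\<close> and the bound near the origin both come
  from the same dominating function.\<close>

lemma
  fixes \<psi> :: "complex \<Rightarrow> real \<Rightarrow> complex \<Rightarrow> complex"
  assumes q: "q > 1" and k: "0 < k1" "k1 < \<kappa>" and \<alpha>: "\<alpha> \<ge> 0" and \<delta>: "\<delta> > 0" and \<rho>: "\<rho> > 0" and c0: "c0 > 0"
    and \<theta>: "\<theta> > 0" and B: "open B"
    and dist: "\<And>\<tau>. \<tau> \<in> sector d \<theta> \<union> ball 0 \<rho> \<Longrightarrow> c0 \<le> cmod (\<tau> + of_real \<delta>)"
    and cont: "\<And>\<epsilon> m. \<epsilon> \<in> B \<Longrightarrow> continuous_on (sector d \<theta>) (\<lambda>\<tau>. \<psi> \<tau> m \<epsilon>)"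
    and hol: "\<And>\<epsilon> m. \<epsilon> \<in> B \<Longrightarrow> (\<lambda>\<tau>. \<psi> \<tau> m \<epsilon>) holomorphic_on (sector d \<theta> \<union> ball 0 \<rho>)"
    and bd: "\<And>\<epsilon> \<tau> m. \<epsilon> \<in> B \<Longrightarrow> \<tau> \<in> sector d \<theta> \<union> ball 0 \<rho> \<Longrightarrow> cmod (\<psi> \<tau> m \<epsilon>) \<le> Z * (fourier_weight \<beta> \<mu> m *
         exp (k1 * (ln (cmod (\<tau> + of_real \<delta>)))\<^sup>2 / (2 * ln q) + \<alpha> * ln (cmod (\<tau> + of_real \<delta>))))"
    and Z: "Z \<ge> 0"
    and near0: "\<And>\<tau> m. \<tau> \<in> ball 0 \<rho> \<Longrightarrow> (\<lambda>\<epsilon>. \<psi> \<tau> m \<epsilon>) holomorphic_on B"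
  shows psi_k2_holomorphic: "\<And>r m. r > 0 \<Longrightarrow> (\<lambda>\<epsilon>. psi_k2 q \<kappa> d \<psi> (of_real r * cis d) m \<epsilon>) holomorphic_on B"
    and psi_k2_bounded_near_0: "\<exists>K\<ge>0. \<forall>r m. \<forall>\<epsilon>\<in>B. 0 < r \<longrightarrow> r \<le> 1 \<longrightarrow>
          cmod (psi_k2 q \<kappa> d \<psi> (of_real r * cis d) m \<epsilon>) \<le> K * fourier_weight \<beta> \<mu> m"
proof -
  define W where "W = sector d \<theta> \<union> ball 0 \<rho>"
  have W: "open W" "connected W"
  proof -
    show "open W" unfolding W_def by (intro open_Un open_sector open_ball)
    have "of_real (\<rho>/2) * cis d \<in> sector d \<theta> \<inter> ball 0 \<rho>"
      using ray_in_sector[OF \<theta>, of "\<rho>/2"] \<rho> by (simp add: norm_mult)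
    then show "connected W" unfolding W_def by (intro connected_Un connected_sector connected_ball) auto
  qed
  have ray: "of_real r * cis d \<in> sector d \<theta>" if "r > 0" for r using ray_in_sector[OF \<theta> that] .
  have par: "(\<lambda>\<epsilon>. \<psi> \<tau> m \<epsilon>) holomorphic_on B" if \<tau>: "\<tau> \<in> W" for \<tau> m
  proof (rule holomorphic_parameter_propagates[OF B W, where N="ball 0 \<rho>"])
    show "(\<lambda>\<tau>. \<psi> \<tau> m \<epsilon>) holomorphic_on W" if "\<epsilon> \<in> B" for \<epsilon> using hol[OF that] by (simp add: W_def)
    fix \<tau> assume \<tau>: "\<tau> \<in> W"
    then obtain r where r: "r > 0" "ball \<tau> r \<subseteq> W" using W(1) open_contains_ball by metis
    \<comment> \<open>\<open>A\<close> bounds the modulus of \<open>ln |\<tau>' + \<delta>|\<close> on the disc of radius \<open>s\<close>.\<close>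
    define s where "s = min r 1"
    define A where "A = \<bar>ln c0\<bar> + \<bar>ln (cmod \<tau> + 1 + \<delta>)\<bar>"
    define M where "M = Z * (fourier_weight \<beta> \<mu> m * exp (k1 * A\<^sup>2 / (2 * ln q) + \<alpha> * A))"
    have "cmod (\<psi> \<tau>' m \<epsilon>) \<le> M" if \<tau>': "\<tau>' \<in> ball \<tau> s" and \<epsilon>: "\<epsilon> \<in> B" for \<tau>' \<epsilon>
    proof -
      have \<tau>'W: "\<tau>' \<in> W" using \<tau>' r by (auto simp: s_def)
      define y where "y = cmod (\<tau>' + of_real \<delta>)"
      have y1: "c0 \<le> y" using dist[of \<tau>'] \<tau>'W by (simp add: W_def y_def)
      have "cmod \<tau>' \<le> cmod \<tau> + 1" using \<tau>' norm_triangle_ineq[of \<tau> "\<tau>' - \<tau>"]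
        by (simp add: s_def dist_norm norm_minus_commute)
      then have y2: "y \<le> cmod \<tau> + 1 + \<delta>" using norm_triangle_ineq[of \<tau>' "of_real \<delta>"] \<delta> unfolding y_def by simp
      have "ln c0 \<le> ln y" "ln y \<le> ln (cmod \<tau> + 1 + \<delta>)" using y1 y2 c0 by (auto intro!: ln_mono)
      then have "\<bar>ln y\<bar> \<le> A" by (simp add: A_def)
      then have "(ln y)\<^sup>2 \<le> A\<^sup>2" "ln y \<le> A" by (auto simp: abs_le_square_iff[symmetric])
      then have "k1 * (ln y)\<^sup>2 / (2 * ln q) + \<alpha> * ln y \<le> k1 * A\<^sup>2 / (2 * ln q) + \<alpha> * A"
        using k q \<alpha> by (intro add_mono divide_right_mono mult_left_mono) auto
      then have "Z * (fourier_weight \<beta> \<mu> m * exp (k1 * (ln y)\<^sup>2 / (2 * ln q) + \<alpha> * ln y)) \<le> M"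
        unfolding M_def using Z fourier_weight_nonneg by (intro mult_left_mono) auto
      then show ?thesis using bd[OF \<epsilon>, of \<tau>' m] \<tau>'W unfolding W_def y_def by auto
    qed
    moreover have "0 < s" "ball \<tau> s \<subseteq> W" using r subset_ball[of s r \<tau>] by (auto simp: s_def)
    ultimately show "\<exists>r>0. \<exists>M. ball \<tau> r \<subseteq> W \<and> (\<forall>\<tau>'\<in>ball \<tau> r. \<forall>\<epsilon>\<in>B. cmod (\<psi> \<tau>' m \<epsilon>) \<le> M)" by blast
  qed (use \<tau> \<rho> near0 in \<open>auto simp: W_def\<close>)
  define kern where "kern = laplace_kernel q \<kappa> d (cis d)"
  have km[measurable]: "kern \<in> borel_measurable borel" unfolding kern_def
    using k q by (intro laplace_kernel_measurable) auto
  have kern0: "kern v = 0" if "\<not> 0 < v" for v using that by (simp add: kern_def laplace_kernel_def)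
  define g where "g r m \<epsilon> v = \<psi> (of_real (r * v) * cis d) m \<epsilon> * kern v" for r m \<epsilon> v
  have rep: "psi_k2 q \<kappa> d \<psi> (of_real r * cis d) m \<epsilon> = (\<integral>v. g r m \<epsilon> v \<partial>lborel)" if r: "r > 0" for r m \<epsilon>
    unfolding psi_k2_def q_laplace_eq_kernel g_def kern_def
    using laplace_integral_scale(1)[of q \<kappa> r "cis d" "of_real r * cis d" 0 "\<lambda>r. \<psi> (of_real r * cis d) m \<epsilon>" d] q k r by simp
  have gm: "g r m \<epsilon> \<in> borel_measurable borel" if "\<epsilon> \<in> B" "r > 0" for r m \<epsilon>
  proof -
    have "continuous_on {0<..} (\<lambda>v. \<psi> (of_real (r * v) * cis d) m \<epsilon>)"
    proof (rule continuous_on_compose2[OF cont[OF that(1)]])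
      show "(\<lambda>v. complex_of_real (r * v) * cis d) ` {0<..} \<subseteq> sector d \<theta>"
        using ray that(2) by (auto simp del: of_real_mult)
    qed (intro continuous_intros)
    from borel_measurable_ray[OF this]
    have [measurable]: "(\<lambda>v. if 0 < v then \<psi> (of_real (r * v) * cis d) m \<epsilon> else 0) \<in> borel_measurable borel" .
    have "g r m \<epsilon> = (\<lambda>v. (if 0 < v then \<psi> (of_real (r * v) * cis d) m \<epsilon> else 0) * kern v)"
      using kern0 by (auto simp: g_def)
    also have "\<dots> \<in> borel_measurable borel" by measurable
    finally show ?thesis .
  qed
  have dom: "\<exists>C\<ge>0. \<forall>r m v. \<forall>\<epsilon>\<in>B. 0 < r \<longrightarrow> r \<le> R \<longrightarrow> cmod (g r m \<epsilon> v) \<le> Z * (fourier_weight \<beta> \<mu> m * (C * (1 + \<bar>v\<bar>) powr (- 2)))"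
    if R: "R > 0" for R
  proof -
    obtain C where C: "C \<ge> 0" "\<forall>s v. 0 < s \<longrightarrow> s \<le> R \<longrightarrow> 0 < v \<longrightarrow> c0 \<le> cmod (of_real (s * v) * cis d + of_real \<delta>) \<longrightarrow>
       exp (k1 * (ln (cmod (of_real (s * v) * cis d + of_real \<delta>)))\<^sup>2 / (2 * ln q) + \<alpha> * ln (cmod (of_real (s * v) * cis d + of_real \<delta>)))
         * cmod (kern v) \<le> C * (1 + v) powr (- 2)"
      using first_borel_kernel_dominated[OF q k \<alpha> \<delta> R c0, of d] unfolding kern_def by blast
    have "cmod (g r m \<epsilon> v) \<le> Z * (fourier_weight \<beta> \<mu> m * (C * (1 + \<bar>v\<bar>) powr (- 2)))"
      if "\<epsilon> \<in> B" "0 < r" "r \<le> R" for r m \<epsilon> v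
    proof (cases "0 < v")
      case False
      then show ?thesis using Z C fourier_weight_nonneg by (simp add: g_def kern0)
    next
      case True
      define \<tau> where "\<tau> = of_real (r * v) * cis d"
      have \<tau>: "\<tau> \<in> sector d \<theta>" unfolding \<tau>_def using that True by (intro ray) auto
      define X where "X = exp (k1 * (ln (cmod (\<tau> + of_real \<delta>)))\<^sup>2 / (2 * ln q) + \<alpha> * ln (cmod (\<tau> + of_real \<delta>)))"
      have X: "X * cmod (kern v) \<le> C * (1 + v) powr (- 2)"
        unfolding X_def \<tau>_def by (rule C(2)[rule_format]) (use that True dist[of \<tau>] \<tau> in \<open>auto simp: \<tau>_def\<close>)
      have "cmod (g r m \<epsilon> v) \<le> (Z * (fourier_weight \<beta> \<mu> m * X)) * cmod (kern v)"
        unfolding g_def norm_mult \<tau>_def[symmetric] X_def by (intro mult_right_mono bd that) (use \<tau> in auto)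
      also have "\<dots> = Z * (fourier_weight \<beta> \<mu> m * (X * cmod (kern v)))" by (simp only: mult_ac)
      also have "\<dots> \<le> Z * (fourier_weight \<beta> \<mu> m * (C * (1 + v) powr (- 2)))"
        by (intro mult_left_mono X Z fourier_weight_nonneg)
      finally show ?thesis using True by simp
    qed
    then show ?thesis using C(1) by blast
  qed
  have int2: "integrable lborel (\<lambda>v::real. (1 + \<bar>v\<bar>) powr (- 2))" by (rule integrable_powr_decay) simp
  show "(\<lambda>\<epsilon>. psi_k2 q \<kappa> d \<psi> (of_real r * cis d) m \<epsilon>) holomorphic_on B" if r: "r > 0" for r m
    unfolding rep[OF r]
  proof (rule holomorphic_lebesgue_integral[OF B])
    obtain C where C: "\<And>r' m v \<epsilon>. \<epsilon> \<in> B \<Longrightarrow> 0 < r' \<Longrightarrow> r' \<le> r \<Longrightarrow> cmod (g r' m \<epsilon> v) \<le> Z * (fourier_weight \<beta> \<mu> m * (C * (1 + \<bar>v\<bar>) powr (- 2)))"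
      using dom[OF r] by blast
    fix \<epsilon> assume \<epsilon>: "\<epsilon> \<in> B"
    show "g r m \<epsilon> \<in> borel_measurable lborel" using gm[OF \<epsilon> r] by simp
    obtain e where "e > 0" "ball \<epsilon> e \<subseteq> B" using B \<epsilon> open_contains_ball by metis
    then show "\<exists>e h. 0 < e \<and> ball \<epsilon> e \<subseteq> B \<and> integrable lborel h \<and> (\<forall>w\<in>ball \<epsilon> e. \<forall>v. cmod (g r m w v) \<le> h v)"
      using C r by (intro exI[of _ e] exI[of _ "\<lambda>v. Z * (fourier_weight \<beta> \<mu> m * (C * (1 + \<bar>v\<bar>) powr (- 2)))"])
        (auto intro!: integrable_mult_right int2)
  next
    fix v
    show "(\<lambda>\<epsilon>. g r m \<epsilon> v) holomorphic_on B"
    proof (cases "0 < v")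
      case True
      then have "of_real (r * v) * cis d \<in> W" using ray[of "r * v"] r by (simp add: W_def)
      then show ?thesis unfolding g_def by (intro holomorphic_intros par)
    qed (simp add: g_def kern0)
  qed
  obtain C where C: "C \<ge> 0" "\<And>r m v \<epsilon>. \<epsilon> \<in> B \<Longrightarrow> 0 < r \<Longrightarrow> r \<le> 1 \<Longrightarrow> cmod (g r m \<epsilon> v) \<le> Z * (fourier_weight \<beta> \<mu> m * (C * (1 + \<bar>v\<bar>) powr (- 2)))"
    using dom[of 1] by auto
  define I where "I = (\<integral>v. (1 + \<bar>v\<bar>) powr (- 2) \<partial>lborel :: real)"
  have I: "I \<ge> 0" unfolding I_def by (rule Bochner_Integration.integral_nonneg) simp
  have "cmod (psi_k2 q \<kappa> d \<psi> (of_real r * cis d) m \<epsilon>) \<le> (Z * C * I) * fourier_weight \<beta> \<mu> m"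
    if r: "0 < r" "r \<le> 1" and \<epsilon>: "\<epsilon> \<in> B" for r m \<epsilon>
  proof -
    have i: "integrable lborel (\<lambda>v::real. Z * (fourier_weight \<beta> \<mu> m * (C * (1 + \<bar>v\<bar>) powr (- 2))))"
      by (intro integrable_mult_right int2)
    have gi: "integrable lborel (g r m \<epsilon>)"
      using gm[OF \<epsilon> r(1)] C(2)[OF \<epsilon> r] by (intro Bochner_Integration.integrable_bound[OF i]) (auto intro!: AE_I2 order_trans[OF C(2)[OF \<epsilon> r] abs_ge_self])
    have "cmod (psi_k2 q \<kappa> d \<psi> (of_real r * cis d) m \<epsilon>) \<le> (\<integral>v. cmod (g r m \<epsilon> v) \<partial>lborel)"
      unfolding rep[OF r(1)] by (rule integral_norm_bound)
    also have "\<dots> \<le> (\<integral>v. Z * (fourier_weight \<beta> \<mu> m * (C * (1 + \<bar>v\<bar>) powr (- 2))) \<partial>lborel)"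
      by (rule integral_mono[OF integrable_norm[OF gi] i C(2)[OF \<epsilon> r]])
    also have "\<dots> = (Z * C * I) * fourier_weight \<beta> \<mu> m"
      unfolding integral_mult_right_zero I_def by (simp only: mult_ac)
    finally show ?thesis .
  qed
  moreover have "Z * C * I \<ge> 0" using Z C I by simp
  ultimately show "\<exists>K\<ge>0. \<forall>r m. \<forall>\<epsilon>\<in>B. 0 < r \<longrightarrow> r \<le> 1 \<longrightarrow>
          cmod (psi_k2 q \<kappa> d \<psi> (of_real r * cis d) m \<epsilon>) \<le> K * fourier_weight \<beta> \<mu> m" by blast
qed

section \<open>q-Laplace and Fourier transform of a family on the ray\<close>

lemma Fubini_swap_dominated:
  fixes f :: "real \<Rightarrow> real \<Rightarrow> complex"
  assumes m: "case_prod f \<in> borel_measurable (borel \<Otimes>\<^sub>M borel)"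
    and ab: "integrable lborel a" "integrable lborel b" and le: "\<And>x y. cmod (f x y) \<le> a x * b y"
  shows "(\<integral>x. (\<integral>y. f x y \<partial>lborel) \<partial>lborel) = (\<integral>y. (\<integral>x. f x y \<partial>lborel) \<partial>lborel)"
    and "integrable lborel (\<lambda>y. \<integral>x. f x y \<partial>lborel)"
proof -
  have fx: "f x \<in> borel_measurable borel" for x
    using measurable_compose[OF measurable_Pair1' m, of x] by simp
  have fy: "(\<lambda>x. f x y) \<in> borel_measurable borel" for y
    using measurable_compose[OF measurable_Pair2' m, of y] by simp
  have ix: "integrable lborel (f x)" for x
    by (rule Bochner_Integration.integrable_bound[OF integrable_mult_right[OF ab(2), of "a x"]])
      (use fx in \<open>auto intro!: AE_I2 order_trans[OF le abs_ge_self]\<close>)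
  have iy: "integrable lborel (\<lambda>x. f x y)" for y
    by (rule Bochner_Integration.integrable_bound[OF integrable_mult_left[OF ab(1), of "b y"]])
      (use fy in \<open>auto intro!: AE_I2 order_trans[OF le abs_ge_self]\<close>)
  show "(\<integral>x. (\<integral>y. f x y \<partial>lborel) \<partial>lborel) = (\<integral>y. (\<integral>x. f x y \<partial>lborel) \<partial>lborel)"
  proof (rule Fubini_swap_lborel[OF m ix])
    show "integrable lborel (\<lambda>x. a x * integral\<^sup>L lborel b)" by (intro integrable_mult_left ab)
    show "(\<integral>y. cmod (f x y) \<partial>lborel) \<le> a x * integral\<^sup>L lborel b" for x
      using integral_mono[OF integrable_norm[OF ix] integrable_mult_right[OF ab(2), of "a x"] le] by simp
  qed
  show "integrable lborel (\<lambda>y. \<integral>x. f x y \<partial>lborel)"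
  proof (rule Bochner_Integration.integrable_bound[OF integrable_mult_right[OF ab(2), of "integral\<^sup>L lborel a"]])
    have "(\<lambda>(y, x). f x y) \<in> borel_measurable (borel \<Otimes>\<^sub>M lborel)"
      unfolding case_prod_unfold by (rule borel_measurable_pair_compose[OF m]) measurable
    then show "(\<lambda>y. \<integral>x. f x y \<partial>lborel) \<in> borel_measurable lborel"
      using lborel.borel_measurable_lebesgue_integral[of "\<lambda>y x. f x y" borel] by simp
    show "AE y in lborel. norm (\<integral>x. f x y \<partial>lborel) \<le> norm (integral\<^sup>L lborel a * b y)"
    proof (rule AE_I2)
      fix y
      have "norm (\<integral>x. f x y \<partial>lborel) \<le> (\<integral>x. cmod (f x y) \<partial>lborel)" by (rule integral_norm_bound)
      also have "\<dots> \<le> (\<integral>x. a x * b y \<partial>lborel)"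
        by (rule integral_mono[OF integrable_norm[OF iy] integrable_mult_left[OF ab(1)] le])
      also have "\<dots> = integral\<^sup>L lborel a * b y" by simp
      finally show "norm (\<integral>x. f x y \<partial>lborel) \<le> norm (integral\<^sup>L lborel a * b y)" by simp
    qed
  qed
qed

lemma fourier_weight_le_exp: "\<mu> \<ge> 0 \<Longrightarrow> fourier_weight \<beta> \<mu> m \<le> exp (- \<beta> * \<bar>m\<bar>)"
proof -
  assume "\<mu> \<ge> 0"
  then have "(1 + \<bar>m\<bar>) powr (- \<mu>) \<le> (1 + \<bar>m\<bar>) powr 0" by (intro powr_mono) auto
  moreover have "1 + \<bar>m\<bar> \<noteq> 0" by linarith
  ultimately show ?thesis unfolding fourier_weight_def
    using mult_right_mono[of "(1 + \<bar>m\<bar>) powr (- \<mu>)" 1 "exp (- \<beta> * \<bar>m\<bar>)"] by simp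
qed

lemma exp_decay_fourier_weight:
  assumes "h \<in> borel_measurable borel" "\<And>m. cmod (h m) \<le> K * fourier_weight \<beta> \<mu> m" "\<mu> \<ge> 0" "K \<ge> 0"
  shows "exp_decay \<beta> h"
  unfolding exp_decay_def
proof (intro conjI exI[of _ K] exI[of _ 0] allI assms(1))
  show "cmod (h m) \<le> K * (1 + \<bar>m\<bar>) ^ 0 * exp (- \<beta> * \<bar>m\<bar>)" for m
    using assms(2)[of m] mult_left_mono[OF fourier_weight_le_exp[OF assms(3), of \<beta> m] assms(4)] by simp
qed

lemma fourier_weight_kernel_bound:
  assumes "cmod h \<le> K * fourier_weight \<beta> \<mu> m" "K \<ge> 0" "z \<in> strip \<beta>"
  shows "cmod (h * exp (\<i> * z * of_real m)) \<le> K * (1 + \<bar>m\<bar>) powr (- \<mu>)"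
proof -
  have "- (Im z * m) \<le> \<beta> * \<bar>m\<bar>"
    using mult_right_mono[of "\<bar>Im z\<bar>" \<beta> "\<bar>m\<bar>"] abs_ge_minus_self[of "Im z * m"] assms(3)
    by (simp add: strip_def abs_mult)
  then have e: "cmod (exp (\<i> * z * of_real m)) \<le> exp (\<beta> * \<bar>m\<bar>)" by simp
  have "cmod (h * exp (\<i> * z * of_real m)) \<le> (K * fourier_weight \<beta> \<mu> m) * exp (\<beta> * \<bar>m\<bar>)"
    unfolding norm_mult using assms(2) fourier_weight_nonneg by (intro mult_mono e assms(1)) auto
  also have "\<dots> = K * (1 + \<bar>m\<bar>) powr (- \<mu>)"
    by (simp add: fourier_weight_def mult.assoc exp_add[symmetric])
  finally show ?thesis .
qed

lemma exp_decay_convolution: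
  assumes \<beta>: "\<beta> \<ge> 0" and \<mu>: "\<mu> - real n > 1" and K: "K \<ge> 0" "K' \<ge> 0"
    and f: "f \<in> borel_measurable borel" "\<And>m. cmod (f m) \<le> K * fourier_weight \<beta> \<mu> m"
    and g: "g \<in> borel_measurable borel" "\<And>m. cmod (g m) \<le> K' * ((1 + \<bar>m\<bar>) ^ n * fourier_weight \<beta> \<mu> m)"
  shows "exp_decay \<beta> (\<lambda>m. \<integral>x. f (m - x) * g x \<partial>lborel)"
proof -
  define a where "a = \<mu> - real n"
  have a: "a > 1" using \<mu> by (simp add: a_def)
  have i: "integrable lborel (\<lambda>x::real. (1 + \<bar>x\<bar>) powr (- a))" by (rule integrable_powr_decay[OF a])
  have i2: "integrable lborel (\<lambda>x::real. (1 + \<bar>m - x\<bar>) powr (- a))" for m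
    using lborel_integrable_real_affine[OF i, of "-1" m] by simp
  define H where "H = (\<integral>x. (1 + \<bar>x\<bar>) powr (- a) \<partial>lborel :: real)"
  have e2: "(\<integral>x. (1 + \<bar>m - x\<bar>) powr (- a) \<partial>lborel) = H" for m
    unfolding H_def using lborel_integral_real_affine[of "-1" "\<lambda>x. (1 + \<bar>x\<bar>) powr (- a)" m] by simp
  note [measurable] = f(1) g(1)
  have bd: "cmod (f (m - x) * g x) \<le> (K * K') * (2 powr a * ((1 + \<bar>m\<bar>) ^ n * fourier_weight \<beta> \<mu> m)) * ((1 + \<bar>m - x\<bar>) powr (- a) + (1 + \<bar>x\<bar>) powr (- a))" for m x
  proof -
    have p: "(1 + \<bar>x\<bar>) powr real n = (1 + \<bar>x\<bar>) ^ n" for x :: real by (simp add: powr_realpow add_pos_nonneg)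
    have "cmod (f (m - x) * g x) \<le> (K * fourier_weight \<beta> \<mu> (m - x)) * (K' * ((1 + \<bar>x\<bar>) ^ n * fourier_weight \<beta> \<mu> x))"
      unfolding norm_mult using K fourier_weight_nonneg by (intro mult_mono f g) auto
    also have "\<dots> = (K * K') * (fourier_weight \<beta> \<mu> (m - x) * ((1 + \<bar>x\<bar>) powr real n * fourier_weight \<beta> \<mu> x))"
      unfolding p by (simp only: mult_ac)
    also have "\<dots> \<le> (K * K') * (2 powr (\<mu> - real n) * ((1 + \<bar>m\<bar>) powr real n * fourier_weight \<beta> \<mu> m)
         * ((1 + \<bar>m - x\<bar>) powr (- (\<mu> - real n)) + (1 + \<bar>x\<bar>) powr (- (\<mu> - real n))))"
      using \<mu> K by (intro mult_left_mono fourier_weight_convolution \<beta>) auto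
    finally show ?thesis unfolding p a_def by (simp only: mult.assoc)
  qed
  have "cmod (\<integral>x. f (m - x) * g x \<partial>lborel) \<le> (K * K' * 2 powr a * (2 * H)) * (1 + \<bar>m\<bar>) ^ n * exp (- \<beta> * \<bar>m\<bar>)" for m
  proof -
    have j: "integrable lborel (\<lambda>x. (K * K') * (2 powr a * ((1 + \<bar>m\<bar>) ^ n * fourier_weight \<beta> \<mu> m)) * ((1 + \<bar>m - x\<bar>) powr (- a) + (1 + \<bar>x\<bar>) powr (- a)))"
      by (intro integrable_mult_right Bochner_Integration.integrable_add i i2)
    have k: "integrable lborel (\<lambda>x. f (m - x) * g x)"
    proof (rule Bochner_Integration.integrable_bound[OF j])
      show "AE x in lborel. norm (f (m - x) * g x) \<le> norm ((K * K') * (2 powr a * ((1 + \<bar>m\<bar>) ^ n * fourier_weight \<beta> \<mu> m)) * ((1 + \<bar>m - x\<bar>) powr (- a) + (1 + \<bar>x\<bar>) powr (- a)))"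
        unfolding real_norm_def by (intro AE_I2 order_trans[OF bd abs_ge_self])
    qed measurable
    have "cmod (\<integral>x. f (m - x) * g x \<partial>lborel) \<le> (\<integral>x. cmod (f (m - x) * g x) \<partial>lborel)" by (rule integral_norm_bound)
    also have "\<dots> \<le> (\<integral>x. (K * K') * (2 powr a * ((1 + \<bar>m\<bar>) ^ n * fourier_weight \<beta> \<mu> m)) * ((1 + \<bar>m - x\<bar>) powr (- a) + (1 + \<bar>x\<bar>) powr (- a)) \<partial>lborel)"
      by (rule integral_mono[OF integrable_norm[OF k] j bd])
    also have "\<dots> = (K * K') * (2 powr a * ((1 + \<bar>m\<bar>) ^ n * fourier_weight \<beta> \<mu> m)) * (2 * H)"
      unfolding integral_mult_right_zero by (subst Bochner_Integration.integral_add[OF i2 i]) (simp only: e2 H_def[symmetric], simp)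
    also have "\<dots> = (K * K' * 2 powr a * (2 * H)) * (1 + \<bar>m\<bar>) ^ n * fourier_weight \<beta> \<mu> m" by (simp only: mult_ac)
    also have "\<dots> \<le> (K * K' * 2 powr a * (2 * H)) * (1 + \<bar>m\<bar>) ^ n * exp (- \<beta> * \<bar>m\<bar>)"
    proof (intro mult_left_mono fourier_weight_le_exp)
      have "0 \<le> H" unfolding H_def by (rule Bochner_Integration.integral_nonneg) simp
      then show "0 \<le> K * K' * 2 powr a * (2 * H) * (1 + \<bar>m\<bar>) ^ n" using K by simp
      show "0 \<le> \<mu>" using \<mu> by linarith
    qed
    finally show ?thesis .
  qed
  moreover have "(\<lambda>m. \<integral>x. f (m - x) * g x \<partial>lborel) \<in> borel_measurable borel" by measurable
  ultimately show ?thesis unfolding exp_decay_def by blast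
qed

text \<open>\<open>b\<close> is a bound for \<open>|T|\<close>; the condition on it is the one under which the Laplace integral of a function
  of size \<open>ray_weight\<close> converges.\<close>

locale laplace_family =
  fixes q k \<nu> \<beta> \<mu> d \<delta> b K :: real and B :: "complex set" and w :: "real \<Rightarrow> real \<Rightarrow> complex \<Rightarrow> complex"
  assumes q: "q > 1" and k: "k > 0" and \<delta>: "\<delta> > 0" and b: "b > 0" "ln b < (1/2 - \<nu>) * ln q / k"
    and \<mu>: "\<mu> > 1" and B: "open B"
    and family: "dominated_family B (ray_weight q k \<nu>) (fourier_weight \<beta> \<mu>) K w" and K: "K \<ge> 0"
begin

definition kern :: "complex \<Rightarrow> real \<Rightarrow> complex" where
  "kern T = laplace_kernel q k d T"

definition U :: "complex \<Rightarrow> real \<Rightarrow> complex \<Rightarrow> complex" where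
  "U T m \<epsilon> = (\<integral>r. w r m \<epsilon> * kern T r \<partial>lborel)"

definition region :: "complex set" where
  "region = {T \<in> R_dom d \<delta>. cmod T \<le> b}"

lemma region_nonzero: "T \<in> region \<Longrightarrow> T \<noteq> 0"
  by (simp add: region_def R_dom_def)

lemma kern_measurable: "T \<in> region \<Longrightarrow> kern T \<in> borel_measurable borel"
  unfolding kern_def by (intro laplace_kernel_measurable q k region_nonzero)

text \<open>One dominating function serves all \<open>T\<close> of the region that stay away from the origin. All local uniform
  statements below rest on it.\<close>

lemma kern_dominated:
  assumes "a > 0"
  shows "\<exists>g. integrable lborel g \<and> (\<forall>r. 0 \<le> g r) \<and>
     (\<forall>T\<in>region. a \<le> cmod T \<longrightarrow> (\<forall>r. ray_weight q k \<nu> r * cmod (kern T r) \<le> g r))"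
proof -
  obtain c \<eta> where c: "0 < c \<and> 0 < \<eta> \<and> (\<forall>T\<in>R_dom d \<delta>. a \<le> cmod T \<longrightarrow> cmod T \<le> b \<longrightarrow>
     (\<forall>r>0. ray_weight q k \<nu> r * cmod (laplace_kernel q k d T r) \<le> c * (1 + r) powr (- (1 + \<eta>))))"
    using laplace_kernel_bound[OF q k \<delta> assms b, of d] by (elim exE)
  show ?thesis
  proof (intro exI[of _ "\<lambda>r. c * (1 + \<bar>r\<bar>) powr (- (1 + \<eta>))"] conjI ballI impI allI)
    show "integrable lborel (\<lambda>r. c * (1 + \<bar>r\<bar>) powr (- (1 + \<eta>)))"
      using c by (intro integrable_mult_right integrable_powr_decay) auto
    show "0 \<le> c * (1 + \<bar>r\<bar>) powr (- (1 + \<eta>))" for r using c by simp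
    fix T r assume T: "T \<in> region" "a \<le> cmod T"
    show "ray_weight q k \<nu> r * cmod (kern T r) \<le> c * (1 + \<bar>r\<bar>) powr (- (1 + \<eta>))"
    proof (cases "0 < r")
      case True
      then show ?thesis using c T unfolding region_def kern_def by auto
    next
      case False
      then show ?thesis using c by (simp add: kern_def laplace_kernel_def)
    qed
  qed
qed

lemma integrand_bound:
  assumes "ray_weight q k \<nu> r * cmod (kern T r) \<le> g" "\<epsilon> \<in> B"
  shows "cmod (w r m \<epsilon> * kern T r) \<le> K * fourier_weight \<beta> \<mu> m * g"
proof -
  have "cmod (w r m \<epsilon> * kern T r) \<le> K * (ray_weight q k \<nu> r * fourier_weight \<beta> \<mu> m) * cmod (kern T r)"
    unfolding norm_mult by (intro mult_right_mono dominated_familyD(3)[OF family assms(2)]) auto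
  also have "\<dots> = K * fourier_weight \<beta> \<mu> m * (ray_weight q k \<nu> r * cmod (kern T r))" by (simp only: mult_ac)
  also have "\<dots> \<le> K * fourier_weight \<beta> \<mu> m * g"
    using K fourier_weight_nonneg by (intro mult_left_mono assms) auto
  finally show ?thesis .
qed

lemma w_measurable: "\<epsilon> \<in> B \<Longrightarrow> (\<lambda>r. w r m \<epsilon>) \<in> borel_measurable borel"
  using borel_measurable_pair_compose[OF dominated_familyD(1)[OF family], of _ "\<lambda>r. r" borel "\<lambda>_. m"] by simp

lemma integrand_integrable:
  assumes T: "T \<in> region" and \<epsilon>: "\<epsilon> \<in> B"
  shows "integrable lborel (\<lambda>r. w r m \<epsilon> * kern T r)"
proof -
  obtain g where g: "integrable lborel g" "\<And>r. ray_weight q k \<nu> r * cmod (kern T r) \<le> g r"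
    using kern_dominated[of "cmod T"] region_nonzero[OF T] T by auto
  note [measurable] = w_measurable[OF \<epsilon>] kern_measurable[OF T]
  show ?thesis
  proof (rule Bochner_Integration.integrable_bound)
    show "integrable lborel (\<lambda>r. K * fourier_weight \<beta> \<mu> m * g r)" by (intro integrable_mult_right g)
    show "AE r in lborel. norm (w r m \<epsilon> * kern T r) \<le> norm (K * fourier_weight \<beta> \<mu> m * g r)"
      unfolding real_norm_def by (intro AE_I2 order_trans[OF integrand_bound[OF g(2) \<epsilon>] abs_ge_self])
  qed measurable
qed

lemma U_bound:
  assumes a: "a > 0"
  shows "\<exists>C\<ge>0. \<forall>T\<in>region. a \<le> cmod T \<longrightarrow> (\<forall>m. \<forall>\<epsilon>\<in>B. cmod (U T m \<epsilon>) \<le> C * fourier_weight \<beta> \<mu> m)"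
proof -
  obtain g where g: "integrable lborel g" "\<And>r. 0 \<le> g r" "\<And>T r. T \<in> region \<Longrightarrow> a \<le> cmod T \<Longrightarrow> ray_weight q k \<nu> r * cmod (kern T r) \<le> g r"
    using kern_dominated[OF a] by blast
  have "cmod (U T m \<epsilon>) \<le> (K * integral\<^sup>L lborel g) * fourier_weight \<beta> \<mu> m" if T: "T \<in> region" "a \<le> cmod T" and \<epsilon>: "\<epsilon> \<in> B" for T m \<epsilon>
  proof -
    have "cmod (U T m \<epsilon>) \<le> (\<integral>r. cmod (w r m \<epsilon> * kern T r) \<partial>lborel)" unfolding U_def by (rule integral_norm_bound)
    also have "\<dots> \<le> (\<integral>r. K * fourier_weight \<beta> \<mu> m * g r \<partial>lborel)"
      by (rule integral_mono[OF integrable_norm[OF integrand_integrable[OF T(1) \<epsilon>]] integrable_mult_right[OF g(1)] integrand_bound[OF g(3)[OF T] \<epsilon>]])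
    also have "\<dots> = (K * integral\<^sup>L lborel g) * fourier_weight \<beta> \<mu> m" by simp
    finally show ?thesis .
  qed
  moreover have "K * integral\<^sup>L lborel g \<ge> 0" using K g(2) by (simp add: Bochner_Integration.integral_nonneg)
  ultimately show ?thesis by blast
qed

lemma U_measurable:
  assumes T: "T \<in> region" and \<epsilon>: "\<epsilon> \<in> B"
  shows "(\<lambda>m. U T m \<epsilon>) \<in> borel_measurable borel"
proof -
  note [measurable] = kern_measurable[OF T]
  have [measurable]: "(\<lambda>p. w (snd p) (fst p) \<epsilon>) \<in> borel_measurable (borel \<Otimes>\<^sub>M lborel)"
    by (rule borel_measurable_pair_compose[OF dominated_familyD(1)[OF family \<epsilon>]]) measurable
  have "(\<lambda>(m, r). w r m \<epsilon> * kern T r) \<in> borel_measurable (borel \<Otimes>\<^sub>M lborel)"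
    unfolding case_prod_unfold by measurable
  from lborel.borel_measurable_lebesgue_integral[OF this] show ?thesis unfolding U_def .
qed

lemma U_exp_decay:
  assumes T: "T \<in> region" and \<epsilon>: "\<epsilon> \<in> B"
  shows "exp_decay \<beta> (\<lambda>m. U T m \<epsilon>)"
proof -
  obtain C where "C \<ge> 0" "\<And>m. cmod (U T m \<epsilon>) \<le> C * fourier_weight \<beta> \<mu> m"
    using U_bound[of "cmod T"] region_nonzero[OF T] T \<epsilon> by auto
  then show ?thesis using \<mu> by (intro exp_decay_fourier_weight[OF U_measurable[OF T \<epsilon>], where K=C and \<mu>=\<mu>]) auto
qed

text \<open>Stated for an abstract curve \<open>x \<mapsto> (T, \<epsilon>)\<close>, as \<open>U\<close> is later needed as a function of \<open>t\<close> and,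
  with both arguments varying, of \<open>\<epsilon>\<close>.\<close>

lemma U_holomorphic:
  assumes X: "open X" and Tf: "Tf holomorphic_on X" and ef: "ef holomorphic_on X" and a: "a > 0"
    and reg: "\<And>x. x \<in> X \<Longrightarrow> Tf x \<in> region" "\<And>x. x \<in> X \<Longrightarrow> a \<le> cmod (Tf x)" "\<And>x. x \<in> X \<Longrightarrow> ef x \<in> B"
  shows "(\<lambda>x. U (Tf x) m (ef x)) holomorphic_on X"
  unfolding U_def
proof (rule holomorphic_lebesgue_integral[OF X])
  obtain g where g: "integrable lborel g" "\<And>T r. T \<in> region \<Longrightarrow> a \<le> cmod T \<Longrightarrow> ray_weight q k \<nu> r * cmod (kern T r) \<le> g r"
    using kern_dominated[OF a] by blast
  fix x assume x: "x \<in> X"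
  show "(\<lambda>r. w r m (ef x) * kern (Tf x) r) \<in> borel_measurable lborel"
    using integrand_integrable[OF reg(1,3)[OF x]] by (rule borel_measurable_integrable)
  obtain e where e: "e > 0" "ball x e \<subseteq> X" using X x open_contains_ball by metis
  have "cmod (w r m (ef y) * kern (Tf y) r) \<le> K * fourier_weight \<beta> \<mu> m * g r" if "y \<in> ball x e" for y r
    using e that by (intro integrand_bound g reg) auto
  then show "\<exists>e h. 0 < e \<and> ball x e \<subseteq> X \<and> integrable lborel h \<and> (\<forall>y\<in>ball x e. \<forall>r. cmod (w r m (ef y) * kern (Tf y) r) \<le> h r)"
    using e g(1) by (intro exI[of _ e] exI[of _ "\<lambda>r. K * fourier_weight \<beta> \<mu> m * g r"]) auto
next
  fix r
  have wh: "(\<lambda>x. w r m (ef x)) holomorphic_on X"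
    using holomorphic_on_compose_gen[OF ef dominated_familyD(2)[OF family, of r m]] reg(3) by (auto simp: o_def)
  show "(\<lambda>x. w r m (ef x) * kern (Tf x) r) holomorphic_on X"
  proof (cases "0 < r")
    case True
    obtain c where c: "c > 0" "\<And>x. x \<noteq> 0 \<Longrightarrow> (\<forall>r\<ge>0. \<delta> \<le> cmod (1 + of_real r * x)) \<Longrightarrow>
       c * exp (k * (ln (cmod x))\<^sup>2 / (2 * ln q) + ln (cmod x) / 2) \<le> cmod (jacobi_theta q k x)"
      using jacobi_theta_lower_bound[OF q k \<delta>] by blast
    have nz: "jacobi_theta q k (of_real r * cis d / Tf x) \<noteq> 0" if x: "x \<in> X" for x
    proof -
      have "Tf x \<noteq> 0" using region_nonzero reg(1)[OF x] by blast
      then have "of_real r * cis d / Tf x \<noteq> 0" using True by simp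
      from c(2)[OF this R_dom_cone[OF _ True]] reg(1)[OF x] show ?thesis
        using c(1) unfolding region_def by (smt (verit, best) exp_gt_zero mem_Collect_eq mult_pos_pos norm_zero)
    qed
    have "(\<lambda>x. jacobi_theta q k (of_real r * cis d / Tf x)) holomorphic_on X"
    proof -
      have "(\<lambda>x. of_real r * cis d / Tf x) holomorphic_on X"
        by (intro holomorphic_intros Tf) (use region_nonzero reg(1) in blast)
      moreover have "(\<lambda>x. of_real r * cis d / Tf x) ` X \<subseteq> - {0}"
        using True region_nonzero reg(1) by fastforce
      ultimately show ?thesis
        using holomorphic_on_compose_gen[OF _ jacobi_theta_holomorphic[OF q k]] by (auto simp: o_def)
    qed
    moreover have "(\<lambda>x. kern (Tf x) r) = (\<lambda>x. inverse (of_real (pi_q q k)) * inverse (of_real r) * inverse (jacobi_theta q k (of_real r * cis d / Tf x)))"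
      using True by (simp add: kern_def laplace_kernel_def divide_inverse mult_ac)
    ultimately have "(\<lambda>x. kern (Tf x) r) holomorphic_on X"
      using nz by (simp only:) (intro holomorphic_on_mult holomorphic_on_inverse holomorphic_on_const, auto)
    then show ?thesis by (rule holomorphic_on_mult[OF wh])
  next
    case False
    then show ?thesis by (simp add: kern_def laplace_kernel_def)
  qed
qed

definition u :: "complex \<Rightarrow> complex \<Rightarrow> complex \<Rightarrow> complex" where
  "u t z \<epsilon> = inv_fourier (\<lambda>m. U (\<epsilon> * t) m \<epsilon>) z"

lemma inv_fourier_U_holomorphic:
  assumes X: "open X" and Tf: "Tf holomorphic_on X" and ef: "ef holomorphic_on X" and a: "a > 0"
    and reg: "\<And>x. x \<in> X \<Longrightarrow> Tf x \<in> region" "\<And>x. x \<in> X \<Longrightarrow> a \<le> cmod (Tf x)" "\<And>x. x \<in> X \<Longrightarrow> ef x \<in> B"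
    and z: "z \<in> strip \<beta>"
  shows "(\<lambda>x. inv_fourier (\<lambda>m. U (Tf x) m (ef x)) z) holomorphic_on X"
proof -
  have "(\<lambda>x. \<integral>m. U (Tf x) m (ef x) * exp (\<i> * z * of_real m) \<partial>lborel) holomorphic_on X"
  proof (rule holomorphic_lebesgue_integral[OF X])
    obtain C where C: "C \<ge> 0" "\<And>T m \<epsilon>. T\<in>region \<Longrightarrow> a \<le> cmod T \<Longrightarrow> \<epsilon>\<in>B \<Longrightarrow> cmod (U T m \<epsilon>) \<le> C * fourier_weight \<beta> \<mu> m"
      using U_bound[OF a] by blast
    fix x assume x: "x \<in> X"
    show "(\<lambda>m. U (Tf x) m (ef x) * exp (\<i> * z * of_real m)) \<in> borel_measurable lborel"
      using exp_decay_integrable[OF U_exp_decay[OF reg(1,3)[OF x]] z] by (rule borel_measurable_integrable)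
    obtain e where e: "e > 0" "ball x e \<subseteq> X" using X x open_contains_ball by metis
    have "cmod (U (Tf y) m (ef y) * exp (\<i> * z * of_real m)) \<le> C * (1 + \<bar>m\<bar>) powr (- \<mu>)" if "y \<in> ball x e" for y m
      by (rule fourier_weight_kernel_bound[OF C(2) C(1) z]) (use e that reg in auto)
    then show "\<exists>e h. 0 < e \<and> ball x e \<subseteq> X \<and> integrable lborel h \<and> (\<forall>y\<in>ball x e. \<forall>m. cmod (U (Tf y) m (ef y) * exp (\<i> * z * of_real m)) \<le> h m)"
      using e by (intro exI[of _ e] exI[of _ "\<lambda>m. C * (1 + \<bar>m\<bar>) powr (- \<mu>)"]) (auto intro!: integrable_mult_right integrable_powr_decay \<mu>)
  next
    fix m
    have "(\<lambda>x. U (Tf x) m (ef x)) holomorphic_on X" by (rule U_holomorphic[OF X Tf ef a reg])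
    then show "(\<lambda>x. U (Tf x) m (ef x) * exp (\<i> * z * of_real m)) holomorphic_on X"
      by (rule holomorphic_on_mult[OF _ holomorphic_on_const])
  qed
  then show ?thesis unfolding inv_fourier_def by (rule holomorphic_on_divide[OF _ holomorphic_on_const]) simp
qed

lemma inv_fourier_U_bound:
  assumes a: "a > 0"
  shows "\<exists>M. \<forall>T\<in>region. a \<le> cmod T \<longrightarrow> (\<forall>\<epsilon>\<in>B. \<forall>z\<in>strip \<beta>. cmod (inv_fourier (\<lambda>m. U T m \<epsilon>) z) \<le> M)"
proof -
  obtain C where C: "C \<ge> 0" "\<And>T m \<epsilon>. T\<in>region \<Longrightarrow> a \<le> cmod T \<Longrightarrow> \<epsilon>\<in>B \<Longrightarrow> cmod (U T m \<epsilon>) \<le> C * fourier_weight \<beta> \<mu> m"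
    using U_bound[OF a] by blast
  have i: "integrable lborel (\<lambda>m::real. C * (1 + \<bar>m\<bar>) powr (- \<mu>))" by (intro integrable_mult_right integrable_powr_decay \<mu>)
  have "cmod (inv_fourier (\<lambda>m. U T m \<epsilon>) z) \<le> (\<integral>m. C * (1 + \<bar>m\<bar>) powr (- \<mu>) \<partial>lborel) / sqrt (2 * pi)"
    if T: "T \<in> region" "a \<le> cmod T" and \<epsilon>: "\<epsilon> \<in> B" and z: "z \<in> strip \<beta>" for T \<epsilon> z
  proof -
    have "cmod (\<integral>m. U T m \<epsilon> * exp (\<i> * z * of_real m) \<partial>lborel) \<le> (\<integral>m. cmod (U T m \<epsilon> * exp (\<i> * z * of_real m)) \<partial>lborel)"
      by (rule integral_norm_bound)
    also have "\<dots> \<le> (\<integral>m. C * (1 + \<bar>m\<bar>) powr (- \<mu>) \<partial>lborel)"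
      by (rule integral_mono[OF integrable_norm[OF exp_decay_integrable[OF U_exp_decay[OF T(1) \<epsilon>] z]] i fourier_weight_kernel_bound[OF C(2)[OF T \<epsilon>] C(1) z]])
    finally have "cmod (\<integral>m. U T m \<epsilon> * exp (\<i> * z * of_real m) \<partial>lborel) / sqrt (2 * pi) \<le> (\<integral>m. C * (1 + \<bar>m\<bar>) powr (- \<mu>) \<partial>lborel) / sqrt (2 * pi)"
      by (rule divide_right_mono) simp
    then show ?thesis unfolding inv_fourier_def norm_divide norm_of_real by simp
  qed
  then show ?thesis by blast
qed

text \<open>Near any point, \<open>\<epsilon> t\<close> stays away from the origin, so the uniform bounds apply and Osgood's lemma gives
  joint differentiability from holomorphy in each variable.\<close>

lemma u_holomorphic3:
  assumes TT: "open TT" and E: "open E" "E \<subseteq> B" and reg: "\<And>t \<epsilon>. t \<in> TT \<Longrightarrow> \<epsilon> \<in> E \<Longrightarrow> \<epsilon> * t \<in> region" and \<beta>': "\<beta>' \<le> \<beta>"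
  shows "holomorphic3_on u (TT \<times> strip \<beta>' \<times> E)"
  unfolding holomorphic3_on_def
proof (intro ballI)
  fix x assume "x \<in> TT \<times> strip \<beta>' \<times> E"
  then obtain t z \<epsilon> where x: "x = (t, z, \<epsilon>)" "t \<in> TT" "z \<in> strip \<beta>'" "\<epsilon> \<in> E" by auto
  have sub: "strip \<beta>' \<subseteq> strip \<beta>" using \<beta>' by (auto simp: strip_def)
  have nz: "t \<noteq> 0" "\<epsilon> \<noteq> 0" using region_nonzero[OF reg[OF x(2,4)]] by auto
  obtain r1 where r1: "r1 > 0" "ball t r1 \<subseteq> TT" using TT x open_contains_ball by metis
  obtain r2 where r2: "r2 > 0" "ball z r2 \<subseteq> strip \<beta>'" using open_strip x open_contains_ball by metis
  obtain r3 where r3: "r3 > 0" "ball \<epsilon> r3 \<subseteq> E" using E x open_contains_ball by metis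
  define r where "r = min (min r1 r2) (min r3 (min (cmod t / 2) (cmod \<epsilon> / 2)))"
  have r: "r > 0" using r1 r2 r3 nz by (simp add: r_def)
  have rle: "r \<le> r1" "r \<le> r2" "r \<le> r3" "r \<le> cmod t / 2" "r \<le> cmod \<epsilon> / 2" by (simp_all add: r_def)
  have bt: "ball t r \<subseteq> TT" using subset_ball[OF rle(1)] r1(2) by (rule subset_trans)
  have bz: "ball z r \<subseteq> strip \<beta>" using subset_trans[OF subset_ball[OF rle(2)] r2(2)] sub by (rule subset_trans)
  have be: "ball \<epsilon> r \<subseteq> E" using subset_ball[OF rle(3)] r3(2) by (rule subset_trans)
  define a where "a = cmod t / 2 * (cmod \<epsilon> / 2)"
  have a: "a > 0" using nz by (simp add: a_def)
  have low: "a \<le> cmod (e * s)" if "s \<in> ball t r" "e \<in> ball \<epsilon> r" for s e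
  proof -
    have "cmod t / 2 \<le> cmod s" "cmod \<epsilon> / 2 \<le> cmod e"
      using that norm_triangle_ineq2[of t "t - s"] norm_triangle_ineq2[of \<epsilon> "\<epsilon> - e"] rle(4,5) by (simp_all add: dist_norm)
    then show ?thesis unfolding a_def norm_mult by (subst mult.commute, intro mult_mono) auto
  qed
  have rg: "e * s \<in> region" if "s \<in> ball t r" "e \<in> ball \<epsilon> r" for s e using that bt be reg by blast
  obtain M where M: "\<And>T \<epsilon> z. T\<in>region \<Longrightarrow> a \<le> cmod T \<Longrightarrow> \<epsilon>\<in>B \<Longrightarrow> z\<in>strip \<beta> \<Longrightarrow> cmod (inv_fourier (\<lambda>m. U T m \<epsilon>) z) \<le> M"
    using inv_fourier_U_bound[OF a] by blast
  have "\<exists>A C D. ((\<lambda>(t,z,\<epsilon>). u t z \<epsilon>) has_derivative (\<lambda>(v,w,e). A * v + C * w + D * e)) (at (t,z,\<epsilon>))"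
  proof (rule osgood_has_derivative[OF r])
    show "(\<lambda>s. u s z' e) holomorphic_on ball t r" if "z' \<in> ball z r" "e \<in> ball \<epsilon> r" for z' e
      unfolding u_def
      by (rule inv_fourier_U_holomorphic[OF open_ball _ _ a]) (use that low rg bz be E in \<open>auto intro!: holomorphic_intros\<close>)
    show "(\<lambda>e. u s z' e) holomorphic_on ball \<epsilon> r" if "s \<in> ball t r" "z' \<in> ball z r" for s z'
      unfolding u_def
      by (rule inv_fourier_U_holomorphic[OF open_ball _ _ a]) (use that low rg bz be E in \<open>auto intro!: holomorphic_intros\<close>)
    show "(\<lambda>z. u s z e) holomorphic_on ball z r" if "s \<in> ball t r" "e \<in> ball \<epsilon> r" for s e
      unfolding u_def
      by (rule holomorphic_on_subset[OF inv_fourier_holomorphic[OF U_exp_decay] bz]) (use that rg be E in auto)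
    show "cmod (u s z' e) \<le> M" if "s \<in> ball t r" "z' \<in> ball z r" "e \<in> ball \<epsilon> r" for s z' e
      unfolding u_def by (rule M) (use that low rg bz be E in auto)
  qed
  then show "\<exists>a b c. ((\<lambda>(t, z, \<epsilon>). u t z \<epsilon>) has_derivative (\<lambda>(v, w, e). a * v + b * w + c * e)) (at x within TT \<times> strip \<beta>' \<times> E)"
    unfolding x using has_derivative_at_withinI by blast
qed

end

section \<open>From the equation on the ray to the q-difference-differential equation\<close>

text \<open>The constant produced by moving \<open>T\<^sup>n\<close> under the Laplace transform. The first factor accounts for the
  equation being read at \<open>q T\<close>.\<close>

definition shift_coeff :: "real \<Rightarrow> real \<Rightarrow> nat \<Rightarrow> real" where
  "shift_coeff q k n = q powr (- real n) * (q powr (- 1 / k)) powr (real n * (real n - 1) / 2)"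

lemma shift_coeff_bounds:
  assumes "q > 1" "k > 0"
  shows "0 < shift_coeff q k n" "shift_coeff q k n \<le> 1"
proof -
  have nn: "real n * (real n - 1) / 2 \<ge> 0" by (cases n) auto
  have 1: "q powr (- real n) \<le> q powr 0" using assms by (intro powr_mono) auto
  have 2: "(q powr (- 1 / k)) powr (real n * (real n - 1) / 2) \<le> 1"
    using q_base[OF assms] nn by (intro powr_le1) auto
  show "0 < shift_coeff q k n" using assms by (simp add: shift_coeff_def)
  show "shift_coeff q k n \<le> 1" unfolding shift_coeff_def
    using 1 2 assms by (intro mult_le_one) auto
qed

text \<open>This identifies the symbol of the leading terms with a multiple of \<open>P_fun\<close>.\<close>

lemma cq_ratio_eq_shift_coeff:
  assumes "q > 1" "k \<ge> 1"
  shows "cq q (real k) k / cq q (real k) (n + k) = shift_coeff q (real k) n"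
proof -
  have "cq q (real k) j = q powr (real j * (real j - 1) / (2 * real k))" for j
    by (simp add: cq_def powr_powr mult.commute)
  then have "cq q (real k) k / cq q (real k) (n + k)
      = q powr (real k * (real k - 1) / (2 * real k) - real (n + k) * (real (n + k) - 1) / (2 * real k))"
    by (simp only: powr_diff)
  also have "real k * (real k - 1) / (2 * real k) - real (n + k) * (real (n + k) - 1) / (2 * real k)
      = - real n + (- 1 / real k) * (real n * (real n - 1) / 2)"
    using assms by (simp add: field_simps)
  finally show ?thesis using assms by (simp only: shift_coeff_def powr_add powr_powr)
qed

text \<open>\<open>P_fun\<close> is a multiple of \<open>\<tau>\<close> to the power \<open>dD\<close> minus a nonzero constant, hence a product of
  \<open>dD\<close> linear factors over its roots.\<close>

lemma P_fun_lower_bound: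
  assumes q: "q > 1" and n: "dD \<ge> 1"
    and nz: "poly Q (\<i> * of_real m) \<noteq> 0" "poly RD (\<i> * of_real m) \<noteq> 0"
    and roots: "ql ` {..<dD} = {\<tau>. P_fun q k dD Q RD m \<tau> = 0}"
    and sep: "\<And>l. l < dD \<Longrightarrow> c \<le> cmod (\<tau> - ql l)" and c: "c \<ge> 0"
  shows "cmod (poly RD (\<i> * of_real m)) / cq q (real k) (dD + k) * c ^ dD \<le> cmod (P_fun q k dD Q RD m \<tau>)"
proof -
  define u where "u = poly RD (\<i> * of_real m) / of_real (cq q (real k) (dD + k))"
  define A where "A = poly Q (\<i> * of_real m) / of_real (cq q (real k) k) / u"
  have cpos: "cq q (real k) j > 0" for j using q by (simp add: cq_def)
  have u: "u \<noteq> 0" using nz cpos[of "dD + k"] by (simp add: u_def)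
  have A: "A \<noteq> 0" using nz u cpos[of k] by (simp add: A_def)
  have P: "P_fun q k dD Q RD m w = - (u * (w ^ dD - A))" for w
    using u unfolding P_fun_def u_def[symmetric] by (simp add: A_def algebra_simps)
  have "c ^ dD \<le> cmod (\<tau> ^ dD - A)"
  proof (rule power_minus_const_lower_bound[OF n A _ c])
    fix w assume "w ^ dD = A"
    then have "w \<in> ql ` {..<dD}" unfolding roots by (simp add: P)
    then show "c \<le> cmod (\<tau> - w)" using sep by auto
  qed
  then have "cmod u * c ^ dD \<le> cmod u * cmod (\<tau> ^ dD - A)" by (intro mult_left_mono) auto
  moreover have "cmod u = cmod (poly RD (\<i> * of_real m)) / cq q (real k) (dD + k)"
    using cpos[of "dD + k"] by (simp add: u_def norm_divide)
  ultimately show ?thesis by (simp add: P norm_mult)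
qed

lemma ray_weight_measurable: "ray_weight q k \<nu> \<in> borel_measurable borel"
  unfolding ray_weight_def log_plus_def by measurable

text \<open>A solution \<open>w\<close> of the equation on the ray, with forcing \<open>\<psi>\<close>. The dilation factors \<open>s j\<close> are those
  that the commutation rule yields for \<open>T\<close> to the power \<open>n j\<close> times the dilation by \<open>q\<close> to the power
  \<open>e j\<close>, when the transform is evaluated at \<open>q T\<close>.\<close>

locale borel_laplace_solution =
  L: laplace_family q k \<nu> \<beta> \<mu> d \<delta> b K B w +
  A: weighted_convolution B "ray_weight q k \<nu>" \<beta> \<mu> \<gamma> M \<zeta> J bc C \<rho> s
  for q k \<nu> \<beta> \<mu> d \<delta> b K :: real and B w and \<gamma> M \<zeta> :: real and J :: "'j set" and bc C \<rho> s +
  fixes N dD :: nat and n :: "'j \<Rightarrow> nat" and e :: "'j \<Rightarrow> real" and \<kappa> :: "'j \<Rightarrow> complex \<Rightarrow> complex"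
    and Q RD :: "complex poly" and R :: "'j \<Rightarrow> complex poly" and \<psi> :: "real \<Rightarrow> real \<Rightarrow> complex \<Rightarrow> complex"
  assumes s_eq: "\<And>j. j \<in> J \<Longrightarrow> s j = q powr (e j - 1 - real (n j) / k)"
    and \<rho>_eq: "\<And>j. j \<in> J \<Longrightarrow> \<rho> j = (\<lambda>x. poly (R j) (\<i> * of_real x))"
    and \<gamma>_eq: "\<gamma> = real N"
    and ray_eq: "\<And>v m \<epsilon>. \<epsilon> \<in> B \<Longrightarrow> v > 0 \<Longrightarrow>
      (poly Q (\<i> * of_real m) - poly RD (\<i> * of_real m) * of_real (shift_coeff q k dD) * (of_real v * cis d) ^ dD) * w v m \<epsilon>
      = \<psi> v m \<epsilon> + (\<Sum>j\<in>J. \<kappa> j \<epsilon> * of_real (shift_coeff q k (n j)) * (of_real v * cis d) ^ n j / of_real (sqrt (2 * pi))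
          * A.conv j w v m \<epsilon>)"
begin

lemma U_dilated:
  assumes T: "of_real q * T \<in> L.region" and T2: "of_real (q powr a) * T \<in> L.region" and \<epsilon>: "\<epsilon> \<in> B"
  shows "T ^ i * L.U (of_real (q powr a) * T) m \<epsilon> = of_real (shift_coeff q k i) *
      (\<integral>v. (of_real v * cis d) ^ i * w (q powr (a - 1 - real i / k) * v) m \<epsilon> * L.kern (of_real q * T) v \<partial>lborel)"
    and "integrable lborel (\<lambda>v. (of_real v * cis d) ^ i * w (q powr (a - 1 - real i / k) * v) m \<epsilon> * L.kern (of_real q * T) v)"
proof -
  define l where "l = q powr (a - 1 - real i / k)"
  have l: "l > 0" using L.q by (simp add: l_def)
  have "l * q powr (real i / k) * q powr 1 = q powr a" unfolding l_def powr_add[symmetric] by simp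
  then have "l * q powr (real i / k) * q = q powr a" using L.q by simp
  then have T2': "of_real (q powr a) * T = of_real (l * q powr (real i / k)) * (of_real q * T)"
    by (simp add: mult.assoc[symmetric] of_real_mult[symmetric] del: of_real_mult)
  have T0: "of_real q * T \<noteq> 0" using L.region_nonzero[OF T] .
  have sc: "q ^ i * shift_coeff q k i = (q powr (- 1 / k)) powr (real i * (real i - 1) / 2)"
    using L.q by (simp add: shift_coeff_def powr_minus powr_realpow)
  have "(of_real q * T) ^ i * L.U (of_real (q powr a) * T) m \<epsilon>
    = of_real (q ^ i * shift_coeff q k i) * (\<integral>v. (of_real v * cis d) ^ i * w (l * v) m \<epsilon> * L.kern (of_real q * T) v \<partial>lborel)"
    unfolding sc L.U_def L.kern_def by (rule laplace_integral_scale(1)[OF L.q L.k l T0 T2'])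
  then show "T ^ i * L.U (of_real (q powr a) * T) m \<epsilon> = of_real (shift_coeff q k i) *
      (\<integral>v. (of_real v * cis d) ^ i * w (q powr (a - 1 - real i / k) * v) m \<epsilon> * L.kern (of_real q * T) v \<partial>lborel)"
    using L.q by (simp add: power_mult_distrib l_def)
  show "integrable lborel (\<lambda>v. (of_real v * cis d) ^ i * w (q powr (a - 1 - real i / k) * v) m \<epsilon> * L.kern (of_real q * T) v)"
    using laplace_integral_scale(2)[OF L.q L.k l T0 T2', of "\<lambda>r. w r m \<epsilon>" d] L.integrand_integrable[OF T2 \<epsilon>]
    unfolding L.kern_def l_def by simp
qed

text \<open>The commutation rule applied to the weight itself gives the radial majorant for Fubini's theorem.\<close>

lemma dilated_weight_integrable:
  assumes T: "of_real q * T \<in> L.region" and T2: "of_real (q powr a) * T \<in> L.region"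
  shows "integrable lborel (\<lambda>v. \<bar>v\<bar> ^ i * ray_weight q k \<nu> (q powr (a - 1 - real i / k) * v) * cmod (L.kern (of_real q * T) v))"
proof -
  define l where "l = q powr (a - 1 - real i / k)"
  have l: "l > 0" using L.q by (simp add: l_def)
  have "l * q powr (real i / k) * q powr 1 = q powr a" unfolding l_def powr_add[symmetric] by simp
  then have "l * q powr (real i / k) * q = q powr a" using L.q by simp
  then have T2': "of_real (q powr a) * T = of_real (l * q powr (real i / k)) * (of_real q * T)"
    by (simp add: mult.assoc[symmetric] of_real_mult[symmetric] del: of_real_mult)
  have T0: "of_real q * T \<noteq> 0" using L.region_nonzero[OF T] .
  note [measurable] = ray_weight_measurable L.kern_measurable[OF T2]
  obtain g where g: "integrable lborel g" "\<And>r. ray_weight q k \<nu> r * cmod (L.kern (of_real (q powr a) * T) r) \<le> g r"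
    using L.kern_dominated[of "cmod (of_real (q powr a) * T)"] L.region_nonzero[OF T2] T2 by auto
  have "integrable lborel (\<lambda>r. of_real (ray_weight q k \<nu> r) * L.kern (of_real (q powr a) * T) r)"
  proof (rule Bochner_Integration.integrable_bound[OF g(1)])
    show "AE r in lborel. norm (of_real (ray_weight q k \<nu> r) * L.kern (of_real (q powr a) * T) r) \<le> norm (g r)"
    proof (rule AE_I2)
      fix r
      have "norm (of_real (ray_weight q k \<nu> r) * L.kern (of_real (q powr a) * T) r) = ray_weight q k \<nu> r * cmod (L.kern (of_real (q powr a) * T) r)"
        by (simp add: norm_mult ray_weight_def)
      then show "norm (of_real (ray_weight q k \<nu> r) * L.kern (of_real (q powr a) * T) r) \<le> norm (g r)" using g(2)[of r] by simp
    qed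
  qed measurable
  then have "integrable lborel (\<lambda>v. (of_real v * cis d) ^ i * of_real (ray_weight q k \<nu> (l * v)) * L.kern (of_real q * T) v)"
    using laplace_integral_scale(2)[OF L.q L.k l T0 T2', of "\<lambda>r. of_real (ray_weight q k \<nu> r)" d] unfolding L.kern_def by simp
  from integrable_norm[OF this] show ?thesis
    by (simp add: norm_mult norm_power l_def ray_weight_def)
qed

text \<open>The convolution in the Fourier variable commutes with the Laplace transform in the radial one.\<close>

lemma conv_laplace:
  assumes T: "of_real q * T \<in> L.region" and j: "j \<in> J" and T2: "of_real (q powr e j) * T \<in> L.region" and \<epsilon>: "\<epsilon> \<in> B"
  shows "T ^ n j * (\<integral>x. C j (m - x) \<epsilon> * (\<rho> j x * L.U (of_real (q powr e j) * T) x \<epsilon>) \<partial>lborel)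
     = of_real (shift_coeff q k (n j)) * (\<integral>v. (of_real v * cis d) ^ n j * A.conv j w v m \<epsilon> * L.kern (of_real q * T) v \<partial>lborel)"
    and "integrable lborel (\<lambda>v. (of_real v * cis d) ^ n j * A.conv j w v m \<epsilon> * L.kern (of_real q * T) v)"
proof -
  define f where "f x v = C j (m - x) \<epsilon> * \<rho> j x * w (s j * v) x \<epsilon> * ((of_real v * cis d) ^ n j * L.kern (of_real q * T) v)" for x v
  define c where "c = complex_of_real (shift_coeff q k (n j))"
  note [measurable] = A.C_meas[OF j \<epsilon>] A.\<rho>_meas[OF j] L.kern_measurable[OF T]
  have [measurable]: "(\<lambda>p. w (s j * snd p) (fst p) \<epsilon>) \<in> borel_measurable (borel \<Otimes>\<^sub>M borel)"
    by (rule borel_measurable_pair_compose[OF dominated_familyD(1)[OF L.family \<epsilon>]]) measurable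
  have m: "case_prod f \<in> borel_measurable (borel \<Otimes>\<^sub>M borel)"
    unfolding f_def case_prod_unfold by measurable
  have bd: "cmod (f x v) \<le> (\<zeta> * M * K * A.conv_majorant m x) * (\<bar>v\<bar> ^ n j * ray_weight q k \<nu> (q powr (e j - 1 - real (n j) / k) * v) * cmod (L.kern (of_real q * T) v))" for x v
  proof -
    have "cmod (f x v) \<le> (\<zeta> * M * K * ray_weight q k \<nu> (s j * v) * A.conv_majorant m x) * cmod ((of_real v * cis d) ^ n j * L.kern (of_real q * T) v)"
      unfolding f_def by (subst norm_mult) (intro mult_right_mono A.integrand_bound[OF L.family L.K j \<epsilon>] norm_ge_zero)
    then show ?thesis by (simp add: norm_mult norm_power s_eq[OF j] mult_ac)
  qed
  have ia: "integrable lborel (\<lambda>x. \<zeta> * M * K * A.conv_majorant m x)" by (intro integrable_mult_right A.conv_majorant)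
  note Fub = Fubini_swap_dominated[OF m ia dilated_weight_integrable[OF T T2, of "n j"] bd]
  have 1: "(\<integral>x. f x v \<partial>lborel) = (of_real v * cis d) ^ n j * A.conv j w v m \<epsilon> * L.kern (of_real q * T) v" for v
    unfolding f_def A.conv_def by (subst integral_mult_left_zero) (simp add: mult_ac)
  have 2: "c * (\<integral>v. f x v \<partial>lborel) = T ^ n j * (C j (m - x) \<epsilon> * (\<rho> j x * L.U (of_real (q powr e j) * T) x \<epsilon>))" for x
  proof -
    have "f x = (\<lambda>v. C j (m - x) \<epsilon> * \<rho> j x * ((of_real v * cis d) ^ n j * w (q powr (e j - 1 - real (n j) / k) * v) x \<epsilon> * L.kern (of_real q * T) v))"
      by (simp add: f_def s_eq[OF j] mult_ac fun_eq_iff)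
    then have "c * (\<integral>v. f x v \<partial>lborel) = C j (m - x) \<epsilon> * \<rho> j x * (T ^ n j * L.U (of_real (q powr e j) * T) x \<epsilon>)"
      unfolding U_dilated(1)[OF T T2 \<epsilon>] c_def by simp
    then show ?thesis by (simp add: mult_ac)
  qed
  have "T ^ n j * (\<integral>x. C j (m - x) \<epsilon> * (\<rho> j x * L.U (of_real (q powr e j) * T) x \<epsilon>) \<partial>lborel) = (\<integral>x. c * (\<integral>v. f x v \<partial>lborel) \<partial>lborel)"
    unfolding 2 by (rule integral_mult_right_zero[symmetric])
  also have "\<dots> = c * (\<integral>x. (\<integral>v. f x v \<partial>lborel) \<partial>lborel)" by (rule integral_mult_right_zero)
  also have "\<dots> = c * (\<integral>v. (of_real v * cis d) ^ n j * A.conv j w v m \<epsilon> * L.kern (of_real q * T) v \<partial>lborel)"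
    unfolding Fub(1) 1 ..
  finally show "T ^ n j * (\<integral>x. C j (m - x) \<epsilon> * (\<rho> j x * L.U (of_real (q powr e j) * T) x \<epsilon>) \<partial>lborel)
     = of_real (shift_coeff q k (n j)) * (\<integral>v. (of_real v * cis d) ^ n j * A.conv j w v m \<epsilon> * L.kern (of_real q * T) v \<partial>lborel)"
    unfolding c_def .
  show "integrable lborel (\<lambda>v. (of_real v * cis d) ^ n j * A.conv j w v m \<epsilon> * L.kern (of_real q * T) v)"
    using Fub(2) unfolding 1 .
qed

text \<open>The forcing term is isolated on the left: the equation on the ray then exhibits it as a combination of
  integrable functions.\<close>

lemma laplace_equation:
  assumes T: "of_real q * T \<in> L.region" and TD: "of_real (q powr (real dD / k + 1)) * T \<in> L.region"
    and Tj: "\<And>j. j \<in> J \<Longrightarrow> of_real (q powr e j) * T \<in> L.region" and \<epsilon>: "\<epsilon> \<in> B"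
  shows "(\<integral>v. \<psi> v m \<epsilon> * L.kern (of_real q * T) v \<partial>lborel)
     = poly Q (\<i> * of_real m) * L.U (of_real q * T) m \<epsilon>
       + (- (T ^ dD)) * (poly RD (\<i> * of_real m) * L.U (of_real (q powr (real dD / k + 1)) * T) m \<epsilon>)
       + (\<Sum>j\<in>J. (- (\<kappa> j \<epsilon> * T ^ n j)) * ((\<integral>x. C j (m - x) \<epsilon> * (\<rho> j x * L.U (of_real (q powr e j) * T) x \<epsilon>) \<partial>lborel) / of_real (sqrt (2 * pi))))"
proof -
  define kn where "kn = L.kern (of_real q * T)"
  define f1 where "f1 v = w v m \<epsilon> * kn v" for v
  define f2 where "f2 v = (of_real v * cis d) ^ dD * w v m \<epsilon> * kn v" for v
  define fj where "fj j v = (of_real v * cis d) ^ n j * A.conv j w v m \<epsilon> * kn v" for j v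
  define cj where "cj j = - (\<kappa> j \<epsilon> * of_real (shift_coeff q k (n j)) / of_real (sqrt (2 * pi)))" for j
  define c1 where "c1 = poly Q (\<i> * of_real m)"
  define c2 where "c2 = - (poly RD (\<i> * of_real m) * of_real (shift_coeff q k dD))"
  have q1: "q powr (real dD / k + 1 - 1 - real dD / k) = 1" using L.q by simp
  have i1: "integrable lborel f1" unfolding f1_def kn_def by (rule L.integrand_integrable[OF T \<epsilon>])
  have i2: "integrable lborel f2" using U_dilated(2)[OF T TD \<epsilon>, of dD m] L.q unfolding f2_def kn_def q1 by simp
  have ij: "integrable lborel (fj j)" if "j \<in> J" for j
    unfolding fj_def kn_def by (rule conv_laplace(2)[OF T that Tj[OF that] \<epsilon>])
  have pt: "\<psi> v m \<epsilon> * kn v = c1 * f1 v + c2 * f2 v + (\<Sum>j\<in>J. cj j * fj j v)" for v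
  proof (cases "v > 0")
    case True
    have "\<psi> v m \<epsilon> = (c1 + c2 * (of_real v * cis d) ^ dD) * w v m \<epsilon> + (\<Sum>j\<in>J. cj j * ((of_real v * cis d) ^ n j * A.conv j w v m \<epsilon>))"
    proof -
      have "(\<Sum>j\<in>J. cj j * ((of_real v * cis d) ^ n j * A.conv j w v m \<epsilon>))
         = - (\<Sum>j\<in>J. \<kappa> j \<epsilon> * of_real (shift_coeff q k (n j)) * (of_real v * cis d) ^ n j / of_real (sqrt (2 * pi)) * A.conv j w v m \<epsilon>)"
        unfolding sum_negf[symmetric] by (intro sum.cong refl) (simp add: cj_def)
      then show ?thesis using ray_eq[OF \<epsilon> True, of m] unfolding c1_def c2_def by (simp add: algebra_simps)
    qed
    then show ?thesis by (simp add: f1_def f2_def fj_def distrib_left distrib_right sum_distrib_left sum_distrib_right mult_ac)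
  next
    case False
    then have "kn v = 0" by (simp add: kn_def L.kern_def laplace_kernel_def)
    then show ?thesis by (simp add: f1_def f2_def fj_def)
  qed
  have "(\<integral>v. \<psi> v m \<epsilon> * kn v \<partial>lborel) = c1 * integral\<^sup>L lborel f1 + c2 * integral\<^sup>L lborel f2 + (\<Sum>j\<in>J. cj j * integral\<^sup>L lborel (fj j))"
  proof -
    have a: "integrable lborel (\<lambda>v. c1 * f1 v)" "integrable lborel (\<lambda>v. c2 * f2 v)"
      by (intro integrable_mult_right i1 i2)+
    have aj: "integrable lborel (\<lambda>v. cj j * fj j v)" if "j \<in> J" for j
      by (intro integrable_mult_right ij that)
    have s: "integrable lborel (\<lambda>v. \<Sum>j\<in>J. cj j * fj j v)"
      by (intro Bochner_Integration.integrable_sum aj)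
    have "(\<integral>v. \<psi> v m \<epsilon> * kn v \<partial>lborel) = (\<integral>v. c1 * f1 v + c2 * f2 v \<partial>lborel) + (\<integral>v. (\<Sum>j\<in>J. cj j * fj j v) \<partial>lborel)"
      unfolding pt by (rule Bochner_Integration.integral_add[OF Bochner_Integration.integrable_add[OF a] s])
    also have "(\<integral>v. c1 * f1 v + c2 * f2 v \<partial>lborel) = (\<integral>v. c1 * f1 v \<partial>lborel) + (\<integral>v. c2 * f2 v \<partial>lborel)"
      by (rule Bochner_Integration.integral_add[OF a])
    also have "(\<integral>v. (\<Sum>j\<in>J. cj j * fj j v) \<partial>lborel) = (\<Sum>j\<in>J. \<integral>v. cj j * fj j v \<partial>lborel)"
      by (rule Bochner_Integration.integral_sum[OF aj])
    finally show ?thesis unfolding integral_mult_right_zero .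
  qed
  moreover have "integral\<^sup>L lborel f1 = L.U (of_real q * T) m \<epsilon>" by (simp add: f1_def[abs_def] kn_def L.U_def)
  moreover have "c2 * integral\<^sup>L lborel f2 = (- (T ^ dD)) * (poly RD (\<i> * of_real m) * L.U (of_real (q powr (real dD / k + 1)) * T) m \<epsilon>)"
  proof -
    have "(\<lambda>v. (of_real v * cis d) ^ dD * w (q powr (real dD / k + 1 - 1 - real dD / k) * v) m \<epsilon> * L.kern (of_real q * T) v) = f2"
      unfolding q1 by (simp add: f2_def[abs_def] kn_def)
    then have "T ^ dD * L.U (of_real (q powr (real dD / k + 1)) * T) m \<epsilon> = of_real (shift_coeff q k dD) * integral\<^sup>L lborel f2"
      using U_dilated(1)[OF T TD \<epsilon>, of dD m] by (simp only:)
    then show ?thesis by (simp add: c2_def)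
  qed
  moreover have "cj j * integral\<^sup>L lborel (fj j) = (- (\<kappa> j \<epsilon> * T ^ n j)) * ((\<integral>x. C j (m - x) \<epsilon> * (\<rho> j x * L.U (of_real (q powr e j) * T) x \<epsilon>) \<partial>lborel) / of_real (sqrt (2 * pi)))"
    if j: "j \<in> J" for j
  proof -
    define c where "c = - (\<kappa> j \<epsilon>) / of_real (sqrt (2 * pi))"
    have "cj j * integral\<^sup>L lborel (fj j) = c * (of_real (shift_coeff q k (n j)) * integral\<^sup>L lborel (fj j))"
      by (simp add: cj_def c_def)
    also have "of_real (shift_coeff q k (n j)) * integral\<^sup>L lborel (fj j) = T ^ n j * (\<integral>x. C j (m - x) \<epsilon> * (\<rho> j x * L.U (of_real (q powr e j) * T) x \<epsilon>) \<partial>lborel)"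
      unfolding fj_def kn_def by (rule conv_laplace(1)[OF T j Tj[OF j] \<epsilon>, symmetric])
    finally show ?thesis by (simp add: c_def)
  qed
  ultimately show ?thesis unfolding kn_def c1_def by simp
qed

lemma fourier_equation:
  assumes T: "of_real q * T \<in> L.region" and TD: "of_real (q powr (real dD / k + 1)) * T \<in> L.region"
    and Tj: "\<And>j. j \<in> J \<Longrightarrow> of_real (q powr e j) * T \<in> L.region" and \<epsilon>: "\<epsilon> \<in> B" and z: "z \<in> strip \<beta>"
  shows "diff_op Q (inv_fourier (\<lambda>m. L.U (of_real q * T) m \<epsilon>)) z
     = T ^ dD * diff_op RD (inv_fourier (\<lambda>m. L.U (of_real (q powr (real dD / k + 1)) * T) m \<epsilon>)) z
       + (\<Sum>j\<in>J. \<kappa> j \<epsilon> * T ^ n j * (inv_fourier (\<lambda>m. C j m \<epsilon>) z * diff_op (R j) (inv_fourier (\<lambda>m. L.U (of_real (q powr e j) * T) m \<epsilon>)) z))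
       + inv_fourier (\<lambda>m. \<integral>v. \<psi> v m \<epsilon> * L.kern (of_real q * T) v \<partial>lborel) z"
proof -
  define h1 where "h1 m = poly Q (\<i> * of_real m) * L.U (of_real q * T) m \<epsilon>" for m
  define h2 where "h2 m = poly RD (\<i> * of_real m) * L.U (of_real (q powr (real dD / k + 1)) * T) m \<epsilon>" for m
  define hU where "hU j m = poly (R j) (\<i> * of_real m) * L.U (of_real (q powr e j) * T) m \<epsilon>" for j m
  define hj where "hj j m = (\<integral>x. C j (m - x) \<epsilon> * hU j x \<partial>lborel) / complex_of_real (sqrt (2 * pi))" for j m
  have e1: "exp_decay \<beta> h1" unfolding h1_def by (intro exp_decay_poly L.U_exp_decay T \<epsilon>)
  have e2: "exp_decay \<beta> h2" unfolding h2_def by (intro exp_decay_poly L.U_exp_decay TD \<epsilon>)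
  have eU: "exp_decay \<beta> (hU j)" if "j \<in> J" for j unfolding hU_def by (intro exp_decay_poly L.U_exp_decay Tj that \<epsilon>)
  have eC: "exp_decay \<beta> (\<lambda>m. C j m \<epsilon>)" if "j \<in> J" for j
    using exp_decay_fourier_weight[OF A.C_meas[OF that \<epsilon>] A.C_bound[OF that \<epsilon>] _ A.M(2)] L.\<mu> by simp
  have ej: "exp_decay \<beta> (hj j)" if j: "j \<in> J" for j
  proof -
    obtain Cu where Cu: "Cu \<ge> 0" "\<And>m. cmod (L.U (of_real (q powr e j) * T) m \<epsilon>) \<le> Cu * fourier_weight \<beta> \<mu> m"
      using L.U_bound[of "cmod (of_real (q powr e j) * T)"] L.region_nonzero[OF Tj[OF j]] Tj[OF j] \<epsilon> by auto
    have "exp_decay \<beta> (\<lambda>m. \<integral>x. C j (m - x) \<epsilon> * hU j x \<partial>lborel)"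
    proof (rule exp_decay_convolution[OF A.\<beta> _ A.M(2) _ A.C_meas[OF j \<epsilon>] A.C_bound[OF j \<epsilon>]])
      show "\<mu> - real N > 1" using A.\<gamma> by (simp add: \<gamma>_eq)
      show "0 \<le> M * Cu" using A.M Cu by simp
      show "hU j \<in> borel_measurable borel" using eU[OF j] by (simp add: exp_decay_def)
      fix m
      have p: "(1 + \<bar>m\<bar>) powr real N = (1 + \<bar>m\<bar>) ^ N" by (simp add: powr_realpow add_pos_nonneg)
      have "cmod (hU j m) \<le> (M * (1 + \<bar>m\<bar>) ^ N) * (Cu * fourier_weight \<beta> \<mu> m)"
        unfolding hU_def norm_mult using A.\<rho>_bound[OF j, of m] A.M
        by (intro mult_mono Cu) (auto simp: \<rho>_eq[OF j] \<gamma>_eq p)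
      then show "cmod (hU j m) \<le> M * Cu * ((1 + \<bar>m\<bar>) ^ N * fourier_weight \<beta> \<mu> m)" by (simp add: mult_ac)
    qed
    then have "exp_decay \<beta> (\<lambda>m. (1 / complex_of_real (sqrt (2 * pi))) * (\<integral>x. C j (m - x) \<epsilon> * hU j x \<partial>lborel))"
      by (rule exp_decay_cmult)
    then show ?thesis by (simp add: hj_def[abs_def])
  qed
  \<comment> \<open>The decay of the transformed forcing term in \<open>m\<close> is read off from the equation itself.\<close>
  have F: "(\<lambda>m. \<integral>v. \<psi> v m \<epsilon> * L.kern (of_real q * T) v \<partial>lborel)
     = (\<lambda>m. h1 m + (- (T ^ dD)) * h2 m + (\<Sum>j\<in>J. (- (\<kappa> j \<epsilon> * T ^ n j)) * hj j m))"
    using laplace_equation[OF T TD Tj \<epsilon>]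
    unfolding h1_def h2_def hj_def hU_def by (simp add: \<rho>_eq cong: sum.cong)
  have es: "exp_decay \<beta> (\<lambda>m. \<Sum>j\<in>J. (- (\<kappa> j \<epsilon> * T ^ n j)) * hj j m)"
    using A.J ej
  proof (induction J rule: finite_induct)
    case empty
    have "exp_decay \<beta> (\<lambda>m. 0 * h1 m)" by (rule exp_decay_cmult[OF e1])
    then show ?case by simp
  next
    case (insert j J')
    then have "exp_decay \<beta> (\<lambda>m. (- (\<kappa> j \<epsilon> * T ^ n j)) * hj j m + (\<Sum>j\<in>J'. (- (\<kappa> j \<epsilon> * T ^ n j)) * hj j m))"
      by (intro exp_decay_add exp_decay_cmult) auto
    then show ?case using insert by simp
  qed
  have Fz: "inv_fourier (\<lambda>m. \<integral>v. \<psi> v m \<epsilon> * L.kern (of_real q * T) v \<partial>lborel) z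
     = inv_fourier h1 z + (- (T ^ dD)) * inv_fourier h2 z + (\<Sum>j\<in>J. (- (\<kappa> j \<epsilon> * T ^ n j)) * inv_fourier (hj j) z)"
    unfolding F
    by (subst inv_fourier_add[OF exp_decay_add[OF e1 exp_decay_cmult[OF e2]] es z], subst inv_fourier_add[OF e1 exp_decay_cmult[OF e2] z],
        subst inv_fourier_sum[OF A.J exp_decay_cmult[OF ej] z]) (simp_all only: inv_fourier_cmult)
  have d1: "diff_op Q (inv_fourier (\<lambda>m. L.U (of_real q * T) m \<epsilon>)) z = inv_fourier h1 z"
    unfolding h1_def by (rule diff_op_inv_fourier[OF L.U_exp_decay[OF T \<epsilon>] z])
  have d2: "diff_op RD (inv_fourier (\<lambda>m. L.U (of_real (q powr (real dD / k + 1)) * T) m \<epsilon>)) z = inv_fourier h2 z"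
    unfolding h2_def by (rule diff_op_inv_fourier[OF L.U_exp_decay[OF TD \<epsilon>] z])
  have dj: "inv_fourier (\<lambda>m. C j m \<epsilon>) z * diff_op (R j) (inv_fourier (\<lambda>m. L.U (of_real (q powr e j) * T) m \<epsilon>)) z = inv_fourier (hj j) z"
    if j: "j \<in> J" for j
  proof -
    have "diff_op (R j) (inv_fourier (\<lambda>m. L.U (of_real (q powr e j) * T) m \<epsilon>)) z = inv_fourier (hU j) z"
      unfolding hU_def by (rule diff_op_inv_fourier[OF L.U_exp_decay[OF Tj[OF j] \<epsilon>] z])
    then show ?thesis unfolding hj_def using inv_fourier_mult[OF eC[OF j] eU[OF j] z] by simp
  qed
  have "(\<Sum>j\<in>J. (- (\<kappa> j \<epsilon> * T ^ n j)) * inv_fourier (hj j) z) = - (\<Sum>j\<in>J. \<kappa> j \<epsilon> * T ^ n j * (inv_fourier (\<lambda>m. C j m \<epsilon>) z * diff_op (R j) (inv_fourier (\<lambda>m. L.U (of_real (q powr e j) * T) m \<epsilon>)) z))"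
    unfolding sum_negf[symmetric] by (intro sum.cong refl) (simp add: dj)
  then show ?thesis unfolding d1 d2 Fz by simp
qed

end

section \<open>The solution\<close>

theorem theorem1:
  fixes q \<kappa> \<beta> \<mu> \<epsilon>0 \<rho> \<alpha> \<nu> \<delta> \<delta>t rT dQR \<eta>QR M1 M2 :: real
    and k1 k2 D dD s :: nat
    and I :: "nat \<Rightarrow> nat set"
    and \<delta>s :: "nat \<Rightarrow> nat"
    and d \<Delta> :: "nat \<Rightarrow> nat \<Rightarrow> nat"
    and R :: "nat \<Rightarrow> complex poly"
    and E U S :: "nat \<Rightarrow> complex set"
    and dir :: "nat \<Rightarrow> real"
    and TT :: "complex set"
    and Rb :: "nat \<Rightarrow> complex set"
  assumes q: "q > 1"
    and k: "1 \<le> k1" "k1 < k2" "1 / \<kappa> = 1 / real k1 - 1 / real k2"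
    and D: "D \<ge> 3" "dD \<ge> 1"
    and I: "\<And>l. l \<in> {1..D-1} \<Longrightarrow> finite (I l) \<and> I l \<noteq> {}"
    and \<delta>s: "\<And>l. l \<in> {1..D-1} \<Longrightarrow> \<delta>s l \<ge> 1"
    and d: "\<And>l j. l \<in> {1..D-1} \<Longrightarrow> j \<in> I l \<Longrightarrow> d j l \<ge> 1"
    and \<delta>s_mono: "\<delta>s 1 = 1" "\<And>l. l \<in> {1..D-2} \<Longrightarrow> \<delta>s l < \<delta>s (Suc l)"
    and \<Delta>: "\<And>l j. l \<in> {1..D-1} \<Longrightarrow> j \<in> I l \<Longrightarrow> \<Delta> j l \<ge> d j l"
    and d_\<delta>s: "\<And>l j. l \<in> {1..D-1} \<Longrightarrow> j \<in> I l \<Longrightarrow> real (d j l) / real k2 + 1 \<ge> real (\<delta>s l)"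
    and dD_\<delta>s: "\<And>l. l \<in> {1..D-1} \<Longrightarrow> (real dD - 1) / real k2 + 1 \<ge> real (\<delta>s l)"
    and deg_R: "\<And>l. l \<in> {1..D-1} \<Longrightarrow> degree (R D) \<ge> degree (R l)"
    and R_D: "\<And>m::real. poly (R D) (\<i> * of_real m) \<noteq> 0"
    and QR: "\<eta>QR > 0"
    and \<beta>\<mu>: "\<beta> > 0" "\<mu> > real (degree (R D)) + 1"
    and pos: "\<epsilon>0 > 0" "\<epsilon>0 < 1" "rT > 0" "rT < 1" "\<rho> > 0" "\<alpha> > 0" "\<delta> > 0" "\<delta>t > 0"
             "M1 > 0" "M2 > 0"
    and covering: "good_covering \<epsilon>0 s E"
    and TT: "bounded_sector rT TT"
    and U: "\<And>p. p < s \<Longrightarrow> unbounded_sector (dir p) (U p)"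
    and S: "\<And>p. p < s \<Longrightarrow> unbounded_sector (dir p) (S p)"
    and \<delta>: "\<And>p. p < s \<Longrightarrow> infdist (- of_real \<delta>) (U p \<union> ball 0 \<rho>) > 0"
    and Rb: "\<And>p. Rb p = R_dom (dir p) \<delta>t \<inter> ball 0 (\<epsilon>0 * rT)"
    and small: "\<nu> + real k2 / ln q * ln rT < 0"
               "\<alpha> + \<kappa> / ln q * ln (\<epsilon>0 * rT) < 0"
               "\<epsilon>0 * rT \<le> q powr ((1/2 - \<nu>) / real k2) / 2"
    and assoc3: "\<And>p. p < s \<Longrightarrow> Rb p \<inter> Rb (Suc p mod s) \<noteq> {}"
                "\<And>p t \<epsilon>. p < s \<Longrightarrow> t \<in> TT \<Longrightarrow> \<epsilon> \<in> E p \<Longrightarrow> \<epsilon> * t \<in> Rb p"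
  shows "\<exists>r0 \<zeta>\<psi> (\<zeta> :: nat \<Rightarrow> nat \<Rightarrow> real).
    r0 > 0 \<and> \<zeta>\<psi> > 0 \<and> (\<forall>l\<in>{1..D-1}. \<forall>j\<in>I l. \<zeta> j l > 0) \<and>
    (\<forall>rQR (Q :: complex poly) (ql :: nat \<Rightarrow> real \<Rightarrow> complex)
        (C :: nat \<Rightarrow> nat \<Rightarrow> real \<Rightarrow> complex \<Rightarrow> complex) (Ct :: nat \<Rightarrow> nat \<Rightarrow> real)
        (F :: nat \<Rightarrow> real \<Rightarrow> complex \<Rightarrow> complex) (CF :: real)
        (\<psi> :: nat \<Rightarrow> complex \<Rightarrow> real \<Rightarrow> complex \<Rightarrow> complex) (\<zeta>\<psi>1 :: real).
      rQR \<ge> r0 \<longrightarrow>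
      degree Q \<ge> degree (R D) \<longrightarrow>
      (\<forall>m::real. poly Q (\<i> * of_real m) \<noteq> 0) \<longrightarrow>
      (\<forall>m::real. poly Q (\<i> * of_real m) / poly (R D) (\<i> * of_real m)
           \<in> outer_closed_sector rQR dQR \<eta>QR) \<longrightarrow>
      (\<forall>m. (\<lambda>l. ql l m) ` {..<dD} = {\<tau>. P_fun q k2 dD Q (R D) m \<tau> = 0}) \<longrightarrow>
      (\<forall>l<dD. \<forall>m. \<forall>p<s. \<forall>\<tau> \<in> S p \<union> cball 0 \<rho>. cmod (\<tau> - ql l m) \<ge> M1 * (1 + cmod \<tau>)) \<longrightarrow>
      (\<exists>l0<dD. \<forall>m. \<forall>p<s. \<forall>\<tau> \<in> S p \<union> cball 0 \<rho>. cmod (\<tau> - ql l0 m) \<ge> M2 * cmod (ql l0 m)) \<longrightarrow>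
      (\<forall>l\<in>{1..D-1}. \<forall>j\<in>I l. Ct j l > 0 \<and>
           (\<forall>m. (\<lambda>\<epsilon>. C j l m \<epsilon>) holomorphic_on ball 0 \<epsilon>0) \<and>
           (\<forall>\<epsilon>\<in>ball 0 \<epsilon>0. (\<lambda>m. C j l m \<epsilon>) \<in> E_space \<beta> \<mu> \<and>
              E_norm \<beta> \<mu> (\<lambda>m. C j l m \<epsilon>) \<le> ennreal (Ct j l))) \<longrightarrow>
      CF > 0 \<longrightarrow>
      (\<forall>n. (\<forall>m. (\<lambda>\<epsilon>. F n m \<epsilon>) holomorphic_on ball 0 \<epsilon>0) \<and>
           (\<forall>\<epsilon>\<in>ball 0 \<epsilon>0. (\<lambda>m. F n m \<epsilon>) \<in> E_space \<beta> \<mu> \<and>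
              E_norm \<beta> \<mu> (\<lambda>m. F n m \<epsilon>)
                \<le> ennreal (CF / \<rho> ^ n * q powr (real n * (real n - 1) / (2 * real k1))))) \<longrightarrow>
      \<zeta>\<psi>1 > 0 \<longrightarrow>
      (\<forall>p<s. \<forall>\<epsilon>\<in>ball 0 \<epsilon>0.
           (\<forall>m. \<forall>\<tau>\<in>ball 0 \<rho>.
              (\<lambda>n. F n m \<epsilon> * \<tau> ^ n / of_real (cq q (real k1) n)) sums \<psi> p \<tau> m \<epsilon>) \<and>
           (\<lambda>\<tau> m. \<psi> p \<tau> m \<epsilon>) \<in> Exp1_space q (U p) \<delta> (real k1) \<beta> \<mu> \<alpha> \<rho> \<and>
           Exp1_norm q (U p) \<delta> (real k1) \<beta> \<mu> \<alpha> \<rho> (\<lambda>\<tau> m. \<psi> p \<tau> m \<epsilon>) \<le> ennreal \<zeta>\<psi>1) \<longrightarrow>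
      (\<exists>\<zeta>\<psi>2>0. \<forall>p<s. \<forall>\<epsilon>\<in>ball 0 \<epsilon>0.
           \<exists>h \<in> Exp2_space q (S p) (Rb p) (real k2) \<beta> \<mu> \<nu>.
             Exp2_norm q (S p) (Rb p) (real k2) \<beta> \<mu> \<nu> h \<le> ennreal \<zeta>\<psi>2 \<and>
             (\<forall>\<tau> \<in> S p \<union> Rb p. \<forall>m. h \<tau> m = psi_k2 q \<kappa> (dir p) (\<psi> p) \<tau> m \<epsilon>)) \<longrightarrow>
      CF \<le> \<zeta>\<psi> \<longrightarrow>
      (\<forall>l\<in>{1..D-1}. \<forall>j\<in>I l. Ct j l \<le> \<zeta> j l) \<longrightarrow>
      (\<forall>p<s. \<exists>u.
         \<forall>\<beta>'. 0 < \<beta>' \<and> \<beta>' < \<beta> \<longrightarrow>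
           holomorphic3_on u (TT \<times> strip \<beta>' \<times> E p) \<and>
           solves_equation q k2 D dD \<delta>s I d \<Delta> Q R
             (\<lambda>j l z \<epsilon>. inv_fourier (\<lambda>m. C j l m \<epsilon>) z)
             (f_forcing q \<kappa> k2 (dir p) (\<psi> p))
             TT (strip \<beta>') (E p) u))"
proof -
  define N where "N = degree (R D)"
  define b where "b = \<epsilon>0 * rT"
  define B where "B = ball (0::complex) \<epsilon>0"
  have k2: "real k2 > 0" "k2 \<ge> 1" and k1: "real k1 > 0" using k by auto
  have \<kappa>: "real k1 < \<kappa>"
  proof -
    have "1 / real k2 < 1 / real k1" using k by (simp add: frac_less2)
    then have "1 / \<kappa> > 0" using k(3) by simp
    then have "\<kappa> > 0" by (simp add: zero_less_divide_iff)
    moreover have "1 / \<kappa> < 1 / real k1" using k(3) k2 by simp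
    ultimately show ?thesis using k1 by (simp add: field_simps)
  qed
  have bpos: "b > 0" using pos by (simp add: b_def)
  have bln: "ln b < (1/2 - \<nu>) * ln q / real k2"
  proof -
    have "ln b \<le> ln (q powr ((1/2 - \<nu>) / real k2) / 2)"
      using small(3) bpos q unfolding b_def by (subst ln_le_cancel_iff) auto
    also have "\<dots> = (1/2 - \<nu>) / real k2 * ln q - ln 2" using q by (simp add: ln_div ln_powr)
    also have "\<dots> < (1/2 - \<nu>) / real k2 * ln q" by simp
    finally show ?thesis by simp
  qed
  obtain cR where cR: "cR > 0" "\<And>m::real. cR * (1 + \<bar>m\<bar>) ^ N \<le> cmod (poly (R D) (\<i> * of_real m))"
    using poly_imaginary_lower_bound[OF R_D] unfolding N_def by blast
  define cA where "cA = cq q (real k2) k2 * (cR / cq q (real k2) (dD + k2) * M1 ^ dD)"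
  have cqpos: "cq q (real k2) j > 0" for j using q by (simp add: cq_def)
  have cA: "cA > 0" using cR cqpos pos by (simp add: cA_def)
  define J where "J = Sigma {1..D-1} I"
  have J: "finite J" unfolding J_def using I by (intro finite_SigmaI) auto
  define n where "n lj = d (snd lj) (fst lj)" for lj
  define e where "e lj = real (\<delta>s (fst lj))" for lj :: "nat \<times> nat"
  \<comment> \<open>\<open>w\<close> is evaluated at \<open>q\<close> to the power \<open>- x\<close> times the radial variable.\<close>
  define x where "x lj = real (n lj) / real k2 + 1 - e lj" for lj
  define sf where "sf lj = q powr (- x lj)" for lj
  have x0: "x lj \<ge> 0" if "lj \<in> J" for lj
    using d_\<delta>s[of "fst lj" "snd lj"] that unfolding J_def x_def n_def e_def by auto
  have "\<exists>c>0. \<forall>r>0. r ^ n lj * ray_weight q (real k2) \<nu> (sf lj * r) \<le> c * (ray_weight q (real k2) \<nu> r * (1 + r) ^ dD)"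
    if lj: "lj \<in> J" for lj
    unfolding sf_def
  proof (rule ray_weight_shift[OF q k2(1) x0[OF lj]])
    \<comment> \<open>After the gain from the weight, the power of \<open>\<tau>\<close> that is left is \<open>k2 (\<delta>\<^sub>l - 1)\<close>.\<close>
    have "(real dD - 1) / real k2 + 1 \<ge> e lj" using dD_\<delta>s[of "fst lj"] lj unfolding J_def e_def by auto
    then have "real k2 * (e lj - 1) \<le> real dD - 1" using k2 by (simp add: field_simps)
    moreover have "real (n lj) - real k2 * x lj = real k2 * (e lj - 1)" using k2 by (simp add: x_def field_simps)
    ultimately show "real (n lj) - real k2 * x lj \<le> real dD" by simp
  qed
  then obtain c where c: "\<And>lj. lj \<in> J \<Longrightarrow> c lj > 0" "\<And>lj r. lj \<in> J \<Longrightarrow> r > 0 \<Longrightarrow>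
      r ^ n lj * ray_weight q (real k2) \<nu> (sf lj * r) \<le> c lj * (ray_weight q (real k2) \<nu> r * (1 + r) ^ dD)"
    by metis
  define Mc where "Mc = (\<Sum>lj\<in>J. c lj / cA)"
  define Mr where "Mr = (\<Sum>lj\<in>J. \<Sum>i\<le>degree (R (fst lj)). cmod (coeff (R (fst lj)) i))"
  define M where "M = Mc + Mr"
  have cd: "0 \<le> c lj / cA" if "lj \<in> J" for lj using c(1)[OF that] cA by simp
  have McMr: "Mc \<ge> 0" "Mr \<ge> 0"
  proof -
    show "Mc \<ge> 0" unfolding Mc_def by (intro sum_nonneg cd)
    show "Mr \<ge> 0" unfolding Mr_def by (intro sum_nonneg norm_ge_zero)
  qed
  have M0: "M \<ge> 0" using McMr by (simp add: M_def)
  have Mc: "c lj / cA \<le> M" if "lj \<in> J" for lj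
  proof -
    have "c lj / cA \<le> Mc" unfolding Mc_def by (rule member_le_sum[OF that _ J]) (use cd in auto)
    then show ?thesis using McMr by (simp add: M_def)
  qed
  have Mr: "(\<Sum>i\<le>degree (R (fst lj)). cmod (coeff (R (fst lj)) i)) \<le> M" if "lj \<in> J" for lj
  proof -
    have "(\<Sum>i\<le>degree (R (fst lj)). cmod (coeff (R (fst lj)) i)) \<le> Mr"
      unfolding Mr_def by (rule member_le_sum[OF that _ J, where f="\<lambda>lj. \<Sum>i\<le>degree (R (fst lj)). cmod (coeff (R (fst lj)) i)"]) (auto intro: sum_nonneg)
    then show ?thesis using McMr by (simp add: M_def)
  qed
  define \<rho>f where "\<rho>f lj = (\<lambda>x::real. poly (R (fst lj)) (\<i> * of_real x))" for lj :: "nat \<times> nat"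
  have \<rho>f_bound: "cmod (\<rho>f lj m) \<le> M * (1 + \<bar>m\<bar>) powr real N" if lj: "lj \<in> J" for lj m
  proof -
    have deg: "degree (R (fst lj)) \<le> N" using deg_R lj unfolding J_def N_def by auto
    have "cmod (\<rho>f lj m) \<le> (\<Sum>i\<le>degree (R (fst lj)). cmod (coeff (R (fst lj)) i)) * (1 + \<bar>m\<bar>) ^ degree (R (fst lj))"
      unfolding \<rho>f_def by (rule poly_imaginary_upper_bound)
    also have "\<dots> \<le> M * (1 + \<bar>m\<bar>) ^ N"
      using Mr[OF lj] M0 deg by (intro mult_mono power_increasing) auto
    also have "(1 + \<bar>m\<bar>) ^ N = (1 + \<bar>m\<bar>) powr real N" by (simp add: powr_realpow add_pos_nonneg)
    finally show ?thesis .
  qed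
  define X where "X = (M * M * (2 powr (\<mu> - real N) * (2 * (\<integral>x. (1 + \<bar>x\<bar>) powr (- (\<mu> - real N)) \<partial>lborel)))) * card J"
  have X: "X \<ge> 0"
  proof -
    have "0 \<le> (\<integral>x. (1 + \<bar>x\<bar>) powr (- (\<mu> - real N)) \<partial>lborel :: real)" by (rule Bochner_Integration.integral_nonneg) simp
    then show ?thesis using M0 by (simp add: X_def)
  qed
  \<comment> \<open>\<open>X\<close> bounds the norm of the operator on the ray up to the factor \<open>\<zeta>0\<close>; the denominator keeps it nonzero for \<open>X = 0\<close>.\<close>
  define \<zeta>0 where "\<zeta>0 = 1 / (2 * (X + 1))"
  have \<zeta>0: "\<zeta>0 > 0" "\<zeta>0 * X \<le> 1 / 2" using X by (auto simp: \<zeta>0_def field_simps)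
  have oTT: "open TT" using TT unfolding bounded_sector_def by (auto intro!: open_Int open_sector)
  have EB: "open (E p)" "E p \<subseteq> B" if "p < s" for p
  proof -
    have "bounded_sector \<epsilon>0 (E p)" using covering that unfolding good_covering_def by blast
    then show "open (E p)" "E p \<subseteq> B" unfolding bounded_sector_def B_def by (auto intro!: open_Int open_sector)
  qed
  show ?thesis
  proof (rule exI[of _ 1], rule exI[of _ 1], rule exI[of _ "\<lambda>_ _. \<zeta>0"], intro conjI allI impI ballI)
    fix rQR :: real and Q :: "complex poly" and ql :: "nat \<Rightarrow> real \<Rightarrow> complex"
      and C :: "nat \<Rightarrow> nat \<Rightarrow> real \<Rightarrow> complex \<Rightarrow> complex" and Ct :: "nat \<Rightarrow> nat \<Rightarrow> real"
      and F :: "nat \<Rightarrow> real \<Rightarrow> complex \<Rightarrow> complex" and CF :: real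
      and \<psi> :: "nat \<Rightarrow> complex \<Rightarrow> real \<Rightarrow> complex \<Rightarrow> complex" and \<zeta>\<psi>1 :: real and p :: nat
    assume Qnz: "\<forall>m::real. poly Q (\<i> * of_real m) \<noteq> 0"
      and roots: "\<forall>m. (\<lambda>l. ql l m) ` {..<dD} = {\<tau>. P_fun q k2 dD Q (R D) m \<tau> = 0}"
      and sep: "\<forall>l<dD. \<forall>m. \<forall>p<s. \<forall>\<tau> \<in> S p \<union> cball 0 \<rho>. cmod (\<tau> - ql l m) \<ge> M1 * (1 + cmod \<tau>)"
      and Cas: "\<forall>l\<in>{1..D-1}. \<forall>j\<in>I l. Ct j l > 0 \<and>
           (\<forall>m. (\<lambda>\<epsilon>. C j l m \<epsilon>) holomorphic_on ball 0 \<epsilon>0) \<and>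
           (\<forall>\<epsilon>\<in>ball 0 \<epsilon>0. (\<lambda>m. C j l m \<epsilon>) \<in> E_space \<beta> \<mu> \<and>
              E_norm \<beta> \<mu> (\<lambda>m. C j l m \<epsilon>) \<le> ennreal (Ct j l))"
      and CF: "CF > 0"
      and Fas: "\<forall>n. (\<forall>m. (\<lambda>\<epsilon>. F n m \<epsilon>) holomorphic_on ball 0 \<epsilon>0) \<and>
           (\<forall>\<epsilon>\<in>ball 0 \<epsilon>0. (\<lambda>m. F n m \<epsilon>) \<in> E_space \<beta> \<mu> \<and>
              E_norm \<beta> \<mu> (\<lambda>m. F n m \<epsilon>)
                \<le> ennreal (CF / \<rho> ^ n * q powr (real n * (real n - 1) / (2 * real k1))))"
      and Z: "\<zeta>\<psi>1 > 0"
      and \<psi>as: "\<forall>p<s. \<forall>\<epsilon>\<in>ball 0 \<epsilon>0.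
           (\<forall>m. \<forall>\<tau>\<in>ball 0 \<rho>.
              (\<lambda>n. F n m \<epsilon> * \<tau> ^ n / of_real (cq q (real k1) n)) sums \<psi> p \<tau> m \<epsilon>) \<and>
           (\<lambda>\<tau> m. \<psi> p \<tau> m \<epsilon>) \<in> Exp1_space q (U p) \<delta> (real k1) \<beta> \<mu> \<alpha> \<rho> \<and>
           Exp1_norm q (U p) \<delta> (real k1) \<beta> \<mu> \<alpha> \<rho> (\<lambda>\<tau> m. \<psi> p \<tau> m \<epsilon>) \<le> ennreal \<zeta>\<psi>1"
      and has: "\<exists>\<zeta>\<psi>2>0. \<forall>p<s. \<forall>\<epsilon>\<in>ball 0 \<epsilon>0.
           \<exists>h \<in> Exp2_space q (S p) (Rb p) (real k2) \<beta> \<mu> \<nu>.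
             Exp2_norm q (S p) (Rb p) (real k2) \<beta> \<mu> \<nu> h \<le> ennreal \<zeta>\<psi>2 \<and>
             (\<forall>\<tau> \<in> S p \<union> Rb p. \<forall>m. h \<tau> m = psi_k2 q \<kappa> (dir p) (\<psi> p) \<tau> m \<epsilon>)"
      and Ctle: "\<forall>l\<in>{1..D-1}. \<forall>j\<in>I l. Ct j l \<le> \<zeta>0"
      and p: "p < s"
    have B: "open B" by (simp add: B_def)
    define dp where "dp = dir p"
    obtain \<theta>U where U': "\<theta>U > 0" "U p = sector dp \<theta>U" using U[OF p] unfolding unbounded_sector_def dp_def by blast
    obtain \<theta>S where S': "\<theta>S > 0" "S p = sector dp \<theta>S" using S[OF p] unfolding unbounded_sector_def dp_def by blast
    have rayS: "of_real r * cis dp \<in> S p" if "r > 0" for r using ray_in_sector[OF S'(1) that] S'(2) by simp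
    \<comment> \<open>The symbol of the two leading terms on the ray.\<close>
    define A where "A r m = of_real (cq q (real k2) k2) * P_fun q k2 dD Q (R D) m (of_real r * cis dp)" for r m :: real
    have A_eq: "A r m = poly Q (\<i> * of_real m) - poly (R D) (\<i> * of_real m) * of_real (shift_coeff q (real k2) dD) * (of_real r * cis dp) ^ dD" for r m
    proof -
      have "shift_coeff q (real k2) dD = cq q (real k2) k2 / cq q (real k2) (dD + k2)"
        by (rule cq_ratio_eq_shift_coeff[OF q k2(2), symmetric])
      then have s: "complex_of_real (shift_coeff q (real k2) dD) = of_real (cq q (real k2) k2) / of_real (cq q (real k2) (dD + k2))"
        by simp
      have "of_real (cq q (real k2) k2) \<noteq> (0::complex)" using cqpos[of k2] by simp
      then show ?thesis unfolding A_def P_fun_def s by (simp add: right_diff_distrib)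
    qed
    have A_lower: "cA * ((1 + r) ^ dD * (1 + \<bar>m\<bar>) ^ N) \<le> cmod (A r m)" if r: "r > 0" for r m
    proof -
      define \<tau> where "\<tau> = of_real r * cis dp"
      have \<tau>: "\<tau> \<in> S p" "cmod \<tau> = r" using rayS[OF r] r by (auto simp: \<tau>_def norm_mult)
      have "cmod (poly (R D) (\<i> * of_real m)) / cq q (real k2) (dD + k2) * (M1 * (1 + r)) ^ dD \<le> cmod (P_fun q k2 dD Q (R D) m \<tau>)"
        by (rule P_fun_lower_bound[OF q D(2), where ql="\<lambda>l. ql l m"])
          (use Qnz R_D roots sep p \<tau> pos r in auto)
      moreover have "cR * (1 + \<bar>m\<bar>) ^ N / cq q (real k2) (dD + k2) * (M1 * (1 + r)) ^ dD
          \<le> cmod (poly (R D) (\<i> * of_real m)) / cq q (real k2) (dD + k2) * (M1 * (1 + r)) ^ dD"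
        using cR(2)[of m] cqpos[of "dD + k2"] pos r by (intro mult_right_mono divide_right_mono) auto
      ultimately have "cR * (1 + \<bar>m\<bar>) ^ N / cq q (real k2) (dD + k2) * (M1 * (1 + r)) ^ dD \<le> cmod (P_fun q k2 dD Q (R D) m \<tau>)"
        by linarith
      then have "cq q (real k2) k2 * (cR * (1 + \<bar>m\<bar>) ^ N / cq q (real k2) (dD + k2) * (M1 * (1 + r)) ^ dD) \<le> cq q (real k2) k2 * cmod (P_fun q k2 dD Q (R D) m \<tau>)"
        using cqpos[of k2] by (intro mult_left_mono) auto
      moreover have "cmod (A r m) = cq q (real k2) k2 * cmod (P_fun q k2 dD Q (R D) m \<tau>)"
        using cqpos[of k2] by (simp add: A_def \<tau>_def norm_mult)
      ultimately show ?thesis unfolding cA_def by (simp add: power_mult_distrib mult_ac)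
    qed
    have Apos: "cmod (A r m) > 0" if "r > 0" for r m
      by (rule less_le_trans[OF _ A_lower[OF that]]) (use cA that in \<open>auto intro!: mult_pos_pos add_pos_nonneg\<close>)
    have A_meas[measurable]: "(\<lambda>x. A (fst x) (snd x)) \<in> borel_measurable (borel \<Otimes>\<^sub>M borel)"
    proof -
      have "continuous_on UNIV (\<lambda>x. A (fst x) (snd x))" unfolding A_eq by (intro continuous_intros)
      then show ?thesis unfolding borel_prod by (rule borel_measurable_continuous_onI)
    qed
    define \<kappa>f where "\<kappa>f lj \<epsilon> = \<epsilon> ^ (\<Delta> (snd lj) (fst lj) - d (snd lj) (fst lj))" for lj and \<epsilon> :: complex
    define bc where "bc lj r m \<epsilon> = (if 0 < r then \<kappa>f lj \<epsilon> * of_real (shift_coeff q (real k2) (n lj)) * (of_real r * cis dp) ^ n lj / of_real (sqrt (2 * pi)) / A r m else 0)" for lj r m \<epsilon>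
    define Cc where "Cc lj = C (snd lj) (fst lj)" for lj
    have JD: "fst lj \<in> {1..D-1}" "snd lj \<in> I (fst lj)" if "lj \<in> J" for lj using that unfolding J_def by auto
    interpret W: weighted_convolution B "ray_weight q (real k2) \<nu>" \<beta> \<mu> "real N" M \<zeta>0 J bc Cc \<rho>f sf
    proof
      show "\<beta> \<ge> 0" "real N \<ge> 0" "\<mu> - real N > 1" using \<beta>\<mu> by (auto simp: N_def)
      show "ray_weight q (real k2) \<nu> r \<ge> 0" for r by (simp add: ray_weight_def)
      show "\<zeta>0 * (M * M * (2 powr (\<mu> - real N) * (2 * (\<integral>x. (1 + \<bar>x\<bar>) powr (- (\<mu> - real N)) \<partial>lborel)))) * card J \<le> 1 / 2"
        using \<zeta>0(2) unfolding X_def by (simp only: mult.assoc)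
      show "(\<lambda>(r, m). bc lj r m \<epsilon>) \<in> borel_measurable (borel \<Otimes>\<^sub>M borel)" for lj \<epsilon>
        unfolding bc_def case_prod_unfold by measurable
      show "(\<lambda>\<epsilon>. bc lj r m \<epsilon>) holomorphic_on B" for lj r m
      proof (cases "0 < r")
        case True
        then have "A r m \<noteq> 0" using Apos by fastforce
        then show ?thesis using True unfolding bc_def \<kappa>f_def by (auto intro!: holomorphic_intros)
      qed (simp add: bc_def)
      show "(\<lambda>m. Cc lj m \<epsilon>) \<in> borel_measurable borel" if "lj \<in> J" "\<epsilon> \<in> B" for lj \<epsilon>
        using Cas JD[OF that(1)] that(2) unfolding Cc_def B_def E_space_def by (auto intro: borel_measurable_continuous_onI)
      show "(\<lambda>\<epsilon>. Cc lj m \<epsilon>) holomorphic_on B" if "lj \<in> J" for lj m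
        using Cas JD[OF that] unfolding Cc_def B_def by blast
      show "cmod (Cc lj m \<epsilon>) \<le> \<zeta>0 * fourier_weight \<beta> \<mu> m" if "lj \<in> J" "\<epsilon> \<in> B" for lj m \<epsilon>
      proof -
        have "E_norm \<beta> \<mu> (\<lambda>m. Cc lj m \<epsilon>) \<le> ennreal (Ct (snd lj) (fst lj))" "0 < Ct (snd lj) (fst lj)" "Ct (snd lj) (fst lj) \<le> \<zeta>0"
          using Cas Ctle JD[OF that(1)] that(2) unfolding Cc_def B_def by blast+
        then show ?thesis
          using E_norm_bound[of \<beta> \<mu> "\<lambda>m. Cc lj m \<epsilon>" "Ct (snd lj) (fst lj)" m] fourier_weight_nonneg[of \<beta> \<mu> m]
          by (meson less_imp_le mult_right_mono order_trans)
      qed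
      show "\<rho>f lj \<in> borel_measurable borel" for lj
        unfolding \<rho>f_def by (intro borel_measurable_continuous_onI continuous_intros)
      show "cmod (bc lj r m \<epsilon>) * ray_weight q (real k2) \<nu> (sf lj * r) \<le> M * ray_weight q (real k2) \<nu> r * (1 + \<bar>m\<bar>) powr (- real N)"
        if lj: "lj \<in> J" and \<epsilon>: "\<epsilon> \<in> B" for lj r m \<epsilon>
      proof (cases "0 < r")
        case True
        define Wr where "Wr = ray_weight q (real k2) \<nu> r"
        define Ws where "Ws = ray_weight q (real k2) \<nu> (sf lj * r)"
        have W0: "Wr \<ge> 0" "Ws \<ge> 0" by (simp_all add: Wr_def Ws_def ray_weight_def)
        have "cmod (\<kappa>f lj \<epsilon>) \<le> 1" unfolding \<kappa>f_def norm_power using \<epsilon> pos by (intro power_le_one) (auto simp: B_def)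
        moreover have "shift_coeff q (real k2) (n lj) / sqrt (2 * pi) \<le> 1"
        proof -
          have "1 \<le> sqrt (2 * pi)" using pi_gt3 by (simp add: real_le_rsqrt)
          then have "shift_coeff q (real k2) (n lj) \<le> sqrt (2 * pi)" using shift_coeff_bounds(2)[OF q k2(1)] order_trans by blast
          then show ?thesis by (simp add: divide_le_eq)
        qed
        ultimately have "cmod (\<kappa>f lj \<epsilon>) * (shift_coeff q (real k2) (n lj) / sqrt (2 * pi)) \<le> 1"
          using shift_coeff_bounds[OF q k2(1), of "n lj"] by (intro mult_le_one) auto
        then have "cmod (\<kappa>f lj \<epsilon>) * (shift_coeff q (real k2) (n lj) / sqrt (2 * pi)) * (r ^ n lj / cmod (A r m)) \<le> 1 * (r ^ n lj / cmod (A r m))"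
          using True by (intro mult_right_mono) auto
        then have "cmod (bc lj r m \<epsilon>) \<le> r ^ n lj / cmod (A r m)"
          using True shift_coeff_bounds[OF q k2(1), of "n lj"]
          by (simp add: bc_def norm_mult norm_divide norm_power)
        then have "cmod (bc lj r m \<epsilon>) * Ws \<le> r ^ n lj / cmod (A r m) * Ws" using W0 by (intro mult_right_mono)
        also have "\<dots> = (r ^ n lj * Ws) / cmod (A r m)" by simp
        also have "\<dots> \<le> (c lj * (Wr * (1 + r) ^ dD)) / cmod (A r m)"
          unfolding Wr_def Ws_def by (intro divide_right_mono c(2) lj True) simp
        also have "\<dots> \<le> (c lj * (Wr * (1 + r) ^ dD)) / (cA * ((1 + r) ^ dD * (1 + \<bar>m\<bar>) ^ N))"
          using c(1)[OF lj] W0 True cA Apos[OF True]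
          by (intro divide_left_mono A_lower mult_pos_pos mult_nonneg_nonneg) (auto intro: add_pos_nonneg zero_less_power)
        also have "\<dots> = (c lj / cA) * Wr * (1 / (1 + \<bar>m\<bar>) ^ N)" using True by simp
        also have "\<dots> \<le> M * Wr * (1 / (1 + \<bar>m\<bar>) ^ N)" using Mc[OF lj] W0 by (intro mult_right_mono) auto
        also have "1 / (1 + \<bar>m\<bar>) ^ N = (1 + \<bar>m\<bar>) powr (- real N)" by (simp add: powr_minus_divide powr_realpow add_pos_nonneg)
        finally show ?thesis unfolding Wr_def Ws_def .
      next
        case False
        then show ?thesis using M0 by (simp add: bc_def ray_weight_def)
      qed
    qed (use B J M0 \<zeta>0 \<rho>f_bound in auto)
    define \<psi>2 where "\<psi>2 r m \<epsilon> = psi_k2 q \<kappa> dp (\<psi> p) (of_real r * cis dp) m \<epsilon>" for r m \<epsilon>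
    define c0 where "c0 = infdist (- of_real \<delta>) (sector dp \<theta>U \<union> ball 0 \<rho>)"
    have c0: "c0 > 0" using \<delta>[OF p] U'(2) by (simp add: c0_def)
    have dist: "c0 \<le> cmod (\<tau> + of_real \<delta>)" if "\<tau> \<in> sector dp \<theta>U \<union> ball 0 \<rho>" for \<tau>
    proof -
      have "c0 \<le> dist (- of_real \<delta>) \<tau>" unfolding c0_def by (rule infdist_le[OF that])
      also have "\<dots> = cmod (\<tau> + of_real \<delta>)" by (simp add: dist_norm norm_minus_commute[of "- of_real \<delta>"])
      finally show ?thesis .
    qed
    have cont: "continuous_on (sector dp \<theta>U) (\<lambda>\<tau>. \<psi> p \<tau> m \<epsilon>)" if "\<epsilon> \<in> B" for \<epsilon> m
    proof -
      have "continuous_on ((U p \<union> cball 0 \<rho>) \<times> UNIV) (\<lambda>(\<tau>, m). \<psi> p \<tau> m \<epsilon>)"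
        using \<psi>as p that unfolding B_def Exp1_space_def by auto
      moreover have "continuous_on (sector dp \<theta>U) (\<lambda>\<tau>. (\<tau>, m))" by (intro continuous_intros)
      ultimately have "continuous_on (sector dp \<theta>U) (\<lambda>\<tau>. case (\<tau>, m) of (\<tau>, m) \<Rightarrow> \<psi> p \<tau> m \<epsilon>)"
        by (rule continuous_on_compose2) (auto simp: U'(2))
      then show ?thesis by simp
    qed
    have hol: "(\<lambda>\<tau>. \<psi> p \<tau> m \<epsilon>) holomorphic_on (sector dp \<theta>U \<union> ball 0 \<rho>)" if "\<epsilon> \<in> B" for \<epsilon> m
    proof -
      have "(\<lambda>\<tau> m. \<psi> p \<tau> m \<epsilon>) \<in> Exp1_space q (U p) \<delta> (real k1) \<beta> \<mu> \<alpha> \<rho>"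
        using \<psi>as p that unfolding B_def by blast
      then show ?thesis unfolding Exp1_space_def U'(2) by simp
    qed
    have bd: "cmod (\<psi> p \<tau> m \<epsilon>) \<le> \<zeta>\<psi>1 * (fourier_weight \<beta> \<mu> m *
         exp (real k1 * (ln (cmod (\<tau> + of_real \<delta>)))\<^sup>2 / (2 * ln q) + \<alpha> * ln (cmod (\<tau> + of_real \<delta>))))"
      if "\<epsilon> \<in> B" "\<tau> \<in> sector dp \<theta>U \<union> ball 0 \<rho>" for \<epsilon> \<tau> m
    proof -
      have "Exp1_norm q (U p) \<delta> (real k1) \<beta> \<mu> \<alpha> \<rho> (\<lambda>\<tau> m. \<psi> p \<tau> m \<epsilon>) \<le> ennreal \<zeta>\<psi>1"
        using \<psi>as p that(1) unfolding B_def by blast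
      moreover have "\<tau> \<in> U p \<union> cball 0 \<rho>" using that(2) ball_subset_cball[of 0 \<rho>] unfolding U'(2) by blast
      ultimately show ?thesis by (rule Exp1_norm_bound[OF _ less_imp_le[OF Z]])
    qed
    have near0: "(\<lambda>\<epsilon>. \<psi> p \<tau> m \<epsilon>) holomorphic_on B" if \<tau>: "\<tau> \<in> ball 0 \<rho>" for \<tau> m
    proof (rule q_borel_series_holomorphic[OF B q k1 pos(5), where F="\<lambda>n. F n m" and \<tau>=\<tau> and K="CF * fourier_weight \<beta> \<mu> m"])
      show "cmod \<tau> < \<rho>" using \<tau> by simp
      show "(\<lambda>\<epsilon>. F n m \<epsilon>) holomorphic_on B" for n using Fas unfolding B_def by blast
      show "(\<lambda>n. F n m \<epsilon> * \<tau> ^ n / of_real (cq q (real k1) n)) sums \<psi> p \<tau> m \<epsilon>" if "\<epsilon> \<in> B" for \<epsilon>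
        using \<psi>as p that \<tau> unfolding B_def by blast
      fix n \<epsilon> assume \<epsilon>: "\<epsilon> \<in> B"
      have "E_norm \<beta> \<mu> (\<lambda>m. F n m \<epsilon>) \<le> ennreal (CF / \<rho> ^ n * q powr (real n * (real n - 1) / (2 * real k1)))"
        using Fas \<epsilon> unfolding B_def by blast
      from E_norm_bound[OF this, of m] show "cmod (F n m \<epsilon>) \<le> CF * fourier_weight \<beta> \<mu> m / \<rho> ^ n * q powr (real n * (real n - 1) / (2 * real k1))"
        using CF pos by (simp add: mult_ac)
    qed
    note psi_facts = q k1 \<kappa> less_imp_le[OF pos(6)] pos(7) pos(5) c0 U'(1) B dist cont hol bd less_imp_le[OF Z] near0
    have \<psi>2_hol: "(\<lambda>\<epsilon>. \<psi>2 r m \<epsilon>) holomorphic_on B" if "r > 0" for r m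
      unfolding \<psi>2_def by (rule psi_k2_holomorphic[OF psi_facts that])
    obtain K1 where K1: "K1 \<ge> 0" "\<And>r m \<epsilon>. \<epsilon>\<in>B \<Longrightarrow> 0 < r \<Longrightarrow> r \<le> 1 \<Longrightarrow> cmod (\<psi>2 r m \<epsilon>) \<le> K1 * fourier_weight \<beta> \<mu> m"
      using psi_k2_bounded_near_0[OF psi_facts] unfolding \<psi>2_def by blast
    obtain \<zeta>2 where \<zeta>2: "\<zeta>2 > 0" and h: "\<And>\<epsilon>. \<epsilon> \<in> B \<Longrightarrow> \<exists>h \<in> Exp2_space q (S p) (Rb p) (real k2) \<beta> \<mu> \<nu>.
             Exp2_norm q (S p) (Rb p) (real k2) \<beta> \<mu> \<nu> h \<le> ennreal \<zeta>2 \<and>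
             (\<forall>\<tau> \<in> S p \<union> Rb p. \<forall>m. h \<tau> m = psi_k2 q \<kappa> dp (\<psi> p) \<tau> m \<epsilon>)"
      using has p unfolding B_def dp_def by blast
    \<comment> \<open>The two bounds on the forcing term, for \<open>r \<le> 1\<close> and for \<open>r > 1\<close>, are joined in the weight.\<close>
    define K2 where "K2 = max K1 \<zeta>2"
    have \<psi>2_bound: "cmod (\<psi>2 r m \<epsilon>) \<le> K2 * (ray_weight q (real k2) \<nu> r * fourier_weight \<beta> \<mu> m)" if r: "r > 0" and \<epsilon>: "\<epsilon> \<in> B" for r m \<epsilon>
    proof (cases "r \<le> 1")
      case True
      then have "ray_weight q (real k2) \<nu> r = 1" using r by (simp add: ray_weight_def log_plus_def)
      then show ?thesis using K1(2)[OF \<epsilon> r True, of m] mult_right_mono[of K1 K2 "fourier_weight \<beta> \<mu> m"] fourier_weight_nonneg[of \<beta> \<mu> m]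
        by (simp add: K2_def)
    next
      case False
      obtain h' where h': "Exp2_norm q (S p) (Rb p) (real k2) \<beta> \<mu> \<nu> h' \<le> ennreal \<zeta>2"
          "\<And>\<tau> m. \<tau> \<in> S p \<Longrightarrow> h' \<tau> m = psi_k2 q \<kappa> dp (\<psi> p) \<tau> m \<epsilon>" using h[OF \<epsilon>] by blast
      have "cmod (h' (of_real r * cis dp) m) \<le> \<zeta>2 * (fourier_weight \<beta> \<mu> m * exp (real k2 * (ln (cmod (of_real r * cis dp)))\<^sup>2 / (2 * ln q) + \<nu> * ln (cmod (of_real r * cis dp))))"
        by (rule Exp2_norm_bound[OF h'(1)]) (use \<zeta>2 rayS[OF r] r in auto)
      also have "exp (real k2 * (ln (cmod (of_real r * cis dp)))\<^sup>2 / (2 * ln q) + \<nu> * ln (cmod (of_real r * cis dp))) = ray_weight q (real k2) \<nu> r"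
        using False by (simp add: norm_mult ray_weight_def log_plus_def)
      also have "\<zeta>2 * (fourier_weight \<beta> \<mu> m * ray_weight q (real k2) \<nu> r) \<le> K2 * (fourier_weight \<beta> \<mu> m * ray_weight q (real k2) \<nu> r)"
        using fourier_weight_nonneg[of \<beta> \<mu> m] by (intro mult_right_mono) (auto simp: K2_def ray_weight_def)
      finally show ?thesis using h'(2)[OF rayS[OF r]] by (simp add: \<psi>2_def mult_ac)
    qed
    have K2: "K2 \<ge> 0" using \<zeta>2 by (simp add: K2_def)
    define g where "g r m \<epsilon> = (if 0 < r then \<psi>2 r m \<epsilon> / A r m else 0)" for r m \<epsilon>
    have g: "dominated_family B (ray_weight q (real k2) \<nu>) (fourier_weight \<beta> \<mu>) (K2 / cA) g"
      unfolding dominated_family_def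
    proof (intro conjI ballI allI)
      fix \<epsilon> assume \<epsilon>: "\<epsilon> \<in> B"
      obtain h' where h': "continuous_on ((S p \<union> closure (Rb p)) \<times> UNIV) (\<lambda>(\<tau>, m). h' \<tau> m)"
          "\<And>\<tau> m. \<tau> \<in> S p \<Longrightarrow> h' \<tau> m = psi_k2 q \<kappa> dp (\<psi> p) \<tau> m \<epsilon>" using h[OF \<epsilon>] unfolding Exp2_space_def by blast
      have "continuous_on ({0<..} \<times> UNIV) (\<lambda>x::real \<times> real. (case (of_real (fst x) * cis dp, snd x) of (\<tau>, m) \<Rightarrow> h' \<tau> m))"
        by (rule continuous_on_compose2[OF h'(1)]) (use rayS in \<open>auto intro!: continuous_intros\<close>)
      then have "(\<lambda>x::real \<times> real. indicator ({0<..} \<times> UNIV) x *\<^sub>R h' (of_real (fst x) * cis dp) (snd x)) \<in> borel_measurable borel"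
        by (intro borel_measurable_continuous_on_indicator) (auto intro!: borel_open open_Times)
      also have "(\<lambda>x::real \<times> real. indicator ({0<..} \<times> UNIV) x *\<^sub>R h' (of_real (fst x) * cis dp) (snd x)) = (\<lambda>x. if 0 < fst x then \<psi>2 (fst x) (snd x) \<epsilon> else 0)"
        using h'(2) rayS by (auto simp: \<psi>2_def fun_eq_iff indicator_def mem_Times_iff)
      finally have [measurable]: "(\<lambda>x. if 0 < fst x then \<psi>2 (fst x) (snd x) \<epsilon> else 0) \<in> borel_measurable (borel \<Otimes>\<^sub>M borel)"
        by (simp add: borel_prod)
      have "(\<lambda>(r, m). g r m \<epsilon>) = (\<lambda>x. (if 0 < fst x then \<psi>2 (fst x) (snd x) \<epsilon> else 0) / A (fst x) (snd x))"
        by (auto simp: g_def fun_eq_iff)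
      also have "\<dots> \<in> borel_measurable (borel \<Otimes>\<^sub>M borel)" by measurable
      finally show "(\<lambda>(r, m). g r m \<epsilon>) \<in> borel_measurable (borel \<Otimes>\<^sub>M borel)" .
      fix r m
      show "cmod (g r m \<epsilon>) \<le> K2 / cA * (ray_weight q (real k2) \<nu> r * fourier_weight \<beta> \<mu> m)"
      proof (cases "0 < r")
        case True
        have "cA * (1 * 1) \<le> cA * ((1 + r) ^ dD * (1 + \<bar>m\<bar>) ^ N)"
          using cA True by (intro mult_left_mono mult_mono one_le_power) auto
        then have "cA \<le> cmod (A r m)" using A_lower[OF True, of m] by simp
        then have "cmod (\<psi>2 r m \<epsilon>) / cmod (A r m) \<le> (K2 * (ray_weight q (real k2) \<nu> r * fourier_weight \<beta> \<mu> m)) / cA"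
          using K2 cA fourier_weight_nonneg[of \<beta> \<mu> m] by (intro frac_le \<psi>2_bound True \<epsilon>) (auto simp: ray_weight_def)
        then show ?thesis using True by (simp add: g_def norm_divide)
      next
        case False
        then show ?thesis using K2 cA fourier_weight_nonneg[of \<beta> \<mu> m] by (simp add: g_def ray_weight_def)
      qed
    next
      fix r m
      show "(\<lambda>\<epsilon>. g r m \<epsilon>) holomorphic_on B"
      proof (cases "0 < r")
        case True
        then have "A r m \<noteq> 0" using Apos by fastforce
        then show ?thesis using True unfolding g_def by (auto intro!: holomorphic_intros \<psi>2_hol)
      qed (simp add: g_def)
    qed
    obtain w where w: "dominated_family B (ray_weight q (real k2) \<nu>) (fourier_weight \<beta> \<mu>) (2 * (K2 / cA)) w"
      and weq: "\<And>r m \<epsilon>. \<epsilon> \<in> B \<Longrightarrow> w r m \<epsilon> = g r m \<epsilon> + W.conv_op w r m \<epsilon>"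
      using W.solution_exists[OF g] K2 cA by auto
    interpret P: borel_laplace_solution q "real k2" \<nu> \<beta> \<mu> dp \<delta>t b "2 * (K2 / cA)" B w "real N" M \<zeta>0 J bc Cc \<rho>f sf
      N dD n e \<kappa>f Q "R D" "\<lambda>lj. R (fst lj)" \<psi>2
    proof (unfold_locales)
      show "\<mu> > 1" using \<beta>\<mu> by simp
      show "0 \<le> 2 * (K2 / cA)" using K2 cA by simp
      show "sf lj = q powr (e lj - 1 - real (n lj) / real k2)" for lj by (simp add: sf_def x_def algebra_simps)
      show "\<rho>f lj = (\<lambda>x. poly (R (fst lj)) (\<i> * of_real x))" for lj by (simp add: \<rho>f_def)
      fix v m \<epsilon> assume \<epsilon>: "\<epsilon> \<in> B" and v: "v > (0::real)"
      have A0: "A v m \<noteq> 0" using Apos[OF v] by fastforce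
      have "A v m * w v m \<epsilon> = A v m * g v m \<epsilon> + (\<Sum>lj\<in>J. A v m * (bc lj v m \<epsilon> * W.conv lj w v m \<epsilon>))"
        unfolding weq[OF \<epsilon>, of v m] W.conv_op_def distrib_left sum_distrib_left ..
      also have "A v m * g v m \<epsilon> = \<psi>2 v m \<epsilon>" using A0 v by (simp add: g_def)
      also have "(\<Sum>lj\<in>J. A v m * (bc lj v m \<epsilon> * W.conv lj w v m \<epsilon>)) = (\<Sum>lj\<in>J. \<kappa>f lj \<epsilon> * of_real (shift_coeff q (real k2) (n lj)) * (of_real v * cis dp) ^ n lj / of_real (sqrt (2 * pi)) * W.conv lj w v m \<epsilon>)"
        using A0 v by (intro sum.cong refl) (simp add: bc_def)
      finally show "(poly Q (\<i> * of_real m) - poly (R D) (\<i> * of_real m) * of_real (shift_coeff q (real k2) dD) * (of_real v * cis dp) ^ dD) * w v m \<epsilon>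
        = \<psi>2 v m \<epsilon> + (\<Sum>lj\<in>J. \<kappa>f lj \<epsilon> * of_real (shift_coeff q (real k2) (n lj)) * (of_real v * cis dp) ^ n lj / of_real (sqrt (2 * pi)) * W.conv lj w v m \<epsilon>)"
        unfolding A_eq .
    qed (use q k2 pos bpos bln B w in auto)
    have reg: "\<epsilon> * t \<in> P.L.region" if "t \<in> TT" "\<epsilon> \<in> E p" for t \<epsilon>
      using assoc3(2)[OF p that] Rb[of p] unfolding P.L.region_def unfolding dp_def b_def by auto
    have "solves_equation q k2 D dD \<delta>s I d \<Delta> Q R (\<lambda>j l z \<epsilon>. inv_fourier (\<lambda>m. C j l m \<epsilon>) z)
             (f_forcing q \<kappa> k2 (dir p) (\<psi> p)) TT (strip \<beta>') (E p) P.L.u" if \<beta>': "\<beta>' < \<beta>" for \<beta>'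
      unfolding solves_equation_def
    proof (intro ballI impI)
      fix t z \<epsilon> assume t: "t \<in> TT" and z: "z \<in> strip \<beta>'" and \<epsilon>: "\<epsilon> \<in> E p"
        and dil: "\<forall>\<gamma>\<in>{1, real dD / real k2 + 1} \<union> (\<lambda>l. real (\<delta>s l)) ` {1..D - 1}. of_real (q powr \<gamma>) * t \<in> TT"
      define T where "T = \<epsilon> * t"
      have zb: "z \<in> strip \<beta>" using z \<beta>' by (auto simp: strip_def)
      have \<epsilon>B: "\<epsilon> \<in> B" using EB[OF p] \<epsilon> by blast
      have q1: "q powr 1 = q" using q by simp
      have r1: "of_real (q powr a) * T \<in> P.L.region" if "of_real (q powr a) * t \<in> TT" for a
        using reg[OF that \<epsilon>] by (simp add: T_def mult_ac)
      have R1: "of_real q * T \<in> P.L.region" using r1[of 1] dil q1 by auto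
      have RD: "of_real (q powr (real dD / real k2 + 1)) * T \<in> P.L.region" using dil by (intro r1) auto
      have Rj: "of_real (q powr e lj) * T \<in> P.L.region" if "lj \<in> J" for lj
        using dil JD[OF that] unfolding e_def by (intro r1) auto
      have uT: "P.L.u (of_real a * t) z \<epsilon> = inv_fourier (\<lambda>m. P.L.U (of_real a * T) m \<epsilon>) z" for a z
        by (simp add: P.L.u_def T_def mult_ac)
      have f: "sigma_q q 1 (\<lambda>t. f_forcing q \<kappa> k2 (dir p) (\<psi> p) t z \<epsilon>) t = inv_fourier (\<lambda>m. \<integral>v. \<psi>2 v m \<epsilon> * P.L.kern (of_real q * T) v \<partial>lborel) z"
        unfolding P.L.kern_def unfolding sigma_q_def q1 f_forcing_def F_forcing_def q_laplace_eq_kernel \<psi>2_def T_def dp_def by (simp add: mult_ac)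
      have "(\<Sum>l=1..D-1. \<Sum>j\<in>I l. t ^ d j l * \<epsilon> ^ \<Delta> j l * sigma_q q (real (\<delta>s l)) (\<lambda>t. inv_fourier (\<lambda>m. C j l m \<epsilon>) z * diff_op (R l) (\<lambda>z. P.L.u t z \<epsilon>) z) t)
        = (\<Sum>lj\<in>J. t ^ d (snd lj) (fst lj) * \<epsilon> ^ \<Delta> (snd lj) (fst lj) * (inv_fourier (\<lambda>m. C (snd lj) (fst lj) m \<epsilon>) z * diff_op (R (fst lj)) (\<lambda>z. P.L.u (of_real (q powr real (\<delta>s (fst lj))) * t) z \<epsilon>) z))"
        unfolding J_def using I by (subst sum.Sigma) (auto simp: sigma_q_def case_prod_unfold)
      also have "\<dots> = (\<Sum>lj\<in>J. \<kappa>f lj \<epsilon> * T ^ n lj * (inv_fourier (\<lambda>m. Cc lj m \<epsilon>) z * diff_op (R (fst lj)) (inv_fourier (\<lambda>m. P.L.U (of_real (q powr e lj) * T) m \<epsilon>)) z))"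
      proof (rule sum.cong[OF refl])
        fix lj assume lj: "lj \<in> J"
        have "\<Delta> (snd lj) (fst lj) = (\<Delta> (snd lj) (fst lj) - d (snd lj) (fst lj)) + d (snd lj) (fst lj)"
          using \<Delta>[OF JD[OF lj]] by simp
        then have "t ^ d (snd lj) (fst lj) * \<epsilon> ^ \<Delta> (snd lj) (fst lj) = \<kappa>f lj \<epsilon> * T ^ n lj"
          unfolding \<kappa>f_def n_def T_def power_mult_distrib by (metis mult.assoc mult.commute power_add)
        then show "t ^ d (snd lj) (fst lj) * \<epsilon> ^ \<Delta> (snd lj) (fst lj) * (inv_fourier (\<lambda>m. C (snd lj) (fst lj) m \<epsilon>) z * diff_op (R (fst lj)) (\<lambda>z. P.L.u (of_real (q powr real (\<delta>s (fst lj))) * t) z \<epsilon>) z)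
          = \<kappa>f lj \<epsilon> * T ^ n lj * (inv_fourier (\<lambda>m. Cc lj m \<epsilon>) z * diff_op (R (fst lj)) (inv_fourier (\<lambda>m. P.L.U (of_real (q powr e lj) * T) m \<epsilon>)) z)"
          by (simp only: uT Cc_def e_def)
      qed
      finally have sums: "(\<Sum>l=1..D-1. \<Sum>j\<in>I l. t ^ d j l * \<epsilon> ^ \<Delta> j l * sigma_q q (real (\<delta>s l)) (\<lambda>t. inv_fourier (\<lambda>m. C j l m \<epsilon>) z * diff_op (R l) (\<lambda>z. P.L.u t z \<epsilon>) z) t)
        = (\<Sum>lj\<in>J. \<kappa>f lj \<epsilon> * T ^ n lj * (inv_fourier (\<lambda>m. Cc lj m \<epsilon>) z * diff_op (R (fst lj)) (inv_fourier (\<lambda>m. P.L.U (of_real (q powr e lj) * T) m \<epsilon>)) z))" .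
      show "diff_op Q (\<lambda>z. sigma_q q 1 (\<lambda>t. P.L.u t z \<epsilon>) t) z =
          (\<epsilon> * t) ^ dD * sigma_q q (real dD / real k2 + 1) (\<lambda>t. diff_op (R D) (\<lambda>z. P.L.u t z \<epsilon>) z) t
          + (\<Sum>l=1..D-1. \<Sum>j\<in>I l. t ^ d j l * \<epsilon> ^ \<Delta> j l * sigma_q q (real (\<delta>s l)) (\<lambda>t. inv_fourier (\<lambda>m. C j l m \<epsilon>) z * diff_op (R l) (\<lambda>z. P.L.u t z \<epsilon>) z) t)
          + sigma_q q 1 (\<lambda>t. f_forcing q \<kappa> k2 (dir p) (\<psi> p) t z \<epsilon>) t"
        unfolding f sums unfolding sigma_q_def q1 uT T_def[symmetric]
        by (rule P.fourier_equation[OF R1 RD Rj \<epsilon>B zb])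
    qed
    moreover have "holomorphic3_on P.L.u (TT \<times> strip \<beta>' \<times> E p)" if "\<beta>' < \<beta>" for \<beta>'
      by (rule P.L.u_holomorphic3[OF oTT EB[OF p] reg]) (use that in auto)
    ultimately show "\<exists>u. \<forall>\<beta>'. 0 < \<beta>' \<and> \<beta>' < \<beta> \<longrightarrow>
           holomorphic3_on u (TT \<times> strip \<beta>' \<times> E p) \<and>
           solves_equation q k2 D dD \<delta>s I d \<Delta> Q R (\<lambda>j l z \<epsilon>. inv_fourier (\<lambda>m. C j l m \<epsilon>) z)
             (f_forcing q \<kappa> k2 (dir p) (\<psi> p)) TT (strip \<beta>') (E p) u"
      by blast
  qed (use \<zeta>0 in auto)
qed

end
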